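(* Let $1<p<\infty$ and let $(X,d,\mu)$ be a complete metric space with a doubling measure $\mu$ supporting a (global) $p$-Poincaré inequality. Fix $x_0\in X$, let $\Omega$ be a bounded domain containing $x_0$ and let $u$ be a Green function in $\Omega$ with singularity at $x_0$. Let $t_p=\overline{s}_0(p-1)/(\overline{s}_0-1)$ and $\hat q=\underline{q}_0+1-\underline{q}_0/\overline{s}_0$. (a) If $p<\overline{s}_0$, then $g_u\notin L^t(\Omega)$ whenever $\mu$ supports a $t$-Poincaré inequality at $x_0$ for small radii, $t>t_p$ and $t\ge1$. (b) If $p<\hat q$, $t_p\ge1$ and $\overline{s}_0\notin\overline{S}_0\setminus\underline{S}_0$, then $g_u\notin L^{t_p}(\Omega)$ whenever $\mu$ supports a $t_p$-Poincaré inequality at $x_0$ for small radii. (c) If $\hat q\le p<\overline{s}_0$, $\overline{s}_0\notin\overline{S}_0\setminus\underline{S}_0$ and $\underline{q}_0>1$, then $g_u\notin L^{t_p}(\Omega)$ whenever $\mu$ supports a $t_0$-Poincaré inequality at $x_0$ for small radii and some $1\le t_0<t_p$.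
   Context: With $B_r=B(x_0,r)$: $\overline{S}_0=\{s>0:\exists C_s>0,\ \mu(B_r)\ge C_sr^s\ (0<r\le1)\}$, $\underline{S}_0=\{s>0:\exists C_s>0,\ \mu(B_r)\le C_sr^s\ (0<r\le1)\}$, $\underline{Q}_0=\{q>0:\exists C_q,\ \mu(B_r)/\mu(B_R)\le C_q(r/R)^q\ (0<r<R\le1)\}$, $\overline{s}_0=\inf\overline{S}_0$, $\underline{q}_0=\sup\underline{Q}_0$. Functions are defined everywhere; $\mu$ positive complete Borel, $0<\mu(B)<\infty$. Minimal $q$-weak upper gradients: Borel $g\ge0$ with $|u(\gamma(0))-u(\gamma(l_\gamma))|\le\int_\gamma g\,ds$ for all nonconstant compact rectifiable curves outside a family of zero $q$-modulus; for the Green function $u$, $g_u$ is the minimal $p$-weak upper gradient of $u$ in $\Omega\setminus\{x_0\}$ regarded as a.e. defined on $\Omega$. $N^{1,p}$, $N^{1,p}_{\mathrm{loc}}$: $\int|u|^p+\inf_g\int g^p<\infty$; $N^{1,p}_0(\Omega)$: restrictions of $u\in N^{1,p}(X)$ vanishing outside $\Omega$; $C_p(E)=\inf\|u\|^p_{N^{1,p}(X)}$ over $u\ge1$ on $E$; $\mathrm{cap}_p(E,\Omega)=\inf\int_\Omega g_u^p$ over $u\in N^{1,p}_0(\Omega)$, $u\ge1$ on $E$. Doubling: $\mu(B(x,2r))\le C\mu(B(x,r))$. A $q$-Poincaré inequality on $B=B(x,r)$: $\frac1{\mu(B)}\int_B|u-u_B|\le Cr(\frac1{\mu(\lambda B)}\int_{\lambda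 B}g^q)^{1/q}$ for integrable $u$ and $q$-weak upper gradients $g$; global if for all balls; at $x_0$ for small radii if for all $B(x_0,r)$, $0<r\le R_0$, some $R_0>0$. $p$-harmonic: real-valued continuous $u\in N^{1,p}_{\mathrm{loc}}(U)$ with $\int_{\phi\ne0}g_u^p\le\int_{\phi\ne0}g_{u+\phi}^p$ for all $\phi\in N^{1,p}_0(U)$. Superharmonic in $U$: lower semicontinuous $u:U\to(-\infty,\infty]$, not $\equiv\infty$ in any component, $v\le u$ in $G$ whenever $G\Subset U$ nonempty open, $C_p(X\setminus G)>0$, $v\in C(\overline G)$ $p$-harmonic in $G$, $v\le u$ on $\partial G$. Singular function in bounded domain $\Omega\ni x_0$: $u:\Omega\to(0,\infty]$ superharmonic, $p$-harmonic in $\Omega\setminus\{x_0\}$, $u(x_0)=\sup u$, $\inf u=0$, extension by $0$ in $N^{1,p}_{\mathrm{loc}}(X\setminus\{x_0\})$. Green function: singular with $\mathrm{cap}_p(\{u\ge b\},\Omega)=b^{1-p}$ for $0<b<u(x_0)$. *)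

theory Defs
  imports "HOL-Analysis.Analysis"
begin

definition curve_length :: "(real \<Rightarrow> 'a::metric_space) \<Rightarrow> real \<Rightarrow> real \<Rightarrow> ennreal" where
  "curve_length \<gamma> a b =
     (SUP ts \<in> {ts. sorted ts \<and> set ts \<subseteq> {a..b}}.
        ennreal (\<Sum>i<length ts - 1. dist (\<gamma> (ts ! i)) (\<gamma> (ts ! Suc i))))"

text \<open>A nonconstant compact rectifiable curve, given by its arc length
  parametrisation gamma on [0,l], l > 0.\<close>
definition arc_curve :: "(real \<Rightarrow> 'a::metric_space) \<Rightarrow> real \<Rightarrow> bool" where
  "arc_curve \<gamma> l \<longleftrightarrow> 0 < l \<and>
     (\<forall>s t. 0 \<le> s \<and> s \<le> t \<and> t \<le> l \<longrightarrow> curve_length \<gamma> s t = ennreal (t - s))"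

definition line_int :: "('a \<Rightarrow> ennreal) \<Rightarrow> (real \<Rightarrow> 'a) \<Rightarrow> real \<Rightarrow> ennreal" where
  "line_int g \<gamma> l = (\<integral>\<^sup>+ t. g (\<gamma> t) * indicator {0..l} t \<partial>lborel)"

definition curves_in :: "'a::metric_space set \<Rightarrow> ((real \<Rightarrow> 'a) \<times> real) set" where
  "curves_in U = {(\<gamma>, l). arc_curve \<gamma> l \<and> \<gamma> ` {0..l} \<subseteq> U}"

definition epow :: "ennreal \<Rightarrow> real \<Rightarrow> ennreal" where
  "epow x q = (if x = \<infinity> then \<infinity> else ennreal (enn2real x powr q))"

definition modulus :: "'a::metric_space measure \<Rightarrow> real \<Rightarrow> ((real \<Rightarrow> 'a) \<times> real) set \<Rightarrow> ennreal" where
  "modulus M q \<Gamma> =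
     (INF \<rho> \<in> {\<rho>. \<rho> \<in> borel_measurable borel \<and> (\<forall>(\<gamma>, l) \<in> \<Gamma>. 1 \<le> line_int \<rho> \<gamma> l)}.
        \<integral>\<^sup>+ x. epow (\<rho> x) q \<partial>M)"

definition weak_ug :: "'a::metric_space measure \<Rightarrow> real \<Rightarrow> 'a set \<Rightarrow> ('a \<Rightarrow> real) \<Rightarrow> ('a \<Rightarrow> ennreal) \<Rightarrow> bool" where
  "weak_ug M q U u g \<longleftrightarrow> g \<in> borel_measurable borel \<and>
     modulus M q {(\<gamma>, l) \<in> curves_in U.
        \<not> (ennreal \<bar>u (\<gamma> 0) - u (\<gamma> l)\<bar> \<le> line_int g \<gamma> l)} = 0"

definition Lp_loc :: "'a::metric_space measure \<Rightarrow> real \<Rightarrow> 'a set \<Rightarrow> ('a \<Rightarrow> ennreal) \<Rightarrow> bool" where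
  "Lp_loc M q U g \<longleftrightarrow> (\<forall>x\<in>U. \<exists>r>0. ball x r \<subseteq> U \<and>
     (\<integral>\<^sup>+ y \<in> ball x r. epow (g y) q \<partial>M) < \<infinity>)"

definition minimal_wug :: "'a::metric_space measure \<Rightarrow> real \<Rightarrow> 'a set \<Rightarrow> ('a \<Rightarrow> real) \<Rightarrow> ('a \<Rightarrow> ennreal) \<Rightarrow> bool" where
  "minimal_wug M q U u g \<longleftrightarrow> weak_ug M q U u g \<and> Lp_loc M q U g \<and>
     (\<forall>g'. weak_ug M q U u g' \<and> Lp_loc M q U g' \<longrightarrow> (AE x in M. x \<in> U \<longrightarrow> g x \<le> g' x))"

definition newton :: "'a::metric_space measure \<Rightarrow> real \<Rightarrow> 'a set \<Rightarrow> ('a \<Rightarrow> real) \<Rightarrow> bool" where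
  "newton M p U u \<longleftrightarrow> (\<lambda>x. indicator U x * u x) \<in> borel_measurable M \<and>
     (\<integral>\<^sup>+ x \<in> U. ennreal (\<bar>u x\<bar> powr p) \<partial>M) < \<infinity> \<and>
     (\<exists>g. weak_ug M p U u g \<and> (\<integral>\<^sup>+ x \<in> U. epow (g x) p \<partial>M) < \<infinity>)"

definition newton_loc :: "'a::metric_space measure \<Rightarrow> real \<Rightarrow> 'a set \<Rightarrow> ('a \<Rightarrow> real) \<Rightarrow> bool" where
  "newton_loc M p U u \<longleftrightarrow> (\<forall>x\<in>U. \<exists>r>0. ball x r \<subseteq> U \<and> newton M p (ball x r) u)"

definition newton0 :: "'a::metric_space measure \<Rightarrow> real \<Rightarrow> 'a set \<Rightarrow> ('a \<Rightarrow> real) \<Rightarrow> bool" where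
  "newton0 M p U u \<longleftrightarrow> (\<exists>v. newton M p UNIV v \<and> (\<forall>x\<in>U. v x = u x) \<and> (\<forall>x. x \<notin> U \<longrightarrow> v x = 0))"

definition Sobolev_cap :: "'a::metric_space measure \<Rightarrow> real \<Rightarrow> 'a set \<Rightarrow> ennreal" where
  "Sobolev_cap M p E =
     (INF u \<in> {u. newton M p UNIV u \<and> (\<forall>x\<in>E. 1 \<le> u x)}.
        (\<integral>\<^sup>+ x. ennreal (\<bar>u x\<bar> powr p) \<partial>M) +
        (INF g \<in> {g. weak_ug M p UNIV u g}. \<integral>\<^sup>+ x. epow (g x) p \<partial>M))"

definition cond_cap :: "'a::metric_space measure \<Rightarrow> real \<Rightarrow> 'a set \<Rightarrow> 'a set \<Rightarrow> ennreal" where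
  "cond_cap M p E \<Omega> =
     (INF ug \<in> {(u, g). newton M p UNIV u \<and> (\<forall>x. x \<notin> \<Omega> \<longrightarrow> u x = 0) \<and>
                        (\<forall>x\<in>E. 1 \<le> u x) \<and> minimal_wug M p UNIV u g}.
        \<integral>\<^sup>+ x \<in> \<Omega>. epow (snd ug x) p \<partial>M)"

definition p_harmonic :: "'a::metric_space measure \<Rightarrow> real \<Rightarrow> 'a set \<Rightarrow> ('a \<Rightarrow> real) \<Rightarrow> bool" where
  "p_harmonic M p U u \<longleftrightarrow> continuous_on U u \<and> newton_loc M p U u \<and>
     (\<forall>\<phi> g h. newton0 M p U \<phi> \<and> minimal_wug M p U u g \<and> minimal_wug M p U (\<lambda>x. u x + \<phi> x) h \<longrightarrow>
        (\<integral>\<^sup>+ x \<in> {x\<in>U. \<phi> x \<noteq> 0}. epow (g x) p \<partial>M) \<le> (\<integral>\<^sup>+ x \<in> {x\<in>U. \<phi> x \<noteq> 0}. epow (h x) p \<partial>M))"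

definition superharmonic :: "'a::metric_space measure \<Rightarrow> real \<Rightarrow> 'a set \<Rightarrow> ('a \<Rightarrow> ereal) \<Rightarrow> bool" where
  "superharmonic M p U u \<longleftrightarrow>
     (\<forall>x\<in>U. u x \<noteq> -\<infinity>) \<and>
     (\<forall>x\<in>U. \<forall>a. a < u x \<longrightarrow> (\<exists>e>0. \<forall>y\<in>U. dist y x < e \<longrightarrow> a < u y)) \<and>
     (\<forall>C \<in> components U. \<exists>x\<in>C. u x \<noteq> \<infinity>) \<and>
     (\<forall>G v. open G \<and> G \<noteq> {} \<and> compact (closure G) \<and> closure G \<subseteq> U \<and>
            0 < Sobolev_cap M p (- G) \<and> continuous_on (closure G) v \<and> p_harmonic M p G v \<and>
            (\<forall>x\<in>frontier G. ereal (v x) \<le> u x) \<longrightarrow> (\<forall>x\<in>G. ereal (v x) \<le> u x))"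

definition singular_fun :: "'a::metric_space measure \<Rightarrow> real \<Rightarrow> 'a set \<Rightarrow> 'a \<Rightarrow> ('a \<Rightarrow> ereal) \<Rightarrow> bool" where
  "singular_fun M p \<Omega> x0 u \<longleftrightarrow>
     (\<forall>x\<in>\<Omega>. 0 < u x) \<and> (\<forall>x\<in>\<Omega> - {x0}. u x \<noteq> \<infinity>) \<and>
     superharmonic M p \<Omega> u \<and>
     p_harmonic M p (\<Omega> - {x0}) (\<lambda>x. real_of_ereal (u x)) \<and>
     u x0 = (SUP x\<in>\<Omega>. u x) \<and> (INF x\<in>\<Omega>. u x) = 0 \<and>
     newton_loc M p (UNIV - {x0}) (\<lambda>x. if x \<in> \<Omega> then real_of_ereal (u x) else 0)"

definition green_fun :: "'a::metric_space measure \<Rightarrow> real \<Rightarrow> 'a set \<Rightarrow> 'a \<Rightarrow> ('a \<Rightarrow> ereal) \<Rightarrow> bool" where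
  "green_fun M p \<Omega> x0 u \<longleftrightarrow> singular_fun M p \<Omega> x0 u \<and>
     (\<forall>b::real. 0 < b \<and> ereal b < u x0 \<longrightarrow>
        cond_cap M p {x\<in>\<Omega>. ereal b \<le> u x} \<Omega> = ennreal (b powr (1 - p)))"

definition doubling :: "'a::metric_space measure \<Rightarrow> bool" where
  "doubling M \<longleftrightarrow> (\<exists>C. \<forall>x r. 0 < r \<longrightarrow> emeasure M (ball x (2 * r)) \<le> ennreal C * emeasure M (ball x r))"

definition poincare_ball :: "'a::metric_space measure \<Rightarrow> real \<Rightarrow> real \<Rightarrow> real \<Rightarrow> 'a \<Rightarrow> real \<Rightarrow> bool" where
  "poincare_ball M q C lam x r \<longleftrightarrow>
     (\<forall>u g. integrable M u \<and> weak_ug M q UNIV u g \<longrightarrow>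
        (let B = ball x r; uB = (\<integral> y \<in> B. u y \<partial>M) / measure M B in
          (\<integral>\<^sup>+ y \<in> B. ennreal \<bar>u y - uB\<bar> \<partial>M) / emeasure M B
            \<le> ennreal (C * r) *
              epow ((\<integral>\<^sup>+ y \<in> ball x (lam * r). epow (g y) q \<partial>M) / emeasure M (ball x (lam * r))) (1 / q)))"

definition poincare_global :: "'a::metric_space measure \<Rightarrow> real \<Rightarrow> bool" where
  "poincare_global M q \<longleftrightarrow> (\<exists>C>0. \<exists>lam\<ge>1. \<forall>x r. 0 < r \<longrightarrow> poincare_ball M q C lam x r)"

definition poincare_at :: "'a::metric_space measure \<Rightarrow> real \<Rightarrow> 'a \<Rightarrow> bool" where
  "poincare_at M q x0 \<longleftrightarrow>
     (\<exists>C>0. \<exists>lam\<ge>1. \<exists>R0>0. \<forall>r. 0 < r \<and> r \<le> R0 \<longrightarrow> poincare_ball M q C lam x0 r)"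

definition S0_upper :: "'a::metric_space measure \<Rightarrow> 'a \<Rightarrow> real set" where
  "S0_upper M x0 = {s. 0 < s \<and> (\<exists>C>0. \<forall>r. 0 < r \<and> r \<le> 1 \<longrightarrow>
      ennreal (C * r powr s) \<le> emeasure M (ball x0 r))}"

definition S0_lower :: "'a::metric_space measure \<Rightarrow> 'a \<Rightarrow> real set" where
  "S0_lower M x0 = {s. 0 < s \<and> (\<exists>C>0. \<forall>r. 0 < r \<and> r \<le> 1 \<longrightarrow>
      emeasure M (ball x0 r) \<le> ennreal (C * r powr s))}"

definition Q0_lower :: "'a::metric_space measure \<Rightarrow> 'a \<Rightarrow> real set" where
  "Q0_lower M x0 = {q. 0 < q \<and> (\<exists>C. \<forall>r R. 0 < r \<and> r < R \<and> R \<le> 1 \<longrightarrow>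
      emeasure M (ball x0 r) / emeasure M (ball x0 R) \<le> ennreal (C * (r / R) powr q))}"

definition s0_upper :: "'a::metric_space measure \<Rightarrow> 'a \<Rightarrow> real" where
  "s0_upper M x0 = Inf (S0_upper M x0)"

definition q0_lower :: "'a::metric_space measure \<Rightarrow> 'a \<Rightarrow> real" where
  "q0_lower M x0 = Sup (Q0_lower M x0)"

end

theory Submission
  imports Defs
begin

text \<open>Write \<open>B\<^sub>r\<close> for the ball around \<open>x0\<close>. Testing the minimality of the Green function \<open>u\<close> against
  \<open>\<phi> = \<epsilon> (b \<eta> - min u b)\<close> for a cutoff \<open>\<eta>\<close> of \<open>B\<^sub>r\<close> in \<open>B\<^sub>2\<^sub>r\<close> and letting \<open>\<epsilon>\<close> tend to \<open>0\<close> bounds the energy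
  of \<open>u\<close> below level \<open>b\<close> by \<open>b\<close> times the integral of \<open>g\<^sub>u\<^bsup>p-1\<^esup> g\<^sub>\<eta>\<close>; the capacity normalisation bounds that
  energy from below by \<open>b\<close>. Hence the integral of \<open>g\<^sub>u\<^bsup>p-1\<^esup>\<close> over \<open>B\<^sub>2\<^sub>r\<close> is at least \<open>r/4\<close>, and Young's
  inequality turns this into a lower bound \<open>c (r\<^sup>s / \<mu>(B\<^sub>r))\<^sup>\<kappa>\<close> for the integral of \<open>g\<^sub>u\<^sup>t\<close> over \<open>B\<^sub>r\<close>, where
  \<open>s = t/(t-p+1)\<close> and \<open>\<kappa> = (t-p+1)/(p-1)\<close>. If \<open>g\<^sub>u\<close> were in \<open>L\<^sup>t\<close>, then \<open>s\<close> would lie in the upper but not in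
  the lower exponent set; since \<open>s < s0\<close> for \<open>t > tp\<close> and \<open>s = s0\<close> for \<open>t = tp\<close>, this is impossible.\<close>

section \<open>Powers of extended reals and arc length parametrised curves\<close>

text \<open>No Euler-Lagrange equation is at hand in a metric space: \<open>p_harmonic\<close> only
  compares energies of minimal weak upper gradients. A one-sided variation takes its place, and both
  this comparison and \<open>cond_cap\<close> call for minimal gradients, so their existence has to
  be established. The obstacle is the singularity, near which \<open>g\<close> need not be
  \<open>p\<close>-integrable. The functions \<open>b \<eta>\<close> and \<open>min u b\<close> both
  equal \<open>b\<close> near \<open>x0\<close> and vanish outside \<open>\<Omega>\<close>, so their
  difference is admissible in \<open>\<Omega> - {x0}\<close> and lives where \<open>g\<close> is
  \<open>p\<close>-integrable. The identity \<open>u = min u b + max u b - b\<close> explains the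
  choice: the perturbation scales the gradient by \<open>1 - \<epsilon>\<close> below level
  \<open>b\<close> and leaves it alone above. The upper bound is \<open>b\<close> times the flux and
  the lower bound is \<open>b\<close>; the level cancels, so the flux estimate depends on the radius
  alone. Finally, \<open>t / (t - p + 1)\<close> is the inverse of the decreasing map sending
  \<open>s\<close> to \<open>s (p - 1) / (s - 1)\<close>, which is where \<open>tp\<close> comes
  from.\<close>

lemma epow_zero [simp]: "epow 0 q = 0"
  by (simp add: epow_def)

lemma epow_top [simp]: "epow \<infinity> q = \<infinity>" "epow top q = top"
  by (simp_all add: epow_def)

lemma epow_ennreal: "0 \<le> x \<Longrightarrow> epow (ennreal x) q = ennreal (x powr q)"
  by (simp add: epow_def)

lemma epow_le_iff:
  assumes "0 < q"
  shows "epow x q \<le> y \<longleftrightarrow> x \<le> epow y (1 / q)"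
proof (cases x rule: ennreal_cases)
  case x: (real a)
  show ?thesis
  proof (cases y rule: ennreal_cases)
    case y: (real b)
    have "a powr q \<le> b \<longleftrightarrow> a \<le> b powr (1 / q)"
    proof
      assume "a powr q \<le> b"
      then have "(a powr q) powr (1/q) \<le> b powr (1/q)"
        using assms by (intro powr_mono2) auto
      then show "a \<le> b powr (1/q)" using x assms by (simp add: powr_powr)
    next
      assume "a \<le> b powr (1/q)"
      then have "a powr q \<le> (b powr (1/q)) powr q"
        using assms x by (intro powr_mono2) auto
      then show "a powr q \<le> b" using y assms by (simp add: powr_powr)
    qed
    then show ?thesis using x y by (simp add: epow_ennreal)
  qed simp
next
  case top
  then show ?thesis
    by (cases y rule: ennreal_cases) (auto simp: epow_ennreal top_unique)
qed

lemma epow_mono: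
  assumes "0 < q" "x \<le> y"
  shows "epow x q \<le> epow y q"
proof -
  have "y \<le> epow (epow y q) (1 / q)" using epow_le_iff[of q y "epow y q"] assms by simp
  then show ?thesis using epow_le_iff[of q x "epow y q"] assms by (meson order_trans)
qed

lemma epow_mult: "epow (ennreal c * x) q = ennreal (c powr q) * epow x q" if "0 < c"
proof (cases x rule: ennreal_cases)
  case (real a)
  then show ?thesis using that
    by (simp add: epow_ennreal powr_mult flip: ennreal_mult)
next
  case top
  then show ?thesis using that by (simp add: ennreal_mult_top)
qed

lemma epow_max_le: "epow (max x y) q \<le> epow x q + epow y q"
  by (auto simp: max_def)

text \<open>The crude estimate through \<open>2 * max x y\<close> holds for all
  \<open>q > 0\<close>, also where convexity fails. Only finiteness is drawn from it, so the
  constant is immaterial.\<close>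

lemma epow_add_le:
  assumes "0 < q"
  shows "epow (x + y) q \<le> ennreal (2 powr q) * (epow x q + epow y q)"
proof -
  have "x + y \<le> ennreal 2 * max x y"
    by (metis add_mono ennreal_numeral max.cobounded1 max.cobounded2 mult_2)
  then have "epow (x + y) q \<le> ennreal (2 powr q) * epow (max x y) q"
    using epow_mono[OF assms, of "x + y" "ennreal 2 * max x y"] epow_mult[of 2 "max x y" q] by simp
  also have "\<dots> \<le> ennreal (2 powr q) * (epow x q + epow y q)"
    by (intro mult_left_mono epow_max_le assms) simp
  finally show ?thesis .
qed

lemma epow_measurable [measurable]:
  assumes [measurable]: "f \<in> borel_measurable N"
  shows "(\<lambda>x. epow (f x) q) \<in> borel_measurable N"
  unfolding epow_def by measurable

lemma epow_mult_indicator: "epow (x * indicator A y) q = epow x q * indicator A y"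
  by (simp split: split_indicator)

section \<open>Arc length parametrised curves, their subcurves and line integrals\<close>

lemma arc_curve_dist_le:
  assumes "arc_curve \<gamma> l" "0 \<le> s" "s \<le> t" "t \<le> l"
  shows "dist (\<gamma> s) (\<gamma> t) \<le> t - s"
proof -
  \<comment> \<open>The partition \<open>[s,t]\<close> competes in the supremum that defines the
    length, so the chord is at most the arc.\<close>
  have "ennreal (\<Sum>i<length [s,t] - 1. dist (\<gamma> ([s,t] ! i)) (\<gamma> ([s,t] ! Suc i))) \<le> curve_length \<gamma> s t"
    unfolding curve_length_def using assms by (intro SUP_upper) auto
  also have "\<dots> = ennreal (t - s)" using assms by (auto simp: arc_curve_def)
  finally show ?thesis using assms by (simp add: ennreal_le_iff)
qed

lemma arc_curve_continuous:
  assumes "arc_curve \<gamma> l"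
  shows "continuous_on {0..l} \<gamma>"
proof (rule continuous_onI)
  fix x e :: real assume *: "x \<in> {0..l}" "0 < e"
  have "dist (\<gamma> y) (\<gamma> x) \<le> \<bar>y - x\<bar>" if "y \<in> {0..l}" for y
    using arc_curve_dist_le[OF assms, of x y] arc_curve_dist_le[OF assms, of y x] that *
    by (cases "x \<le> y") (auto simp: dist_commute)
  then show "\<exists>d>0. \<forall>x'\<in>{0..l}. dist x' x < d \<longrightarrow> dist (\<gamma> x') (\<gamma> x) \<le> e"
    using * by (intro exI[of _ e]) (force simp: dist_real_def)
qed

text \<open>A curve is continuous on \<open>{0..l}\<close> only and arbitrary elsewhere, so
  \<open>g \<circ> \<gamma>\<close> becomes measurable only after multiplication with an
  indicator.\<close>

lemma curve_measurable:
  fixes g :: "'a::metric_space \<Rightarrow> ennreal"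
  assumes "arc_curve \<gamma> l" and [measurable]: "g \<in> borel_measurable borel"
    and "A \<in> sets borel" "A \<subseteq> {0..l}"
  shows "(\<lambda>x. g (\<gamma> x) * indicator A x) \<in> borel_measurable borel"
proof -
  have [measurable]: "\<gamma> \<in> borel_measurable (restrict_space borel A)"
    by (intro borel_measurable_continuous_on_restrict continuous_on_subset[OF arc_curve_continuous[OF assms(1)]] assms)
  have "(\<lambda>x. g (\<gamma> x)) \<in> borel_measurable (restrict_space borel A)"
    by measurable
  then show ?thesis
    using assms(3) by (subst (asm) borel_measurable_restrict_space_iff_ennreal) auto
qed

lemma curve_length_shift:
  "curve_length (\<lambda>x. \<gamma> (c + x)) a b = curve_length \<gamma> (c + a) (c + b)"
proof (rule antisym)
  show "curve_length (\<lambda>x. \<gamma> (c + x)) a b \<le> curve_length \<gamma> (c + a) (c + b)"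
    unfolding curve_length_def
  proof (rule SUP_mono)
    fix ts :: "real list" assume ts: "ts \<in> {ts. sorted ts \<and> set ts \<subseteq> {a..b}}"
    show "\<exists>ss\<in>{ts. sorted ts \<and> set ts \<subseteq> {c + a..c + b}}.
        ennreal (\<Sum>i<length ts - 1. dist (\<gamma> (c + ts ! i)) (\<gamma> (c + ts ! Suc i)))
        \<le> ennreal (\<Sum>i<length ss - 1. dist (\<gamma> (ss ! i)) (\<gamma> (ss ! Suc i)))"
      using ts by (intro bexI[of _ "map ((+) c) ts"]) (auto simp: sorted_map intro: sorted_wrt_mono_rel)
  qed
  show "curve_length \<gamma> (c + a) (c + b) \<le> curve_length (\<lambda>x. \<gamma> (c + x)) a b"
    unfolding curve_length_def
  proof (rule SUP_mono)
    fix ts :: "real list" assume ts: "ts \<in> {ts. sorted ts \<and> set ts \<subseteq> {c + a..c + b}}"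
    show "\<exists>ss\<in>{ts. sorted ts \<and> set ts \<subseteq> {a..b}}.
        ennreal (\<Sum>i<length ts - 1. dist (\<gamma> (ts ! i)) (\<gamma> (ts ! Suc i)))
        \<le> ennreal (\<Sum>i<length ss - 1. dist (\<gamma> (c + ss ! i)) (\<gamma> (c + ss ! Suc i)))"
      using ts by (intro bexI[of _ "map (\<lambda>x. x - c) ts"])
        (auto simp: sorted_map intro: sorted_wrt_mono_rel)
  qed
qed

lemma arc_curve_subcurve:
  assumes "arc_curve \<gamma> l" "0 \<le> s" "s < t" "t \<le> l"
  shows "arc_curve (\<lambda>x. \<gamma> (s + x)) (t - s)"
  using assms unfolding arc_curve_def curve_length_shift by simp

lemma line_int_subcurve:
  fixes g :: "'a::metric_space \<Rightarrow> ennreal"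
  assumes "arc_curve \<gamma> l" "0 \<le> s" "s \<le> t" "t \<le> l" "g \<in> borel_measurable borel"
  shows "line_int g (\<lambda>x. \<gamma> (s + x)) (t - s) = (\<integral>\<^sup>+x\<in>{s..t}. g (\<gamma> x) \<partial>lborel)"
proof -
  have "(\<integral>\<^sup>+x. g (\<gamma> x) * indicator {s..t} x \<partial>lborel) =
      (\<integral>\<^sup>+x. g (\<gamma> (s + 1 * x)) * indicator {s..t} (s + 1 * x) \<partial>lborel)"
    using curve_measurable[OF assms(1,5), of "{s..t}"] assms
    by (subst nn_integral_real_affine[of _ 1 s]) auto
  then show ?thesis
    by (auto simp: line_int_def intro!: nn_integral_cong split: split_indicator)
qed

section \<open>Assembling increments over an interval from local estimates\<close>

lemma nn_integral_Icc_split: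
  fixes H :: "real \<Rightarrow> ennreal"
  assumes "a \<le> b" "b \<le> c" "(\<lambda>x. H x * indicator {a..c} x) \<in> borel_measurable borel"
  shows "(\<integral>\<^sup>+x\<in>{a..c}. H x \<partial>lborel) = (\<integral>\<^sup>+x\<in>{a..b}. H x \<partial>lborel) + (\<integral>\<^sup>+x\<in>{b..c}. H x \<partial>lborel)"
proof -
  have *: "(\<lambda>x. H x * indicator {s..t} x) \<in> borel_measurable lborel" if "a \<le> s" "t \<le> c" for s t
  proof -
    have "(\<lambda>x. (H x * indicator {a..c} x) * indicator {s..t} x) \<in> borel_measurable borel"
      using assms(3) by measurable
    also have "(\<lambda>x. (H x * indicator {a..c} x) * indicator {s..t} x) = (\<lambda>x. H x * indicator {s..t} x)"
      using that by (auto split: split_indicator)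
    finally show ?thesis by simp
  qed
  have "(\<integral>\<^sup>+x\<in>{a..c}. H x \<partial>lborel) = (\<integral>\<^sup>+x. H x * indicator {a..b} x + H x * indicator {b..c} x \<partial>lborel)"
    using AE_lborel_singleton[of b] assms(1,2)
    by (intro nn_integral_cong_AE) (auto split: split_indicator elim!: eventually_mono)
  also have "\<dots> = (\<integral>\<^sup>+x\<in>{a..b}. H x \<partial>lborel) + (\<integral>\<^sup>+x\<in>{b..c}. H x \<partial>lborel)"
    using assms(1,2) by (intro nn_integral_add *) auto
  finally show ?thesis .
qed

text \<open>Bisection: the estimate is additive over adjacent intervals, so a failure on
  \<open>{a..b}\<close> would persist on arbitrarily short intervals around some point. Gluing on
  open sets and minima of gradients both reduce to this.\<close>

lemma increment_le_local_to_global: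
  fixes F :: "real \<Rightarrow> real" and H :: "real \<Rightarrow> ennreal"
  assumes "a \<le> b" and meas: "(\<lambda>x. H x * indicator {a..b} x) \<in> borel_measurable borel"
    and loc: "\<And>x. a \<le> x \<Longrightarrow> x \<le> b \<Longrightarrow> \<exists>d>0. \<forall>s t. a \<le> s \<and> s \<le> x \<and> x \<le> t \<and> t \<le> b \<and> t - s < d \<longrightarrow>
       ennreal \<bar>F s - F t\<bar> \<le> (\<integral>\<^sup>+x\<in>{s..t}. H x \<partial>lborel)"
  shows "ennreal \<bar>F a - F b\<bar> \<le> (\<integral>\<^sup>+x\<in>{a..b}. H x \<partial>lborel)"
proof -
  \<comment> \<open>The premise makes \<open>P\<close> vacuous for intervals that leave
    \<open>{a..b}\<close>, since the neighbourhoods in \<open>Bolzano\<close> may extend beyond the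
    endpoints.\<close>
  define P where "P s t \<longleftrightarrow> (a \<le> s \<and> t \<le> b \<longrightarrow> ennreal \<bar>F s - F t\<bar> \<le> (\<integral>\<^sup>+x\<in>{s..t}. H x \<partial>lborel))" for s t
  have "P a b"
  proof (rule Bolzano[OF \<open>a \<le> b\<close>])
    fix s t v assume *: "P s t" "P t v" "s \<le> t" "t \<le> v"
    show "P s v" unfolding P_def
    proof
      assume sv: "a \<le> s \<and> v \<le> b"
      have "(\<lambda>x. (H x * indicator {a..b} x) * indicator {s..v} x) \<in> borel_measurable borel"
        using meas by measurable
      also have "(\<lambda>x. (H x * indicator {a..b} x) * indicator {s..v} x) = (\<lambda>x. H x * indicator {s..v} x)"
        using sv by (auto split: split_indicator)
      finally have eq: "(\<integral>\<^sup>+x\<in>{s..v}. H x \<partial>lborel) = (\<integral>\<^sup>+x\<in>{s..t}. H x \<partial>lborel) + (\<integral>\<^sup>+x\<in>{t..v}. H x \<partial>lborel)"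
        using * by (intro nn_integral_Icc_split)
      have "ennreal \<bar>F s - F v\<bar> \<le> ennreal (\<bar>F s - F t\<bar> + \<bar>F t - F v\<bar>)"
        by (intro ennreal_leI) linarith
      also have "\<dots> = ennreal \<bar>F s - F t\<bar> + ennreal \<bar>F t - F v\<bar>" by simp
      also have "\<dots> \<le> (\<integral>\<^sup>+x\<in>{s..t}. H x \<partial>lborel) + (\<integral>\<^sup>+x\<in>{t..v}. H x \<partial>lborel)"
        using * sv by (intro add_mono) (auto simp: P_def)
      finally show "ennreal \<bar>F s - F v\<bar> \<le> (\<integral>\<^sup>+x\<in>{s..v}. H x \<partial>lborel)" using eq by simp
    qed
  next
    fix x assume "a \<le> x" "x \<le> b"
    from loc[OF this] show "\<exists>d>0. \<forall>s t. s \<le> x \<and> x \<le> t \<and> t - s < d \<longrightarrow> P s t"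
      unfolding P_def by blast
  qed
  then show ?thesis by (simp add: P_def)
qed

section \<open>Exceptional curve families\<close>

text \<open>Fuglede's form of "for \<open>p\<close>-almost every curve": the exceptional curves have
  infinite line integral of a single \<open>p\<close>-integrable Borel function. Unlike an infimum
  over admissible functions, such a witness is easy to combine and to restrict.\<close>

definition ae_curve :: "'a::metric_space measure \<Rightarrow> real \<Rightarrow> ((real \<Rightarrow> 'a) \<Rightarrow> real \<Rightarrow> bool) \<Rightarrow> bool" where
  "ae_curve M p P \<longleftrightarrow> (\<exists>\<rho>. \<rho> \<in> borel_measurable borel \<and> (\<integral>\<^sup>+x. epow (\<rho> x) p \<partial>M) < \<infinity> \<and>
     (\<forall>\<gamma> l. arc_curve \<gamma> l \<and> line_int \<rho> \<gamma> l < \<infinity> \<longrightarrow> P \<gamma> l))"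

lemma ae_curve_mono:
  assumes "ae_curve M p P" "\<And>\<gamma> l. arc_curve \<gamma> l \<Longrightarrow> P \<gamma> l \<Longrightarrow> Q \<gamma> l"
  shows "ae_curve M p Q"
  using assms unfolding ae_curve_def by metis

lemma ae_curve_trivial:
  assumes "\<And>\<gamma> l. arc_curve \<gamma> l \<Longrightarrow> P \<gamma> l"
  shows "ae_curve M p P"
  unfolding ae_curve_def using assms by (intro exI[of _ "\<lambda>_. 0"]) auto

text \<open>The same witness \<open>\<rho>\<close> serves, because its integral over a subcurve is
  at most that over the whole curve.\<close>

lemma ae_curve_subcurves:
  assumes "ae_curve M p P"
  shows "ae_curve M p (\<lambda>\<gamma> l. \<forall>s t. 0 \<le> s \<and> s < t \<and> t \<le> l \<longrightarrow> P (\<lambda>x. \<gamma> (s + x)) (t - s))"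
proof -
  obtain \<rho> where \<rho>: "\<rho> \<in> borel_measurable borel" "(\<integral>\<^sup>+x. epow (\<rho> x) p \<partial>M) < \<infinity>"
    "\<And>\<gamma> l. arc_curve \<gamma> l \<Longrightarrow> line_int \<rho> \<gamma> l < \<infinity> \<Longrightarrow> P \<gamma> l"
    using assms unfolding ae_curve_def by auto
  have "P (\<lambda>x. \<gamma> (s + x)) (t - s)"
    if "arc_curve \<gamma> l" "line_int \<rho> \<gamma> l < \<infinity>" "0 \<le> s" "s < t" "t \<le> l" for \<gamma> l s t
  proof (rule \<rho>(3))
    show "arc_curve (\<lambda>x. \<gamma> (s + x)) (t - s)" using that by (intro arc_curve_subcurve) auto
    have "line_int \<rho> (\<lambda>x. \<gamma> (s + x)) (t - s) = (\<integral>\<^sup>+x\<in>{s..t}. \<rho> (\<gamma> x) \<partial>lborel)"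
      using that \<rho>(1) by (intro line_int_subcurve) auto
    also have "\<dots> \<le> line_int \<rho> \<gamma> l" unfolding line_int_def
      using that by (intro nn_integral_mono) (auto split: split_indicator)
    finally show "line_int \<rho> (\<lambda>x. \<gamma> (s + x)) (t - s) < \<infinity>" using that by auto
  qed
  then show ?thesis unfolding ae_curve_def using \<rho>(1,2) by blast
qed

text \<open>Witnesses are combined by a supremum, not by a sum: its \<open>p\<close>-th power is at
  most the sum of the \<open>p\<close>-th powers for every \<open>p > 0\<close>, so no triangle
  inequality in \<open>L^p\<close> enters.\<close>

lemma sup_Lp_bound:
  fixes \<rho> :: "nat \<Rightarrow> 'a \<Rightarrow> ennreal"
  assumes "0 < p" and [measurable]: "\<And>n. \<rho> n \<in> borel_measurable M"
  shows "(\<integral>\<^sup>+x. epow (SUP n. \<rho> n x) p \<partial>M) \<le> (\<Sum>n. \<integral>\<^sup>+x. epow (\<rho> n x) p \<partial>M)"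
proof -
  have "epow (SUP n. \<rho> n x) p \<le> (\<Sum>n. epow (\<rho> n x) p)" for x
    unfolding epow_le_iff[OF \<open>0 < p\<close>]
  proof (rule SUP_least)
    fix n
    have "epow (\<rho> n x) p \<le> (\<Sum>n. epow (\<rho> n x) p)"
      using sum_le_suminf[of "\<lambda>n. epow (\<rho> n x) p" "{n}"] by auto
    then show "\<rho> n x \<le> epow (\<Sum>n. epow (\<rho> n x) p) (1 / p)"
      using epow_le_iff[OF \<open>0 < p\<close>] by blast
  qed
  then have "(\<integral>\<^sup>+x. epow (SUP n. \<rho> n x) p \<partial>M) \<le> (\<integral>\<^sup>+x. (\<Sum>n. epow (\<rho> n x) p) \<partial>M)"
    by (intro nn_integral_mono) auto
  also have "\<dots> = (\<Sum>n. \<integral>\<^sup>+x. epow (\<rho> n x) p \<partial>M)"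
    by (intro nn_integral_suminf) auto
  finally show ?thesis .
qed

lemma suminf_half_powers_finite: "(\<Sum>n. ennreal ((1/2)^n)) < \<infinity>"
proof -
  have "(\<Sum>n. ennreal ((1/2::real)^n)) = ennreal (\<Sum>n. (1/2::real)^n)"
    by (intro suminf_ennreal2) (auto intro: summable_geometric)
  then show ?thesis by simp
qed

lemma line_int_cmult:
  fixes g :: "'a::metric_space \<Rightarrow> ennreal"
  assumes "arc_curve \<gamma> l" "g \<in> borel_measurable borel"
  shows "line_int (\<lambda>x. c * g x) \<gamma> l = c * line_int g \<gamma> l"
  unfolding line_int_def using curve_measurable[OF assms, of "{0..l}"]
  by (simp add: mult.assoc nn_integral_cmult)

lemma line_int_mono:
  assumes "\<And>x. x \<in> {0..l} \<Longrightarrow> g (\<gamma> x) \<le> h (\<gamma> x)"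
  shows "line_int g \<gamma> l \<le> line_int h \<gamma> l"
  unfolding line_int_def using assms by (intro nn_integral_mono) (auto split: split_indicator)

lemma ennreal_mult_less_topD: "ennreal c * x < \<infinity> \<Longrightarrow> 0 < c \<Longrightarrow> x < \<infinity>"
  by (cases x rule: ennreal_cases) (auto simp: ennreal_mult_top)

text \<open>\<open>sets M\<close> may exceed the Borel sets, as the measure is to be complete. Line
  integrals work with Borel functions and integrals over \<open>M\<close> with measurable ones,
  which is why both kinds of measurability are carried along.\<close>

locale metric_measure =
  fixes M :: "'a::metric_space measure" and p :: real
  assumes p_pos: "0 < p" and space_UNIV: "space M = UNIV" and borel_sets: "sets borel \<subseteq> sets M"
begin

lemma borel_measurable_M: "f \<in> borel_measurable borel \<Longrightarrow> f \<in> borel_measurable M"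
  for f :: "'a \<Rightarrow> 'b::topological_space"
  using borel_sets space_UNIV unfolding measurable_def by auto

lemma ae_curve_all:
  fixes P :: "nat \<Rightarrow> (real \<Rightarrow> 'a) \<Rightarrow> real \<Rightarrow> bool"
  assumes "\<And>n. ae_curve M p (P n)"
  shows "ae_curve M p (\<lambda>\<gamma> l. \<forall>n. P n \<gamma> l)"
proof -
  have "\<exists>\<rho>. \<rho> \<in> borel_measurable borel \<and> (\<integral>\<^sup>+x. epow (\<rho> x) p \<partial>M) < \<infinity> \<and>
     (\<forall>\<gamma> l. arc_curve \<gamma> l \<and> line_int \<rho> \<gamma> l < \<infinity> \<longrightarrow> P n \<gamma> l)" for n
    using assms unfolding ae_curve_def by auto
  then obtain \<rho> where \<rho>: "\<And>n. \<rho> n \<in> borel_measurable borel" "\<And>n. (\<integral>\<^sup>+x. epow (\<rho> n x) p \<partial>M) < \<infinity>"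
    "\<And>n \<gamma> l. arc_curve \<gamma> l \<Longrightarrow> line_int (\<rho> n) \<gamma> l < \<infinity> \<Longrightarrow> P n \<gamma> l"
    by metis
  note [measurable] = \<rho>(1) borel_measurable_M[OF \<rho>(1)]
  define I where "I n = enn2real (\<integral>\<^sup>+x. epow (\<rho> n x) p \<partial>M)" for n
  \<comment> \<open>The weight makes the \<open>n\<close>-th scaled energy at most
    \<open>(1/2)^n\<close>; the summand 1 in the denominator covers energies equal to 0.\<close>
  define c where "c n = ((1/2)^n / (1 + I n)) powr (1 / p)" for n
  have I: "0 \<le> I n" "(\<integral>\<^sup>+x. epow (\<rho> n x) p \<partial>M) = ennreal (I n)" for n
    using \<rho>(2)[of n] by (auto simp: I_def)
  have c: "0 < c n" "c n powr p = (1/2)^n / (1 + I n)" for n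
    using I(1)[of n] p_pos by (auto simp: c_def powr_powr)
  define R where "R x = (SUP n. ennreal (c n) * \<rho> n x)" for x
  have R_meas: "R \<in> borel_measurable borel"
    unfolding R_def by measurable
  have "(\<integral>\<^sup>+x. epow (R x) p \<partial>M) \<le> (\<Sum>n. \<integral>\<^sup>+x. epow (ennreal (c n) * \<rho> n x) p \<partial>M)"
    unfolding R_def by (intro sup_Lp_bound p_pos) measurable
  also have "\<dots> \<le> (\<Sum>n. ennreal ((1/2)^n))"
  proof (intro suminf_le allI)
    fix n
    have "(\<integral>\<^sup>+x. epow (ennreal (c n) * \<rho> n x) p \<partial>M) = ennreal (c n powr p) * ennreal (I n)"
      using c(1)[of n] by (simp add: epow_mult nn_integral_cmult I)
    also have "\<dots> = ennreal ((1/2)^n * (I n / (1 + I n)))"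
      using I(1)[of n] by (simp add: c(2) flip: ennreal_mult)
    also have "\<dots> \<le> ennreal ((1/2)^n)"
      using I(1)[of n] by (intro ennreal_leI mult_left_le) auto
    finally show "(\<integral>\<^sup>+x. epow (ennreal (c n) * \<rho> n x) p \<partial>M) \<le> ennreal ((1/2)^n)" .
  qed auto
  finally have fin: "(\<integral>\<^sup>+x. epow (R x) p \<partial>M) < \<infinity>"
    using suminf_half_powers_finite by (auto simp: less_top[symmetric] top_unique)
  have "P n \<gamma> l" if "arc_curve \<gamma> l" "line_int R \<gamma> l < \<infinity>" for \<gamma> l n
  proof (rule \<rho>(3)[OF that(1)])
    have "ennreal (c n) * line_int (\<rho> n) \<gamma> l = line_int (\<lambda>x. ennreal (c n) * \<rho> n x) \<gamma> l"
      using that by (simp add: line_int_cmult)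
    also have "\<dots> \<le> line_int R \<gamma> l"
      by (intro line_int_mono) (auto simp: R_def intro: SUP_upper)
    finally have "ennreal (c n) * line_int (\<rho> n) \<gamma> l < \<infinity>"
      using that(2) by (rule le_less_trans)
    then show "line_int (\<rho> n) \<gamma> l < \<infinity>"
      using c(1) by (rule ennreal_mult_less_topD)
  qed
  then show ?thesis
    unfolding ae_curve_def using R_meas fin by blast
qed

lemma ae_curve_conj:
  assumes "ae_curve M p P" "ae_curve M p Q"
  shows "ae_curve M p (\<lambda>\<gamma> l. P \<gamma> l \<and> Q \<gamma> l)"
proof -
  have "ae_curve M p (\<lambda>\<gamma> l. \<forall>n::nat. (if n = 0 then P else Q) \<gamma> l)"
    using assms by (intro ae_curve_all) auto
  then show ?thesis
    by (rule ae_curve_mono) (metis zero_neq_one)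
qed

text \<open>Fuglede's lemma. From modulus 0, admissible functions of rapidly decreasing energy are
  scaled up and their supremum has infinite integral on every curve of \<open>\<Gamma>\<close>.
  Conversely, an infinite line integral stays infinite under every positive scaling, so admissible
  functions of arbitrarily small energy arise from one witness.\<close>

lemma modulus_zero_iff:
  assumes "\<And>\<gamma> l. (\<gamma>, l) \<in> \<Gamma> \<Longrightarrow> arc_curve \<gamma> l"
  shows "modulus M p \<Gamma> = 0 \<longleftrightarrow> ae_curve M p (\<lambda>\<gamma> l. (\<gamma>, l) \<notin> \<Gamma>)"
proof
  assume 0: "modulus M p \<Gamma> = 0"
  \<comment> \<open>The factor \<open>(1/2^n) powr p\<close> absorbs the later scaling by
    \<open>2^n\<close>; the factor \<open>(1/2)^n\<close> leaves a convergent series.\<close>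
  have "\<exists>\<rho>. \<rho> \<in> borel_measurable borel \<and> (\<forall>\<gamma> l. (\<gamma>, l) \<in> \<Gamma> \<longrightarrow> 1 \<le> line_int \<rho> \<gamma> l) \<and>
      (\<integral>\<^sup>+x. epow (\<rho> x) p \<partial>M) < ennreal ((1/2)^n * (1/2^n) powr p)" for n
  proof -
    have "modulus M p \<Gamma> < ennreal ((1/2)^n * (1/2^n) powr p)" using 0 by simp
    then show ?thesis unfolding modulus_def by (subst (asm) INF_less_iff) auto
  qed
  then obtain \<rho> where \<rho>: "\<And>n. \<rho> n \<in> borel_measurable borel"
     "\<And>n \<gamma> l. (\<gamma>, l) \<in> \<Gamma> \<Longrightarrow> 1 \<le> line_int (\<rho> n) \<gamma> l"
     "\<And>n. (\<integral>\<^sup>+x. epow (\<rho> n x) p \<partial>M) < ennreal ((1/2)^n * (1/2^n) powr p)"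
    by metis
  note [measurable] = \<rho>(1) borel_measurable_M[OF \<rho>(1)]
  define R where "R x = (SUP n. ennreal (2^n) * \<rho> n x)" for x
  have R_meas: "R \<in> borel_measurable borel"
    unfolding R_def by measurable
  have "(\<integral>\<^sup>+x. epow (R x) p \<partial>M) \<le> (\<Sum>n. \<integral>\<^sup>+x. epow (ennreal (2^n) * \<rho> n x) p \<partial>M)"
    unfolding R_def by (intro sup_Lp_bound p_pos) measurable
  also have "\<dots> \<le> (\<Sum>n. ennreal ((1/2)^n))"
  proof (intro suminf_le allI)
    fix n
    have "(\<integral>\<^sup>+x. epow (ennreal (2^n) * \<rho> n x) p \<partial>M) = ennreal ((2^n) powr p) * (\<integral>\<^sup>+x. epow (\<rho> n x) p \<partial>M)"
      by (simp add: epow_mult nn_integral_cmult)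
    also have "\<dots> \<le> ennreal ((2^n) powr p) * ennreal ((1/2)^n * (1/2^n) powr p)"
      using \<rho>(3)[of n] by (intro mult_left_mono) auto
    also have "\<dots> = ennreal ((2^n) powr p * (1/2^n) powr p * (1/2)^n)"
      by (simp add: mult_ac flip: ennreal_mult)
    also have "((2::real)^n) powr p * (1/2^n) powr p = 1"
      by (subst powr_mult[symmetric]) auto
    finally show "(\<integral>\<^sup>+x. epow (ennreal (2^n) * \<rho> n x) p \<partial>M) \<le> ennreal ((1/2)^n)" by simp
  qed auto
  finally have fin: "(\<integral>\<^sup>+x. epow (R x) p \<partial>M) < \<infinity>"
    using suminf_half_powers_finite by (auto simp: less_top[symmetric] top_unique)
  have "(\<gamma>, l) \<notin> \<Gamma>" if "line_int R \<gamma> l < \<infinity>" for \<gamma> l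
  proof
    assume G: "(\<gamma>, l) \<in> \<Gamma>"
    have "of_nat n \<le> line_int R \<gamma> l" for n
    proof -
      have "(of_nat n :: ennreal) \<le> ennreal (2^n)"
        using of_nat_less_two_power[of n, where ?'a = real]
        by (metis ennreal_leI ennreal_of_nat_eq_real_of_nat less_imp_le)
      also have "\<dots> \<le> ennreal (2^n) * line_int (\<rho> n) \<gamma> l"
        using mult_left_mono[OF \<rho>(2)[OF G, of n], of "ennreal (2^n)"] by simp
      also have "\<dots> = line_int (\<lambda>x. ennreal (2^n) * \<rho> n x) \<gamma> l"
        using assms[OF G] by (simp add: line_int_cmult)
      also have "\<dots> \<le> line_int R \<gamma> l"
        by (intro line_int_mono) (auto simp: R_def intro: SUP_upper)
      finally show ?thesis .
    qed
    then show False using that ennreal_Ex_less_of_nat[of "line_int R \<gamma> l"]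
      by (auto simp: not_less[symmetric])
  qed
  then show "ae_curve M p (\<lambda>\<gamma> l. (\<gamma>, l) \<notin> \<Gamma>)"
    unfolding ae_curve_def using R_meas fin by blast
next
  assume "ae_curve M p (\<lambda>\<gamma> l. (\<gamma>, l) \<notin> \<Gamma>)"
  then obtain \<rho> where \<rho>: "\<rho> \<in> borel_measurable borel" "(\<integral>\<^sup>+x. epow (\<rho> x) p \<partial>M) < \<infinity>"
    "\<And>\<gamma> l. arc_curve \<gamma> l \<Longrightarrow> line_int \<rho> \<gamma> l < \<infinity> \<Longrightarrow> (\<gamma>, l) \<notin> \<Gamma>"
    unfolding ae_curve_def by auto
  note [measurable] = \<rho>(1) borel_measurable_M[OF \<rho>(1)]
  define I where "I = enn2real (\<integral>\<^sup>+x. epow (\<rho> x) p \<partial>M)"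
  have I: "0 \<le> I" "(\<integral>\<^sup>+x. epow (\<rho> x) p \<partial>M) = ennreal I"
    using \<rho>(2) by (auto simp: I_def)
  have "modulus M p \<Gamma> \<le> 0 + ennreal e" if "0 < e" for e
  proof -
    define c where "c = (e / (1 + I)) powr (1 / p)"
    have c: "0 < c" "c powr p = e / (1 + I)"
      using that I(1) p_pos by (auto simp: c_def powr_powr)
    have "1 \<le> line_int (\<lambda>x. ennreal c * \<rho> x) \<gamma> l" if "(\<gamma>, l) \<in> \<Gamma>" for \<gamma> l
    proof -
      have "line_int \<rho> \<gamma> l = \<infinity>" using \<rho>(3) assms that by (auto simp: less_top[symmetric])
      then show ?thesis using assms[OF that] c(1) by (simp add: line_int_cmult ennreal_mult_top)
    qed
    then have "modulus M p \<Gamma> \<le> (\<integral>\<^sup>+x. epow (ennreal c * \<rho> x) p \<partial>M)"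
      unfolding modulus_def by (intro INF_lower) auto
    also have "\<dots> = ennreal (c powr p) * ennreal I"
      using c(1) by (simp add: epow_mult nn_integral_cmult I)
    also have "\<dots> = ennreal (e * (I / (1 + I)))"
      using I(1) that by (simp add: c(2) flip: ennreal_mult)
    also have "\<dots> \<le> ennreal e"
      using I(1) that by (intro ennreal_leI mult_left_le) auto
    finally show ?thesis by simp
  qed
  then show "modulus M p \<Gamma> = 0"
    using ennreal_le_epsilon[of 0 "modulus M p \<Gamma>"] by auto
qed

text \<open>Exceptional families are closed under passing to curves that have an exceptional subcurve,
  so the upper gradient inequality may be tested on all subcurves of almost every curve, also of
  those that leave \<open>U\<close>.\<close>
lemma weak_ug_iff:
  "weak_ug M p U f g \<longleftrightarrow> g \<in> borel_measurable borel \<and>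
     ae_curve M p (\<lambda>\<gamma> l. \<forall>s t. 0 \<le> s \<and> s \<le> t \<and> t \<le> l \<and> \<gamma> ` {s..t} \<subseteq> U \<longrightarrow>
        ennreal \<bar>f (\<gamma> s) - f (\<gamma> t)\<bar> \<le> (\<integral>\<^sup>+x\<in>{s..t}. g (\<gamma> x) \<partial>lborel))"
  (is "_ \<longleftrightarrow> _ \<and> ?R")
proof (cases "g \<in> borel_measurable borel")
  case g: True
  let ?\<Gamma> = "{(\<gamma>, l) \<in> curves_in U. \<not> (ennreal \<bar>f (\<gamma> 0) - f (\<gamma> l)\<bar> \<le> line_int g \<gamma> l)}"
  have "weak_ug M p U f g \<longleftrightarrow> ae_curve M p (\<lambda>\<gamma> l. (\<gamma>, l) \<notin> ?\<Gamma>)"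
    unfolding weak_ug_def using g by (subst modulus_zero_iff) (auto simp: curves_in_def)
  also have "\<dots> \<longleftrightarrow> ?R"
  proof
    assume "ae_curve M p (\<lambda>\<gamma> l. (\<gamma>, l) \<notin> ?\<Gamma>)"
    from ae_curve_subcurves[OF this] show ?R
    proof (rule ae_curve_mono, intro allI impI)
      fix \<gamma> :: "real \<Rightarrow> 'a" and l s t
      assume arc: "arc_curve \<gamma> l"
        and *: "\<forall>s t. 0 \<le> s \<and> s < t \<and> t \<le> l \<longrightarrow> (\<lambda>x. \<gamma> (s + x), t - s) \<notin> ?\<Gamma>"
        and st: "0 \<le> s \<and> s \<le> t \<and> t \<le> l \<and> \<gamma> ` {s..t} \<subseteq> U"
      show "ennreal \<bar>f (\<gamma> s) - f (\<gamma> t)\<bar> \<le> (\<integral>\<^sup>+x\<in>{s..t}. g (\<gamma> x) \<partial>lborel)"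
      proof (cases "s = t")
        case False
        have "(\<lambda>x. \<gamma> (s + x), t - s) \<in> curves_in U"
          using st False arc_curve_subcurve[OF arc, of s t] unfolding curves_in_def by auto
        with *[rule_format, of s t] st False
        have "ennreal \<bar>f (\<gamma> s) - f (\<gamma> t)\<bar> \<le> line_int g (\<lambda>x. \<gamma> (s + x)) (t - s)"
          by simp
        then show ?thesis
          using line_int_subcurve[OF arc _ _ _ g, of s t] st by simp
      qed simp
    qed
  next
    assume ?R
    then show "ae_curve M p (\<lambda>\<gamma> l. (\<gamma>, l) \<notin> ?\<Gamma>)"
    proof (rule ae_curve_mono)
      fix \<gamma> :: "real \<Rightarrow> 'a" and l
      assume arc: "arc_curve \<gamma> l" and *: "\<forall>s t. 0 \<le> s \<and> s \<le> t \<and> t \<le> l \<and> \<gamma> ` {s..t} \<subseteq> U \<longrightarrow>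
        ennreal \<bar>f (\<gamma> s) - f (\<gamma> t)\<bar> \<le> (\<integral>\<^sup>+x\<in>{s..t}. g (\<gamma> x) \<partial>lborel)"
      have "0 < l" using arc by (simp add: arc_curve_def)
      then show "(\<gamma>, l) \<notin> ?\<Gamma>"
        using *[rule_format, of 0 l] by (auto simp: curves_in_def line_int_def)
    qed
  qed
  finally show ?thesis using g by simp
qed (simp add: weak_ug_def)

end

section \<open>Calculus of weak upper gradients\<close>

lemma continuous_on_Icc_near:
  fixes W :: "real \<Rightarrow> 'b::metric_space"
  assumes "continuous_on {s..t} W" "x \<in> {s..t}" "open V" "W x \<in> V"
  obtains d where "0 < d" "\<And>y. y \<in> {s..t} \<Longrightarrow> \<bar>y - x\<bar> < d \<Longrightarrow> W y \<in> V"
proof -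
  obtain e where "0 < e" "ball (W x) e \<subseteq> V" using assms by (meson openE)
  moreover obtain d where "0 < d" "\<forall>y\<in>{s..t}. dist y x < d \<longrightarrow> dist (W y) (W x) < e"
    using assms \<open>0 < e\<close> unfolding continuous_on_iff by meson
  ultimately show ?thesis
    using that[of d] by (force simp: dist_real_def dist_commute)
qed

lemma set_nn_integral_mono_on:
  assumes "\<And>x. x \<in> A \<Longrightarrow> f x \<le> g x"
  shows "(\<integral>\<^sup>+x\<in>A. f x \<partial>N) \<le> (\<integral>\<^sup>+x\<in>A. g x \<partial>N)"
  using assms by (intro nn_integral_mono) (auto split: split_indicator)

text \<open>With a compact \<open>C\<close> and an open \<open>V\<close> that squeeze \<open>{G1 \<le> G2}\<close>, each point has a neighbourhood inside \<open>V\<close>,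
  where \<open>G1\<close> controls the increments, or outside \<open>C\<close>, where \<open>G2\<close> does.\<close>
lemma increment_le_min:
  fixes F :: "real \<Rightarrow> real" and G1 G2 :: "real \<Rightarrow> ennreal"
  assumes "s \<le> t"
    and meas: "(\<lambda>x. G1 x * indicator {s..t} x) \<in> borel_measurable borel"
      "(\<lambda>x. G2 x * indicator {s..t} x) \<in> borel_measurable borel"
    and fin: "(\<integral>\<^sup>+x\<in>{s..t}. G1 x \<partial>lborel) < \<infinity>" "(\<integral>\<^sup>+x\<in>{s..t}. G2 x \<partial>lborel) < \<infinity>"
    and F1: "\<And>a b. s \<le> a \<Longrightarrow> a \<le> b \<Longrightarrow> b \<le> t \<Longrightarrow> ennreal \<bar>F a - F b\<bar> \<le> (\<integral>\<^sup>+x\<in>{a..b}. G1 x \<partial>lborel)"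
    and F2: "\<And>a b. s \<le> a \<Longrightarrow> a \<le> b \<Longrightarrow> b \<le> t \<Longrightarrow> ennreal \<bar>F a - F b\<bar> \<le> (\<integral>\<^sup>+x\<in>{a..b}. G2 x \<partial>lborel)"
  shows "ennreal \<bar>F s - F t\<bar> \<le> (\<integral>\<^sup>+x\<in>{s..t}. min (G1 x) (G2 x) \<partial>lborel)"
proof (rule ennreal_le_epsilon)
  fix e :: real assume "0 < e"
  define H1 where "H1 x = G1 x * indicator {s..t} x" for x
  define H2 where "H2 x = G2 x * indicator {s..t} x" for x
  note [measurable] = meas[folded H1_def H2_def]
  \<comment> \<open>Regularity is applied to the density \<open>H1 + H2\<close>, finite by
    \<open>fin\<close>, so that \<open>V - C\<close>, the only place where both functions are
    counted, costs at most \<open>e\<close>.\<close>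
  define \<nu> where "\<nu> = density lborel (\<lambda>x. H1 x + H2 x)"
  have [measurable_cong]: "sets \<nu> = sets borel" by (simp add: \<nu>_def)
  have "emeasure \<nu> (space \<nu>) = (\<integral>\<^sup>+x. H1 x + H2 x \<partial>lborel)"
    by (simp add: \<nu>_def emeasure_density)
  also have "\<dots> = (\<integral>\<^sup>+x. H1 x \<partial>lborel) + (\<integral>\<^sup>+x. H2 x \<partial>lborel)"
    by (intro nn_integral_add) auto
  also have "\<dots> < \<infinity>" using fin by (simp add: H1_def H2_def)
  finally have \<nu>_fin: "emeasure \<nu> (space \<nu>) \<noteq> \<infinity>" by simp
  interpret \<nu>: finite_measure \<nu> by standard fact
  define E where "E = {x. H1 x \<le> H2 x}"
  have E[measurable]: "E \<in> sets borel" unfolding E_def by measurable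
  have small: "0 < ennreal (e / 2)" using \<open>0 < e\<close> by simp
  obtain C where C: "C \<subseteq> E" "compact C" "emeasure \<nu> E \<le> emeasure \<nu> C + ennreal (e / 2)"
  proof -
    have SUP: "emeasure \<nu> E = (SUP K\<in>{K. K \<subseteq> E \<and> compact K}. emeasure \<nu> K)"
      using inner_regular[OF _ \<nu>_fin E] by (simp add: \<nu>_def)
    show ?thesis
    proof (cases "emeasure \<nu> E = 0")
      case True
      then show ?thesis using that[of "{}"] by simp
    next
      case False
      then have "emeasure \<nu> E - ennreal (e / 2) < emeasure \<nu> E"
        using small \<nu>.emeasure_finite[of E] by (intro ennreal_between) (auto simp: zero_less_iff_neq_zero less_top[symmetric])
      then obtain K where "K \<subseteq> E" "compact K" "emeasure \<nu> E - ennreal (e / 2) < emeasure \<nu> K"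
        unfolding SUP less_SUP_iff by auto
      then show ?thesis
        using that[of K] less_imp_le[of "emeasure \<nu> E - ennreal (e / 2)"]
        by (simp add: ennreal_minus_le_iff add.commute)
    qed
  qed
  obtain V where V: "E \<subseteq> V" "open V" "emeasure \<nu> V \<le> emeasure \<nu> E + ennreal (e / 2)"
  proof -
    have "emeasure \<nu> E + 0 < emeasure \<nu> E + ennreal (e / 2)"
      using small \<nu>.emeasure_finite[of E] by (subst ennreal_add_left_cancel_less) auto
    moreover have "emeasure \<nu> E = (INF U\<in>{U. E \<subseteq> U \<and> open U}. emeasure \<nu> U)"
      using outer_regular[OF _ \<nu>_fin E] by (simp add: \<nu>_def)
    ultimately have "(INF U\<in>{U. E \<subseteq> U \<and> open U}. emeasure \<nu> U) < emeasure \<nu> E + ennreal (e / 2)"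
      by simp
    then show ?thesis using that by (auto simp: INF_less_iff intro: less_imp_le)
  qed
  have [measurable]: "C \<in> sets borel" "V \<in> sets borel"
    using borel_closed[OF compact_imp_closed[OF C(2)]] V(2) by auto
  define H where "H x = H1 x * indicator V x + H2 x * indicator (- C) x" for x
  have "ennreal \<bar>F s - F t\<bar> \<le> (\<integral>\<^sup>+x\<in>{s..t}. H x \<partial>lborel)"
  proof (rule increment_le_local_to_global[OF \<open>s \<le> t\<close>])
    show "(\<lambda>x. H x * indicator {s..t} x) \<in> borel_measurable borel"
      unfolding H_def by measurable
  next
    fix x assume x: "s \<le> x" "x \<le> t"
    show "\<exists>d>0. \<forall>a b. s \<le> a \<and> a \<le> x \<and> x \<le> b \<and> b \<le> t \<and> b - a < d \<longrightarrow>
             ennreal \<bar>F a - F b\<bar> \<le> (\<integral>\<^sup>+x\<in>{a..b}. H x \<partial>lborel)"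
    proof (cases "x \<in> V")
      case True
      then obtain d where d: "0 < d" "\<And>y. \<bar>y - x\<bar> < d \<Longrightarrow> y \<in> V"
        using V(2) unfolding open_dist by (auto simp: dist_real_def)
      have "ennreal \<bar>F a - F b\<bar> \<le> (\<integral>\<^sup>+x\<in>{a..b}. H x \<partial>lborel)"
        if "s \<le> a" "a \<le> x" "x \<le> b" "b \<le> t" "b - a < d" for a b
      proof -
        have "(\<integral>\<^sup>+x\<in>{a..b}. G1 x \<partial>lborel) \<le> (\<integral>\<^sup>+x\<in>{a..b}. H x \<partial>lborel)"
        proof (rule set_nn_integral_mono_on)
          fix y assume "y \<in> {a..b}"
          then have "\<bar>y - x\<bar> < d" "y \<in> {s..t}" using that by auto
          then have "y \<in> V" "y \<in> {s..t}" using d(2) by blast+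
          then show "G1 y \<le> H y" by (simp add: H_def H1_def)
        qed
        then show ?thesis using F1[of a b] that by auto
      qed
      then show ?thesis using d(1) by blast
    next
      case False
      then have "x \<in> - C" "open (- C)" using V(1) C(1,2) by (auto intro: compact_imp_closed)
      then obtain d where d: "0 < d" "\<And>y. \<bar>y - x\<bar> < d \<Longrightarrow> y \<in> - C"
        unfolding open_dist by (auto simp: dist_real_def)
      have "ennreal \<bar>F a - F b\<bar> \<le> (\<integral>\<^sup>+x\<in>{a..b}. H x \<partial>lborel)"
        if "s \<le> a" "a \<le> x" "x \<le> b" "b \<le> t" "b - a < d" for a b
      proof -
        have "(\<integral>\<^sup>+x\<in>{a..b}. G2 x \<partial>lborel) \<le> (\<integral>\<^sup>+x\<in>{a..b}. H x \<partial>lborel)"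
        proof (rule set_nn_integral_mono_on)
          fix y assume "y \<in> {a..b}"
          then have "\<bar>y - x\<bar> < d" "y \<in> {s..t}" using that by auto
          then have "y \<in> - C" "y \<in> {s..t}" using d(2) by blast+
          then show "G2 y \<le> H y" by (simp add: H_def H2_def)
        qed
        then show ?thesis using F2[of a b] that by auto
      qed
      then show ?thesis using d(1) by blast
    qed
  qed
  also have "\<dots> \<le> (\<integral>\<^sup>+x. min (H1 x) (H2 x) + (H1 x + H2 x) * indicator (V - C) x \<partial>lborel)"
  proof (rule nn_integral_mono)
    fix x
    \<comment> \<open>On \<open>C\<close> only \<open>H1\<close> is counted, which is the minimum
      because \<open>C\<close> lies in \<open>E\<close>; off \<open>V\<close> only \<open>H2\<close>
      is, which is the minimum because the point is outside \<open>E\<close>.\<close>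
    show "H x * indicator {s..t} x \<le> min (H1 x) (H2 x) + (H1 x + H2 x) * indicator (V - C) x"
      using C(1) V(1) unfolding H_def E_def
      by (auto split: split_indicator simp: min_def add_increasing)
  qed
  also have "\<dots> = (\<integral>\<^sup>+x. min (H1 x) (H2 x) \<partial>lborel) + emeasure \<nu> (V - C)"
    unfolding \<nu>_def by (simp add: nn_integral_add emeasure_density)
  also have "emeasure \<nu> (V - C) \<le> ennreal e"
  proof -
    have "emeasure \<nu> (V - C) = emeasure \<nu> V - emeasure \<nu> C"
      using C V \<nu>.emeasure_finite[of C] by (intro emeasure_Diff) auto
    also have "\<dots> \<le> (emeasure \<nu> C + ennreal (e/2) + ennreal (e/2)) - emeasure \<nu> C"
      using C(3) V(3) by (intro ennreal_minus_mono) (auto intro: order_trans add_right_mono)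
    also have "\<dots> = ennreal (e/2) + ennreal (e/2)"
      using \<nu>.emeasure_finite[of C] by (simp add: add.assoc)
    also have "\<dots> = ennreal e" using \<open>0 < e\<close> by (simp flip: ennreal_plus)
    finally show ?thesis .
  qed
  finally have "ennreal \<bar>F s - F t\<bar> \<le> (\<integral>\<^sup>+x. min (H1 x) (H2 x) \<partial>lborel) + ennreal e"
    by (simp add: add_left_mono)
  also have "(\<integral>\<^sup>+x. min (H1 x) (H2 x) \<partial>lborel) = (\<integral>\<^sup>+x\<in>{s..t}. min (G1 x) (G2 x) \<partial>lborel)"
    unfolding H1_def H2_def by (intro nn_integral_cong) (auto split: split_indicator)
  finally show "ennreal \<bar>F s - F t\<bar> \<le> (\<integral>\<^sup>+x\<in>{s..t}. min (G1 x) (G2 x) \<partial>lborel) + ennreal e" .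
qed

context metric_measure
begin

lemma weak_ug_borel: "weak_ug M p U f g \<Longrightarrow> g \<in> borel_measurable borel"
  by (simp add: weak_ug_def)

text \<open>One rule for all harmless changes: a smaller set, a larger gradient there, and a
  function with smaller increments. The last covers truncation, added constants, changes of sign and
  modifications outside \<open>V\<close>.\<close>

lemma weak_ug_mono:
  assumes "weak_ug M p U f g" "V \<subseteq> U" "h \<in> borel_measurable borel" "\<And>x. x \<in> V \<Longrightarrow> g x \<le> h x"
    and "\<And>x y. x \<in> V \<Longrightarrow> y \<in> V \<Longrightarrow> \<bar>f' x - f' y\<bar> \<le> \<bar>f x - f y\<bar>"
  shows "weak_ug M p V f' h"
  unfolding weak_ug_iff
proof
  from assms(1) have "ae_curve M p (\<lambda>\<gamma> l. \<forall>s t. 0 \<le> s \<and> s \<le> t \<and> t \<le> l \<and> \<gamma> ` {s..t} \<subseteq> U \<longrightarrow>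
        ennreal \<bar>f (\<gamma> s) - f (\<gamma> t)\<bar> \<le> (\<integral>\<^sup>+x\<in>{s..t}. g (\<gamma> x) \<partial>lborel))"
    unfolding weak_ug_iff by simp
  then show "ae_curve M p (\<lambda>\<gamma> l. \<forall>s t. 0 \<le> s \<and> s \<le> t \<and> t \<le> l \<and> \<gamma> ` {s..t} \<subseteq> V \<longrightarrow>
        ennreal \<bar>f' (\<gamma> s) - f' (\<gamma> t)\<bar> \<le> (\<integral>\<^sup>+x\<in>{s..t}. h (\<gamma> x) \<partial>lborel))"
  proof (rule ae_curve_mono, intro allI impI)
    fix \<gamma> :: "real \<Rightarrow> 'a" and l s t
    assume *: "\<forall>s t. 0 \<le> s \<and> s \<le> t \<and> t \<le> l \<and> \<gamma> ` {s..t} \<subseteq> U \<longrightarrow>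
        ennreal \<bar>f (\<gamma> s) - f (\<gamma> t)\<bar> \<le> (\<integral>\<^sup>+x\<in>{s..t}. g (\<gamma> x) \<partial>lborel)"
      and st: "0 \<le> s \<and> s \<le> t \<and> t \<le> l \<and> \<gamma> ` {s..t} \<subseteq> V"
    have "ennreal \<bar>f' (\<gamma> s) - f' (\<gamma> t)\<bar> \<le> ennreal \<bar>f (\<gamma> s) - f (\<gamma> t)\<bar>"
      using st by (intro ennreal_leI assms) (auto simp: image_subset_iff)
    also have "\<dots> \<le> (\<integral>\<^sup>+x\<in>{s..t}. g (\<gamma> x) \<partial>lborel)" using * st assms(2) by auto
    also have "\<dots> \<le> (\<integral>\<^sup>+x\<in>{s..t}. h (\<gamma> x) \<partial>lborel)"
      using st by (intro set_nn_integral_mono_on assms) (auto simp: image_subset_iff)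
    finally show "ennreal \<bar>f' (\<gamma> s) - f' (\<gamma> t)\<bar> \<le> (\<integral>\<^sup>+x\<in>{s..t}. h (\<gamma> x) \<partial>lborel)" .
  qed
qed fact

lemma weak_ug_lipschitz:
  assumes "\<And>x y. \<bar>f x - f y\<bar> \<le> L * dist x y" "0 \<le> L"
  shows "weak_ug M p U f (\<lambda>_. ennreal L)"
  unfolding weak_ug_iff
proof (intro conjI ae_curve_trivial allI impI)
  fix \<gamma> :: "real \<Rightarrow> 'a" and l s t
  assume arc: "arc_curve \<gamma> l" and st: "0 \<le> s \<and> s \<le> t \<and> t \<le> l \<and> \<gamma> ` {s..t} \<subseteq> U"
  have "\<bar>f (\<gamma> s) - f (\<gamma> t)\<bar> \<le> L * (t - s)"
    using assms(1)[of "\<gamma> s" "\<gamma> t"] arc_curve_dist_le[OF arc, of s t] st assms(2)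
    by (meson mult_left_mono order_trans)
  then have "ennreal \<bar>f (\<gamma> s) - f (\<gamma> t)\<bar> \<le> ennreal L * ennreal (t - s)"
    using assms(2) st by (simp add: ennreal_leI flip: ennreal_mult)
  also have "\<dots> = (\<integral>\<^sup>+x\<in>{s..t}. ennreal L \<partial>lborel)"
    using st by (simp add: nn_integral_cmult_indicator)
  finally show "ennreal \<bar>f (\<gamma> s) - f (\<gamma> t)\<bar> \<le> (\<integral>\<^sup>+x\<in>{s..t}. ennreal L \<partial>lborel)" .
qed simp

lemma weak_ug_const: "weak_ug M p U (\<lambda>_. c) (\<lambda>_. 0)"
  using weak_ug_lipschitz[of "\<lambda>_. c" 0] by simp

lemma weak_ug_add:
  assumes "weak_ug M p U f g" "weak_ug M p U f' g'"
  shows "weak_ug M p U (\<lambda>x. f x + f' x) (\<lambda>x. g x + g' x)"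
  unfolding weak_ug_iff
proof
  show "(\<lambda>x. g x + g' x) \<in> borel_measurable borel"
    using assms by (intro borel_measurable_add weak_ug_borel)
  have "ae_curve M p (\<lambda>\<gamma> l. (\<forall>s t. 0 \<le> s \<and> s \<le> t \<and> t \<le> l \<and> \<gamma> ` {s..t} \<subseteq> U \<longrightarrow>
        ennreal \<bar>f (\<gamma> s) - f (\<gamma> t)\<bar> \<le> (\<integral>\<^sup>+x\<in>{s..t}. g (\<gamma> x) \<partial>lborel)) \<and>
        (\<forall>s t. 0 \<le> s \<and> s \<le> t \<and> t \<le> l \<and> \<gamma> ` {s..t} \<subseteq> U \<longrightarrow>
        ennreal \<bar>f' (\<gamma> s) - f' (\<gamma> t)\<bar> \<le> (\<integral>\<^sup>+x\<in>{s..t}. g' (\<gamma> x) \<partial>lborel)))"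
    using assms unfolding weak_ug_iff by (intro ae_curve_conj) auto
  then show "ae_curve M p (\<lambda>\<gamma> l. \<forall>s t. 0 \<le> s \<and> s \<le> t \<and> t \<le> l \<and> \<gamma> ` {s..t} \<subseteq> U \<longrightarrow>
        ennreal \<bar>f (\<gamma> s) + f' (\<gamma> s) - (f (\<gamma> t) + f' (\<gamma> t))\<bar> \<le> (\<integral>\<^sup>+x\<in>{s..t}. (g (\<gamma> x) + g' (\<gamma> x)) \<partial>lborel))"
  proof (rule ae_curve_mono, intro allI impI)
    fix \<gamma> :: "real \<Rightarrow> 'a" and l s t
    assume arc: "arc_curve \<gamma> l" and *: "(\<forall>s t. 0 \<le> s \<and> s \<le> t \<and> t \<le> l \<and> \<gamma> ` {s..t} \<subseteq> U \<longrightarrow>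
        ennreal \<bar>f (\<gamma> s) - f (\<gamma> t)\<bar> \<le> (\<integral>\<^sup>+x\<in>{s..t}. g (\<gamma> x) \<partial>lborel)) \<and>
        (\<forall>s t. 0 \<le> s \<and> s \<le> t \<and> t \<le> l \<and> \<gamma> ` {s..t} \<subseteq> U \<longrightarrow>
        ennreal \<bar>f' (\<gamma> s) - f' (\<gamma> t)\<bar> \<le> (\<integral>\<^sup>+x\<in>{s..t}. g' (\<gamma> x) \<partial>lborel))"
      and st: "0 \<le> s \<and> s \<le> t \<and> t \<le> l \<and> \<gamma> ` {s..t} \<subseteq> U"
    have "ennreal \<bar>f (\<gamma> s) + f' (\<gamma> s) - (f (\<gamma> t) + f' (\<gamma> t))\<bar>
        \<le> ennreal (\<bar>f (\<gamma> s) - f (\<gamma> t)\<bar> + \<bar>f' (\<gamma> s) - f' (\<gamma> t)\<bar>)"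
      by (intro ennreal_leI) linarith
    also have "\<dots> = ennreal \<bar>f (\<gamma> s) - f (\<gamma> t)\<bar> + ennreal \<bar>f' (\<gamma> s) - f' (\<gamma> t)\<bar>" by simp
    also have "\<dots> \<le> (\<integral>\<^sup>+x\<in>{s..t}. g (\<gamma> x) \<partial>lborel) + (\<integral>\<^sup>+x\<in>{s..t}. g' (\<gamma> x) \<partial>lborel)"
      using * st by (intro add_mono) auto
    also have "\<dots> = (\<integral>\<^sup>+x. g (\<gamma> x) * indicator {s..t} x + g' (\<gamma> x) * indicator {s..t} x \<partial>lborel)"
      using curve_measurable[OF arc weak_ug_borel[OF assms(1)], of "{s..t}"]
        curve_measurable[OF arc weak_ug_borel[OF assms(2)], of "{s..t}"] st
      by (intro nn_integral_add[symmetric]) auto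
    also have "\<dots> = (\<integral>\<^sup>+x\<in>{s..t}. (g (\<gamma> x) + g' (\<gamma> x)) \<partial>lborel)"
      by (intro nn_integral_cong) (auto split: split_indicator)
    finally show "ennreal \<bar>f (\<gamma> s) + f' (\<gamma> s) - (f (\<gamma> t) + f' (\<gamma> t))\<bar>
        \<le> (\<integral>\<^sup>+x\<in>{s..t}. (g (\<gamma> x) + g' (\<gamma> x)) \<partial>lborel)" .
  qed
qed

lemma weak_ug_cmult:
  assumes "weak_ug M p U f g"
  shows "weak_ug M p U (\<lambda>x. c * f x) (\<lambda>x. ennreal \<bar>c\<bar> * g x)"
  unfolding weak_ug_iff
proof
  show "(\<lambda>x. ennreal \<bar>c\<bar> * g x) \<in> borel_measurable borel"
    using assms by (auto dest: weak_ug_borel)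
  from assms have "ae_curve M p (\<lambda>\<gamma> l. \<forall>s t. 0 \<le> s \<and> s \<le> t \<and> t \<le> l \<and> \<gamma> ` {s..t} \<subseteq> U \<longrightarrow>
        ennreal \<bar>f (\<gamma> s) - f (\<gamma> t)\<bar> \<le> (\<integral>\<^sup>+x\<in>{s..t}. g (\<gamma> x) \<partial>lborel))"
    unfolding weak_ug_iff by simp
  then show "ae_curve M p (\<lambda>\<gamma> l. \<forall>s t. 0 \<le> s \<and> s \<le> t \<and> t \<le> l \<and> \<gamma> ` {s..t} \<subseteq> U \<longrightarrow>
        ennreal \<bar>c * f (\<gamma> s) - c * f (\<gamma> t)\<bar> \<le> (\<integral>\<^sup>+x\<in>{s..t}. (ennreal \<bar>c\<bar> * g (\<gamma> x)) \<partial>lborel))"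
  proof (rule ae_curve_mono, intro allI impI)
    fix \<gamma> :: "real \<Rightarrow> 'a" and l s t
    assume arc: "arc_curve \<gamma> l" and *: "\<forall>s t. 0 \<le> s \<and> s \<le> t \<and> t \<le> l \<and> \<gamma> ` {s..t} \<subseteq> U \<longrightarrow>
        ennreal \<bar>f (\<gamma> s) - f (\<gamma> t)\<bar> \<le> (\<integral>\<^sup>+x\<in>{s..t}. g (\<gamma> x) \<partial>lborel)"
      and st: "0 \<le> s \<and> s \<le> t \<and> t \<le> l \<and> \<gamma> ` {s..t} \<subseteq> U"
    have "ennreal \<bar>c * f (\<gamma> s) - c * f (\<gamma> t)\<bar> = ennreal \<bar>c\<bar> * ennreal \<bar>f (\<gamma> s) - f (\<gamma> t)\<bar>"
      by (metis abs_ge_zero abs_mult ennreal_mult right_diff_distrib)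
    also have "\<dots> \<le> ennreal \<bar>c\<bar> * (\<integral>\<^sup>+x\<in>{s..t}. g (\<gamma> x) \<partial>lborel)"
      using * st by (intro mult_left_mono) auto
    also have "\<dots> = (\<integral>\<^sup>+x\<in>{s..t}. (ennreal \<bar>c\<bar> * g (\<gamma> x)) \<partial>lborel)"
      using curve_measurable[OF arc weak_ug_borel[OF assms], of "{s..t}"] st
      by (simp add: mult.assoc nn_integral_cmult)
    finally show "ennreal \<bar>c * f (\<gamma> s) - c * f (\<gamma> t)\<bar> \<le> (\<integral>\<^sup>+x\<in>{s..t}. (ennreal \<bar>c\<bar> * g (\<gamma> x)) \<partial>lborel)" .
  qed
qed

text \<open>By openness and continuity, each parameter of a curve in the union has a neighbourhood
  mapped into one of the two sets. There the corresponding gradient bounds the increments, and the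
  local estimates add up.\<close>

lemma weak_ug_glue:
  assumes "weak_ug M p U1 f g1" "weak_ug M p U2 f g2" "open U1" "open U2"
    and "h \<in> borel_measurable borel" "\<And>x. x \<in> U1 \<Longrightarrow> g1 x \<le> h x" "\<And>x. x \<in> U2 \<Longrightarrow> g2 x \<le> h x"
  shows "weak_ug M p (U1 \<union> U2) f h"
  unfolding weak_ug_iff
proof
  have 1: "weak_ug M p U1 f h" by (rule weak_ug_mono[OF assms(1)]) (use assms in auto)
  have 2: "weak_ug M p U2 f h" by (rule weak_ug_mono[OF assms(2)]) (use assms in auto)
  have "ae_curve M p (\<lambda>\<gamma> l. (\<forall>s t. 0 \<le> s \<and> s \<le> t \<and> t \<le> l \<and> \<gamma> ` {s..t} \<subseteq> U1 \<longrightarrow>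
        ennreal \<bar>f (\<gamma> s) - f (\<gamma> t)\<bar> \<le> (\<integral>\<^sup>+x\<in>{s..t}. h (\<gamma> x) \<partial>lborel)) \<and>
        (\<forall>s t. 0 \<le> s \<and> s \<le> t \<and> t \<le> l \<and> \<gamma> ` {s..t} \<subseteq> U2 \<longrightarrow>
        ennreal \<bar>f (\<gamma> s) - f (\<gamma> t)\<bar> \<le> (\<integral>\<^sup>+x\<in>{s..t}. h (\<gamma> x) \<partial>lborel)))"
    using 1 2 unfolding weak_ug_iff by (intro ae_curve_conj) auto
  then show "ae_curve M p (\<lambda>\<gamma> l. \<forall>s t. 0 \<le> s \<and> s \<le> t \<and> t \<le> l \<and> \<gamma> ` {s..t} \<subseteq> U1 \<union> U2 \<longrightarrow>
        ennreal \<bar>f (\<gamma> s) - f (\<gamma> t)\<bar> \<le> (\<integral>\<^sup>+x\<in>{s..t}. h (\<gamma> x) \<partial>lborel))"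
  proof (rule ae_curve_mono, intro allI impI)
    fix \<gamma> :: "real \<Rightarrow> 'a" and l s t
    assume arc: "arc_curve \<gamma> l" and *: "(\<forall>s t. 0 \<le> s \<and> s \<le> t \<and> t \<le> l \<and> \<gamma> ` {s..t} \<subseteq> U1 \<longrightarrow>
        ennreal \<bar>f (\<gamma> s) - f (\<gamma> t)\<bar> \<le> (\<integral>\<^sup>+x\<in>{s..t}. h (\<gamma> x) \<partial>lborel)) \<and>
        (\<forall>s t. 0 \<le> s \<and> s \<le> t \<and> t \<le> l \<and> \<gamma> ` {s..t} \<subseteq> U2 \<longrightarrow>
        ennreal \<bar>f (\<gamma> s) - f (\<gamma> t)\<bar> \<le> (\<integral>\<^sup>+x\<in>{s..t}. h (\<gamma> x) \<partial>lborel))"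
      and st: "0 \<le> s \<and> s \<le> t \<and> t \<le> l \<and> \<gamma> ` {s..t} \<subseteq> U1 \<union> U2"
    have cont: "continuous_on {s..t} \<gamma>"
      using st by (intro continuous_on_subset[OF arc_curve_continuous[OF arc]]) auto
    show "ennreal \<bar>f (\<gamma> s) - f (\<gamma> t)\<bar> \<le> (\<integral>\<^sup>+x\<in>{s..t}. h (\<gamma> x) \<partial>lborel)"
    proof (rule increment_le_local_to_global[of s t "\<lambda>x. h (\<gamma> x)" "\<lambda>x. f (\<gamma> x)"])
      show "s \<le> t" using st by simp
      show "(\<lambda>x. h (\<gamma> x) * indicator {s..t} x) \<in> borel_measurable borel"
        using st by (intro curve_measurable[OF arc assms(5)]) auto
      fix x assume x: "s \<le> x" "x \<le> t"
      have "\<gamma> x \<in> U1 \<union> U2" using st x by (simp add: image_subset_iff)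
      then obtain V where V: "V = U1 \<or> V = U2" "\<gamma> x \<in> V" by blast
      then obtain d where d: "0 < d" "\<And>y. y \<in> {s..t} \<Longrightarrow> \<bar>y - x\<bar> < d \<Longrightarrow> \<gamma> y \<in> V"
        using continuous_on_Icc_near[OF cont, of x V] x assms(3,4) by auto
      have "ennreal \<bar>f (\<gamma> a) - f (\<gamma> b)\<bar> \<le> (\<integral>\<^sup>+x\<in>{a..b}. h (\<gamma> x) \<partial>lborel)"
        if "s \<le> a \<and> a \<le> x \<and> x \<le> b \<and> b \<le> t \<and> b - a < d" for a b
      proof -
        have "\<gamma> ` {a..b} \<subseteq> V" using that d(2) by auto
        then show ?thesis using * st that V(1) by auto
      qed
      then show "\<exists>d>0. \<forall>a b. s \<le> a \<and> a \<le> x \<and> x \<le> b \<and> b \<le> t \<and> b - a < d \<longrightarrow>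
           ennreal \<bar>f (\<gamma> a) - f (\<gamma> b)\<bar> \<le> (\<integral>\<^sup>+x\<in>{a..b}. h (\<gamma> x) \<partial>lborel)"
        using d(1) by blast
    qed
  qed
qed fact

lemma borel_strict_sublevel:
  fixes f :: "'a \<Rightarrow> real"
  assumes "continuous_on U f" "open U"
  shows "open {x\<in>U. f x < b}" "{x\<in>U. f x < b} \<in> sets borel"
proof -
  have "open (f -` {..<b} \<inter> U)"
    using assms by (simp add: continuous_on_open_vimage)
  moreover have "f -` {..<b} \<inter> U = {x\<in>U. f x < b}" by auto
  ultimately show "open {x\<in>U. f x < b}" by simp
  then show "{x\<in>U. f x < b} \<in> sets borel" by simp
qed

text \<open>\<open>min f (b - e)\<close> is constant on the open set where \<open>f > b - e\<close>; glue there and let \<open>e\<close> tend to \<open>0\<close>.\<close>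
lemma weak_ug_min_const:
  assumes ug: "weak_ug M p U f g" and cont: "continuous_on U f" and "open U"
  shows "weak_ug M p U (\<lambda>x. min (f x) b) (\<lambda>x. g x * indicator {x\<in>U. f x < b} x)"
  unfolding weak_ug_iff
proof
  note [measurable] = borel_strict_sublevel(2)[OF cont \<open>open U\<close>] weak_ug_borel[OF ug]
  define h where "h x = g x * indicator {x\<in>U. f x < b} x" for x
  have h[measurable]: "h \<in> borel_measurable borel" unfolding h_def by measurable
  then show "(\<lambda>x. g x * indicator {x\<in>U. f x < b} x) \<in> borel_measurable borel"
    unfolding h_def .
  have "weak_ug M p U (\<lambda>x. min (f x) (b - 1 / Suc n)) h" for n
  proof -
    have "continuous_on U (\<lambda>x. - f x)" using cont by (intro continuous_intros)
    from borel_strict_sublevel(1)[OF this \<open>open U\<close>, of "- (b - 1 / Suc n)"]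
    moreover have "{x\<in>U. - f x < - (b - 1 / Suc n)} = {x\<in>U. f x > b - 1 / Suc n}" by auto
    ultimately have op: "open {x\<in>U. f x > b - 1 / Suc n}" by simp
    have *: "weak_ug M p {x\<in>U. f x > b - 1 / Suc n} (\<lambda>x. min (f x) (b - 1 / Suc n)) (\<lambda>_. 0)"
      by (rule weak_ug_mono[OF weak_ug_const[of UNIV 0]]) auto
    have "weak_ug M p {x\<in>U. f x < b} (\<lambda>x. min (f x) (b - 1 / Suc n)) h"
      by (rule weak_ug_mono[OF ug]) (auto simp: h_def)
    from weak_ug_glue[OF * this op borel_strict_sublevel(1)[OF cont \<open>open U\<close>] h]
    have "weak_ug M p ({x\<in>U. f x > b - 1 / Suc n} \<union> {x\<in>U. f x < b}) (\<lambda>x. min (f x) (b - 1 / Suc n)) h"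
      by simp
    moreover have "{x\<in>U. f x > b - 1 / Suc n} \<union> {x\<in>U. f x < b} = U"
      by (auto simp: not_less intro: less_le_trans[of _ b])
    ultimately show ?thesis by simp
  qed
  \<comment> \<open>Only countably many levels occur, so a single exceptional family serves them all
    and the limit can be taken on each remaining curve.\<close>
  then have "ae_curve M p (\<lambda>\<gamma> l. \<forall>n. \<forall>s t. 0 \<le> s \<and> s \<le> t \<and> t \<le> l \<and> \<gamma> ` {s..t} \<subseteq> U \<longrightarrow>
      ennreal \<bar>min (f (\<gamma> s)) (b - 1 / Suc n) - min (f (\<gamma> t)) (b - 1 / Suc n)\<bar> \<le> (\<integral>\<^sup>+x\<in>{s..t}. h (\<gamma> x) \<partial>lborel))"
    unfolding weak_ug_iff by (intro ae_curve_all) auto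
  then have "ae_curve M p (\<lambda>\<gamma> l. \<forall>s t. 0 \<le> s \<and> s \<le> t \<and> t \<le> l \<and> \<gamma> ` {s..t} \<subseteq> U \<longrightarrow>
        ennreal \<bar>min (f (\<gamma> s)) b - min (f (\<gamma> t)) b\<bar> \<le> (\<integral>\<^sup>+x\<in>{s..t}. h (\<gamma> x) \<partial>lborel))"
  proof (rule ae_curve_mono, intro allI impI)
    fix \<gamma> :: "real \<Rightarrow> 'a" and l s t
    assume *: "\<forall>n. \<forall>s t. 0 \<le> s \<and> s \<le> t \<and> t \<le> l \<and> \<gamma> ` {s..t} \<subseteq> U \<longrightarrow>
      ennreal \<bar>min (f (\<gamma> s)) (b - 1 / Suc n) - min (f (\<gamma> t)) (b - 1 / Suc n)\<bar> \<le> (\<integral>\<^sup>+x\<in>{s..t}. h (\<gamma> x) \<partial>lborel)"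
      and st: "0 \<le> s \<and> s \<le> t \<and> t \<le> l \<and> \<gamma> ` {s..t} \<subseteq> U"
    have lim: "(\<lambda>n. b - 1 / real (Suc n)) \<longlonglongrightarrow> b - 0"
      by (intro tendsto_intros LIMSEQ_Suc[OF lim_1_over_n])
    have lim': "(\<lambda>n. ennreal \<bar>min (f (\<gamma> s)) (b - 1 / Suc n) - min (f (\<gamma> t)) (b - 1 / Suc n)\<bar>)
       \<longlonglongrightarrow> ennreal \<bar>min (f (\<gamma> s)) (b - 0) - min (f (\<gamma> t)) (b - 0)\<bar>"
      by (intro tendsto_intros lim)
    have "ennreal \<bar>min (f (\<gamma> s)) (b - 0) - min (f (\<gamma> t)) (b - 0)\<bar> \<le> (\<integral>\<^sup>+x\<in>{s..t}. h (\<gamma> x) \<partial>lborel)"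
      by (rule LIMSEQ_le_const2[OF lim']) (use * st in blast)
    then show "ennreal \<bar>min (f (\<gamma> s)) b - min (f (\<gamma> t)) b\<bar> \<le> (\<integral>\<^sup>+x\<in>{s..t}. h (\<gamma> x) \<partial>lborel)"
      by simp
  qed
  then show "ae_curve M p (\<lambda>\<gamma> l. \<forall>s t. 0 \<le> s \<and> s \<le> t \<and> t \<le> l \<and> \<gamma> ` {s..t} \<subseteq> U \<longrightarrow>
        ennreal \<bar>min (f (\<gamma> s)) b - min (f (\<gamma> t)) b\<bar>
        \<le> (\<integral>\<^sup>+x\<in>{s..t}. (g (\<gamma> x) * indicator {x\<in>U. f x < b} (\<gamma> x)) \<partial>lborel))"
    unfolding h_def .
qed

lemma weak_ug_max_const:
  assumes ug: "weak_ug M p U f g" and cont: "continuous_on U f" and "open U"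
  shows "weak_ug M p U (\<lambda>x. max (f x) b) (\<lambda>x. g x * indicator {x\<in>U. b < f x} x)"
proof -
  have "weak_ug M p U (\<lambda>x. - f x) g"
    by (rule weak_ug_mono[OF ug]) (use weak_ug_borel[OF ug] in auto)
  then have "weak_ug M p U (\<lambda>x. min (- f x) (- b)) (\<lambda>x. g x * indicator {x\<in>U. - f x < - b} x)"
    using \<open>open U\<close> cont by (intro weak_ug_min_const continuous_intros)
  then have *: "weak_ug M p U (\<lambda>x. min (- f x) (- b)) (\<lambda>x. g x * indicator {x\<in>U. b < f x} x)"
    by simp
  show ?thesis
    by (rule weak_ug_mono[OF *]) (use weak_ug_borel[OF *] in auto)
qed

end

section \<open>Minimal weak upper gradients\<close>

text \<open>An order-reversing bijection of \<open>[0, \<infinity>]\<close> onto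
  \<open>[0, 1]\<close>: it makes gradients with possibly infinite values and infinite energy
  comparable through finite integrals.\<close>

lemma inverse_one_add_le_iff:
  fixes x y :: ennreal
  shows "inverse (1 + y) \<le> inverse (1 + x) \<longleftrightarrow> x \<le> y"
proof (cases x rule: ennreal_cases)
  case x: (real a)
  have *: "inverse (1 + ennreal c) = ennreal (inverse (1 + c))" if "0 \<le> c" for c
    using that by (subst inverse_ennreal[symmetric]) auto
  show ?thesis
    by (cases y rule: ennreal_cases) (use x in \<open>auto simp: *\<close>)
next
  case top
  then show ?thesis by (auto simp: top_unique)
qed

text \<open>Compactness of closed balls turns local integrability into integrability on bounded
  closed subsets. In the theorem it is obtained from completeness and doubling.\<close>

locale proper_metric_measure = metric_measure M p for M :: "'a::metric_space measure" and p +
  assumes compact_cball: "\<And>(x::'a) r. compact (cball x r)"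
    and finite_balls: "\<And>x r. emeasure M (ball x r) < \<infinity>"
begin

lemma borel_in_sets: "A \<in> sets borel \<Longrightarrow> A \<in> sets M"
  using borel_sets by auto

lemma Lp_loc_compact:
  assumes "Lp_loc M q U g" "compact K" "K \<subseteq> U" "g \<in> borel_measurable borel"
  shows "(\<integral>\<^sup>+x\<in>K. epow (g x) q \<partial>M) < \<infinity>"
proof -
  note [measurable] = borel_measurable_M[OF assms(4)]
  obtain r where r: "\<And>x. x \<in> K \<Longrightarrow> 0 < r x \<and> (\<integral>\<^sup>+y \<in> ball x (r x). epow (g y) q \<partial>M) < \<infinity>"
    using assms(1,3) unfolding Lp_loc_def by (metis subsetD)
  obtain D where D: "D \<subseteq> K" "finite D" "K \<subseteq> (\<Union>x\<in>D. ball x (r x))"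
  proof (rule compactE_image[OF assms(2), of K "\<lambda>x. ball x (r x)"])
    show "K \<subseteq> (\<Union>x\<in>K. ball x (r x))" using r by (auto intro!: UN_I)
  qed auto
  have [measurable]: "ball x s \<in> sets M" for x s by (intro borel_in_sets) simp
  have "(\<integral>\<^sup>+x\<in>K. epow (g x) q \<partial>M) \<le> (\<integral>\<^sup>+x. (\<Sum>y\<in>D. epow (g x) q * indicator (ball y (r y)) x) \<partial>M)"
  proof (rule nn_integral_mono)
    fix x
    show "epow (g x) q * indicator K x \<le> (\<Sum>y\<in>D. epow (g x) q * indicator (ball y (r y)) x)"
    proof (cases "x \<in> K")
      case True
      then obtain y where y: "y \<in> D" "x \<in> ball y (r y)" using D(3) by blast
      then show ?thesis
        using member_le_sum[of y D "\<lambda>y. epow (g x) q * indicator (ball y (r y)) x"] D(2)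
        by (simp add: indicator_def split: if_splits)
    qed simp
  qed
  also have "\<dots> = (\<Sum>y\<in>D. \<integral>\<^sup>+x\<in>ball y (r y). epow (g x) q \<partial>M)"
    by (intro nn_integral_sum) measurable
  also have "\<dots> < \<infinity>"
    using r D(1,2) by (auto simp: less_top[symmetric])
  finally show ?thesis .
qed

text \<open>\<open>g\<close> is only locally \<open>p\<close>-integrable, so it cannot witness the
  claim itself. Its restrictions to the members of a compact exhaustion of \<open>U\<close> can, and
  every compact curve in \<open>U\<close> lies in one of them.\<close>

lemma ae_curve_finite_integral:
  assumes "open U" "g \<in> borel_measurable borel" "Lp_loc M p U g"
  shows "ae_curve M p (\<lambda>\<gamma> l. \<forall>s t. 0 \<le> s \<and> s \<le> t \<and> t \<le> l \<and> \<gamma> ` {s..t} \<subseteq> U \<longrightarrow>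
     (\<integral>\<^sup>+x\<in>{s..t}. g (\<gamma> x) \<partial>lborel) < \<infinity>)"
proof -
  fix a :: 'a
  \<comment> \<open>Points within distance \<open>n\<close> of \<open>a\<close> that keep distance
    at least \<open>1 / (n + 1)\<close> from the complement of \<open>U\<close>.\<close>
  define K where "K n = cball a (real n) \<inter> (\<Inter>y\<in>-U. {x. 1 / real (Suc n) \<le> dist x y})" for n
  have cK: "compact (K n)" for n
    unfolding K_def
    by (intro compact_Int_closed compact_cball closed_INT ballI closed_Collect_le continuous_intros)
  have KU: "K n \<subseteq> U" for n
  proof
    fix x assume x: "x \<in> K n"
    show "x \<in> U"
    proof (rule ccontr)
      assume "x \<notin> U"
      then have "1 / real (Suc n) \<le> dist x x" using x unfolding K_def by blast
      then show False by simp
    qed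
  qed
  have [measurable]: "K n \<in> sets borel" for n
    by (intro borel_closed compact_imp_closed cK)
  note [measurable] = assms(2)
  have "ae_curve M p (\<lambda>\<gamma> l. line_int (\<lambda>x. g x * indicator (K n) x) \<gamma> l < \<infinity>)" for n
    unfolding ae_curve_def
  proof (intro exI conjI allI impI)
    show "(\<integral>\<^sup>+x. epow (g x * indicator (K n) x) p \<partial>M) < \<infinity>"
      unfolding epow_mult_indicator using Lp_loc_compact[OF assms(3) cK KU assms(2)] .
  qed auto
  then have "ae_curve M p (\<lambda>\<gamma> l. \<forall>n. line_int (\<lambda>x. g x * indicator (K n) x) \<gamma> l < \<infinity>)"
    by (rule ae_curve_all)
  then show ?thesis
  proof (rule ae_curve_mono, intro allI impI)
    fix \<gamma> :: "real \<Rightarrow> 'a" and l s t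
    assume arc: "arc_curve \<gamma> l" and *: "\<forall>n. line_int (\<lambda>x. g x * indicator (K n) x) \<gamma> l < \<infinity>"
      and st: "0 \<le> s \<and> s \<le> t \<and> t \<le> l \<and> \<gamma> ` {s..t} \<subseteq> U"
    have cpt: "compact (\<gamma> ` {s..t})"
      using st by (intro compact_continuous_image continuous_on_subset[OF arc_curve_continuous[OF arc]]) auto
    obtain e where e: "0 < e" "(\<Union>x\<in>\<gamma> ` {s..t}. ball x e) \<subseteq> U"
      using compact_subset_open_imp_ball_epsilon_subset[OF cpt \<open>open U\<close>] st by auto
    obtain R where R: "\<And>x. x \<in> \<gamma> ` {s..t} \<Longrightarrow> dist a x \<le> R"
      using compact_imp_bounded[OF cpt] unfolding bounded_any_center[where a=a] by auto
    obtain n where n: "max R (1 / e) < real n" using reals_Archimedean2 by blast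
    have "1 / real (Suc n) < e"
    proof -
      have "1 / e < real (Suc n)" using n by simp
      then show ?thesis using e(1) by (simp add: field_simps)
    qed
    have "\<gamma> ` {s..t} \<subseteq> K n"
    proof
      fix z assume z: "z \<in> \<gamma> ` {s..t}"
      have "1 / real (Suc n) \<le> dist z y" if "y \<notin> U" for y
      proof -
        have "y \<notin> ball z e" using e(2) z that by blast
        then show ?thesis using \<open>1 / real (Suc n) < e\<close> by simp
      qed
      moreover have "dist a z \<le> real n" using R[OF z] n by simp
      ultimately show "z \<in> K n" unfolding K_def by simp
    qed
    then have "(\<integral>\<^sup>+x\<in>{s..t}. g (\<gamma> x) \<partial>lborel) \<le> line_int (\<lambda>x. g x * indicator (K n) x) \<gamma> l"
      unfolding line_int_def using st
      by (intro nn_integral_mono) (auto split: split_indicator simp: image_subset_iff)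
    then show "(\<integral>\<^sup>+x\<in>{s..t}. g (\<gamma> x) \<partial>lborel) < \<infinity>"
      using * le_less_trans by blast
  qed
qed

lemma Lp_loc_mono:
  assumes "Lp_loc M p U g" "\<And>x. x \<in> U \<Longrightarrow> h x \<le> g x"
  shows "Lp_loc M p U h"
  unfolding Lp_loc_def
proof
  fix x assume "x \<in> U"
  then obtain r where r: "0 < r" "ball x r \<subseteq> U" "(\<integral>\<^sup>+ y \<in> ball x r. epow (g y) p \<partial>M) < \<infinity>"
    using assms(1) unfolding Lp_loc_def by blast
  have "(\<integral>\<^sup>+ y \<in> ball x r. epow (h y) p \<partial>M) \<le> (\<integral>\<^sup>+ y \<in> ball x r. epow (g y) p \<partial>M)"
    using r(2) by (intro set_nn_integral_mono_on epow_mono p_pos assms(2)) auto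
  with r show "\<exists>r>0. ball x r \<subseteq> U \<and> (\<integral>\<^sup>+ y \<in> ball x r. epow (h y) p \<partial>M) < \<infinity>"
    using le_less_trans by blast
qed

text \<open>Local integrability makes both line integrals finite on almost every curve, which
  supplies the finite measure on the parameter interval that \<open>increment_le_min\<close> relies
  on.\<close>

lemma weak_ug_min:
  assumes "open U" "weak_ug M p U f g1" "Lp_loc M p U g1" "weak_ug M p U f g2" "Lp_loc M p U g2"
  shows "weak_ug M p U f (\<lambda>x. min (g1 x) (g2 x))"
  unfolding weak_ug_iff
proof
  note [measurable] = weak_ug_borel[OF assms(2)] weak_ug_borel[OF assms(4)]
  show "(\<lambda>x. min (g1 x) (g2 x)) \<in> borel_measurable borel" by measurable
  let ?P = "\<lambda>g \<gamma> l. \<forall>s t. 0 \<le> s \<and> s \<le> t \<and> t \<le> l \<and> \<gamma> ` {s..t} \<subseteq> U \<longrightarrow>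
     (\<integral>\<^sup>+x\<in>{s..t}. g (\<gamma> x) \<partial>lborel) < \<infinity>"
  let ?Q = "\<lambda>g \<gamma> l. \<forall>s t. 0 \<le> s \<and> s \<le> t \<and> t \<le> l \<and> \<gamma> ` {s..t} \<subseteq> U \<longrightarrow>
        ennreal \<bar>f (\<gamma> s) - f (\<gamma> t)\<bar> \<le> (\<integral>\<^sup>+x\<in>{s..t}. g (\<gamma> x) \<partial>lborel)"
  have "ae_curve M p (\<lambda>\<gamma> l. (?P g1 \<gamma> l \<and> ?P g2 \<gamma> l) \<and> ?Q g1 \<gamma> l \<and> ?Q g2 \<gamma> l)"
    using assms unfolding weak_ug_iff by (intro ae_curve_conj ae_curve_finite_integral) auto
  then show "ae_curve M p (?Q (\<lambda>x. min (g1 x) (g2 x)))"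
  proof (rule ae_curve_mono, intro allI impI)
    fix \<gamma> :: "real \<Rightarrow> 'a" and l s t
    assume arc: "arc_curve \<gamma> l" and *: "(?P g1 \<gamma> l \<and> ?P g2 \<gamma> l) \<and> ?Q g1 \<gamma> l \<and> ?Q g2 \<gamma> l"
      and st: "0 \<le> s \<and> s \<le> t \<and> t \<le> l \<and> \<gamma> ` {s..t} \<subseteq> U"
    from * have P1: "?P g1 \<gamma> l" and P2: "?P g2 \<gamma> l" and Q1: "?Q g1 \<gamma> l" and Q2: "?Q g2 \<gamma> l"
      by simp_all
    have sub: "0 \<le> a \<and> a \<le> b \<and> b \<le> l \<and> \<gamma> ` {a..b} \<subseteq> U" if "s \<le> a" "a \<le> b" "b \<le> t" for a b
    proof -
      have "\<gamma> ` {a..b} \<subseteq> \<gamma> ` {s..t}" using that by (intro image_mono) auto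
      then show ?thesis using that st by (meson order_trans)
    qed
    show "ennreal \<bar>f (\<gamma> s) - f (\<gamma> t)\<bar> \<le> (\<integral>\<^sup>+x\<in>{s..t}. min (g1 (\<gamma> x)) (g2 (\<gamma> x)) \<partial>lborel)"
    proof (rule increment_le_min[of s t _ _ "\<lambda>x. f (\<gamma> x)"])
      show "s \<le> t" using st by simp
      show "(\<lambda>x. g1 (\<gamma> x) * indicator {s..t} x) \<in> borel_measurable borel"
        using st by (intro curve_measurable[OF arc]) auto
      show "(\<lambda>x. g2 (\<gamma> x) * indicator {s..t} x) \<in> borel_measurable borel"
        using st by (intro curve_measurable[OF arc]) auto
      show "(\<integral>\<^sup>+x\<in>{s..t}. g1 (\<gamma> x) \<partial>lborel) < \<infinity>" using P1 st by simp
      show "(\<integral>\<^sup>+x\<in>{s..t}. g2 (\<gamma> x) \<partial>lborel) < \<infinity>" using P2 st by simp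
      fix a b assume "s \<le> a" "a \<le> b" "b \<le> t"
      note ab = sub[OF this]
      show "ennreal \<bar>f (\<gamma> a) - f (\<gamma> b)\<bar> \<le> (\<integral>\<^sup>+x\<in>{a..b}. g1 (\<gamma> x) \<partial>lborel)" using Q1 ab by simp
      show "ennreal \<bar>f (\<gamma> a) - f (\<gamma> b)\<bar> \<le> (\<integral>\<^sup>+x\<in>{a..b}. g2 (\<gamma> x) \<partial>lborel)" using Q2 ab by simp
    qed
  qed
qed

text \<open>Monotone convergence from above along the curve; its finite starting integral comes from
  the local integrability of \<open>g 0\<close>.\<close>

lemma weak_ug_INF:
  assumes "open U" "\<And>n. weak_ug M p U f (g n)" "Lp_loc M p U (g 0)" "decseq g"
  shows "weak_ug M p U f (\<lambda>x. INF n. g n x)"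
  unfolding weak_ug_iff
proof
  note [measurable] = weak_ug_borel[OF assms(2)]
  show "(\<lambda>x. INF n. g n x) \<in> borel_measurable borel" by measurable
  let ?P = "\<lambda>g \<gamma> l. \<forall>s t. 0 \<le> s \<and> s \<le> t \<and> t \<le> l \<and> \<gamma> ` {s..t} \<subseteq> U \<longrightarrow>
     (\<integral>\<^sup>+x\<in>{s..t}. g (\<gamma> x) \<partial>lborel) < \<infinity>"
  let ?Q = "\<lambda>g \<gamma> l. \<forall>s t. 0 \<le> s \<and> s \<le> t \<and> t \<le> l \<and> \<gamma> ` {s..t} \<subseteq> U \<longrightarrow>
        ennreal \<bar>f (\<gamma> s) - f (\<gamma> t)\<bar> \<le> (\<integral>\<^sup>+x\<in>{s..t}. g (\<gamma> x) \<partial>lborel)"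
  have "ae_curve M p (\<lambda>\<gamma> l. ?P (g 0) \<gamma> l \<and> (\<forall>n. ?Q (g n) \<gamma> l))"
    using assms unfolding weak_ug_iff by (intro ae_curve_conj ae_curve_all ae_curve_finite_integral) auto
  then show "ae_curve M p (?Q (\<lambda>x. INF n. g n x))"
  proof (rule ae_curve_mono, intro allI impI)
    fix \<gamma> :: "real \<Rightarrow> 'a" and l s t
    assume arc: "arc_curve \<gamma> l" and *: "?P (g 0) \<gamma> l \<and> (\<forall>n. ?Q (g n) \<gamma> l)"
      and st: "0 \<le> s \<and> s \<le> t \<and> t \<le> l \<and> \<gamma> ` {s..t} \<subseteq> U"
    have "ennreal \<bar>f (\<gamma> s) - f (\<gamma> t)\<bar> \<le> (INF n. \<integral>\<^sup>+x\<in>{s..t}. g n (\<gamma> x) \<partial>lborel)"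
      using * st by (intro INF_greatest) blast
    also have "\<dots> = (\<integral>\<^sup>+x. (INF n. g n (\<gamma> x) * indicator {s..t} x) \<partial>lborel)"
    proof (rule nn_integral_monotone_convergence_INF_decseq[symmetric])
      show "decseq (\<lambda>n x. g n (\<gamma> x) * indicator {s..t} x)"
        using decseqD[OF assms(4), THEN le_funD]
        by (intro decseq_SucI) (simp add: le_fun_def mult_right_mono)
      show "(\<lambda>x. g n (\<gamma> x) * indicator {s..t} x) \<in> borel_measurable lborel" for n
        using curve_measurable[OF arc weak_ug_borel[OF assms(2)], of "{s..t}"] st by auto
      show "(\<integral>\<^sup>+x\<in>{s..t}. g 0 (\<gamma> x) \<partial>lborel) < \<infinity>" using * st by blast
    qed
    also have "\<dots> = (\<integral>\<^sup>+x\<in>{s..t}. (INF n. g n (\<gamma> x)) \<partial>lborel)"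
      by (intro nn_integral_cong) (auto split: split_indicator)
    finally show "ennreal \<bar>f (\<gamma> s) - f (\<gamma> t)\<bar> \<le> (\<integral>\<^sup>+x\<in>{s..t}. (INF n. g n (\<gamma> x)) \<partial>lborel)" .
  qed
qed

lemma sigma_finite_M: "sigma_finite_measure M"
proof
  fix a :: 'a
  have "(\<Union>n. ball a (real n)) = UNIV"
    using reals_Archimedean2 by (auto simp: mem_ball)
  then show "\<exists>A. countable A \<and> A \<subseteq> sets M \<and> \<Union> A = space M \<and> (\<forall>a\<in>A. emeasure M a \<noteq> \<infinity>)"
    using finite_balls borel_in_sets
    by (intro exI[of _ "range (\<lambda>n. ball a (real n))"]) (auto simp: space_UNIV less_top)
qed

text \<open>The weak upper gradients in \<open>Lp_loc\<close> form a lattice, closed under decreasing limits; one that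
  maximises \<open>\<integral>\<^sub>U inverse (1 + g) k\<close> for a positive integrable weight \<open>k\<close> is minimal.\<close>
theorem ex_minimal_wug:
  assumes "open U" "weak_ug M p U f g0" "Lp_loc M p U g0"
  shows "\<exists>g. minimal_wug M p U f g"
proof -
  interpret sigma_finite_measure M by (rule sigma_finite_M)
  obtain k where [measurable]: "k \<in> borel_measurable M" and k: "integral\<^sup>N M k \<noteq> \<infinity>"
    "\<And>x. 0 < k x \<and> k x < \<infinity>"
    using Ex_finite_integrable_function space_UNIV by auto
  have [measurable]: "U \<in> sets M" using assms(1) by (intro borel_in_sets) simp
  define \<G> where "\<G> = {g. weak_ug M p U f g \<and> Lp_loc M p U g}"
  have \<G>_meas: "g \<in> borel_measurable M" if "g \<in> \<G>" for g
    using that by (auto simp: \<G>_def intro: borel_measurable_M weak_ug_borel)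
  define J where "J g = (\<integral>\<^sup>+x\<in>U. (inverse (1 + g x) * k x) \<partial>M)" for g
  have J_mono: "J g \<le> J h" if "\<And>x. x \<in> U \<Longrightarrow> h x \<le> g x" for g h
    unfolding J_def using that
    by (intro set_nn_integral_mono_on mult_right_mono) (auto simp: inverse_one_add_le_iff)
  have inv_le: "inverse (1 + y) \<le> (1::ennreal)" for y :: ennreal
    using inverse_one_add_le_iff[of y 0] by simp
  have J_fin: "J g \<noteq> \<infinity>" for g
  proof -
    have "J g \<le> integral\<^sup>N M k"
      unfolding J_def using inv_le mult_right_mono[OF inv_le]
      by (intro nn_integral_mono) (auto split: split_indicator)
    then show ?thesis using k(1) by (auto simp: top_unique)
  qed
  have "\<G> \<noteq> {}" using assms by (auto simp: \<G>_def)
  from ennreal_SUP_countable_SUP[OF this, of J] obtain F :: "nat \<Rightarrow> ennreal"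
    where F: "range F \<subseteq> J ` \<G>" "(SUP g\<in>\<G>. J g) = (SUP n. F n)" by auto
  obtain g where g: "\<And>n. g n \<in> \<G>" "\<And>n. F n = J (g n)"
  proof -
    have "\<forall>n. \<exists>g. g \<in> \<G> \<and> F n = J g" using F(1) by blast
    then show ?thesis using that by metis
  qed
  \<comment> \<open>Running minima make the maximising sequence decreasing. They stay in
    \<open>\<G>\<close>, and since \<open>J\<close> reverses the order their values of
    \<open>J\<close> are no smaller.\<close>
  define G where "G = rec_nat (g 0) (\<lambda>n h x. min (h x) (g (Suc n) x))"
  have G_simps: "G 0 = g 0" "G (Suc n) = (\<lambda>x. min (G n x) (g (Suc n) x))" for n
    by (simp_all add: G_def)
  have min_\<G>: "(\<lambda>x. min (g1 x) (g2 x)) \<in> \<G>" if "g1 \<in> \<G>" "g2 \<in> \<G>" for g1 g2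
    using that \<open>open U\<close> unfolding \<G>_def by (auto intro: weak_ug_min Lp_loc_mono)
  have G: "G n \<in> \<G>" for n
    by (induction n) (auto simp: G_simps g intro!: min_\<G>)
  have Gg: "G n x \<le> g n x" for n x
    by (cases n) (auto simp: G_simps)
  define h where "h x = (INF n. G n x)" for x
  have h: "h \<in> \<G>"
  proof -
    have "weak_ug M p U f (\<lambda>x. INF n. G n x)"
    proof (rule weak_ug_INF[OF \<open>open U\<close>])
      show "weak_ug M p U f (G n)" "Lp_loc M p U (G 0)" for n using G unfolding \<G>_def by auto
      show "decseq G" by (rule decseq_SucI) (simp add: G_simps le_fun_def)
    qed
    moreover have "Lp_loc M p U h"
    proof (rule Lp_loc_mono)
      show "Lp_loc M p U (G 0)" using G unfolding \<G>_def by auto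
      show "h x \<le> G 0 x" for x unfolding h_def by (rule INF_lower) simp
    qed
    ultimately show ?thesis by (simp add: \<G>_def h_def[abs_def])
  qed
  have J_max: "J g' \<le> J h" if "g' \<in> \<G>" for g'
  proof -
    have "J g' \<le> (SUP n. F n)" using that F(2) by (metis SUP_upper)
    also have "\<dots> \<le> J h"
      unfolding g(2) by (intro SUP_least J_mono) (auto simp: h_def intro: INF_lower2 Gg)
    finally show ?thesis .
  qed
  have "AE x in M. x \<in> U \<longrightarrow> h x \<le> g' x" if g': "g' \<in> \<G>" for g'
  proof -
    \<comment> \<open>If \<open>h\<close> exceeded \<open>g'\<close> on a set of positive measure in
      \<open>U\<close>, then \<open>m\<close> would have strictly larger \<open>J\<close>: the
      weight is positive and \<open>J h\<close> is finite.\<close>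
    define m where "m x = min (h x) (g' x)" for x
    have m: "m \<in> \<G>" using min_\<G>[OF h g'] by (simp add: m_def[abs_def])
    note [measurable] = \<G>_meas[OF m] \<G>_meas[OF h]
    have le: "inverse (1 + h x) * k x * indicator U x \<le> inverse (1 + m x) * k x * indicator U x" for x
      by (intro mult_right_mono) (auto simp: inverse_one_add_le_iff m_def)
    have "AE x in M. inverse (1 + m x) * k x * indicator U x \<le> inverse (1 + h x) * k x * indicator U x"
    proof (rule ccontr)
      assume "\<not> ?thesis"
      then have "J h < J m"
        unfolding J_def using le J_fin[of h] by (intro nn_integral_less) (auto simp: J_def)
      then show False using J_max[OF m] by simp
    qed
    then show ?thesis
    proof (rule eventually_mono, intro impI)
      fix x assume *: "inverse (1 + m x) * k x * indicator U x \<le> inverse (1 + h x) * k x * indicator U x"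
        and "x \<in> U"
      have "inverse (1 + m x) \<le> inverse (1 + h x)"
      proof (rule ccontr)
        assume "\<not> ?thesis"
        then have "inverse (1 + h x) * k x < inverse (1 + m x) * k x"
          using k(2)[of x] by (simp add: ennreal_mult_strict_right_mono not_le less_top)
        then show False using * \<open>x \<in> U\<close> by simp
      qed
      then have "h x \<le> m x" by (simp add: inverse_one_add_le_iff)
      then show "h x \<le> g' x" by (simp add: m_def)
    qed
  qed
  then show ?thesis
    using h unfolding minimal_wug_def \<G>_def by blast
qed

end

section \<open>First variation of the energy\<close>

text \<open>Convexity, with the tangent taken at \<open>y\<close>. Used with the perturbed gradient
  as \<open>y\<close>, it bounds the gain in energy from above by a term linear in the
  perturbation.\<close>

lemma powr_tangent_le:
  fixes x y p :: real
  assumes "1 < p" "0 \<le> x" "0 \<le> y"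
  shows "y powr p - x powr p \<le> p * (y powr (p - 1) * (y - x))"
proof -
  define q where "q = p / (p - 1)"
  have q: "1 < q" "1 / p + 1 / q = 1" "(p - 1) * q = p"
    using assms(1) by (auto simp: q_def field_simps)
  have "x * y powr (p - 1) \<le> x powr p / p + (y powr (p - 1)) powr q / q"
    using q assms by (intro Youngs_inequality) auto
  also have "(y powr (p - 1)) powr q = y powr p"
    using q(3) by (simp add: powr_powr)
  finally have "p * (x * y powr (p - 1)) \<le> p * (x powr p / p + y powr p / q)"
    using assms(1) by (intro mult_left_mono) auto
  also have "\<dots> = x powr p + (p - 1) * y powr p"
    using assms(1) by (simp add: q_def field_simps)
  finally have *: "p * (x * y powr (p - 1)) \<le> x powr p + (p - 1) * y powr p" .
  have "y powr (p - 1) * y = y powr p"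
    using assms by (cases "y = 0") (auto simp: powr_diff)
  with * show ?thesis by (simp add: algebra_simps)
qed

text \<open>A one-sided derivative at \<open>e = 0\<close>. All competitors lie between 0 and
  \<open>g + k\<close>, so \<open>(g + k) powr p\<close> dominates both their energies and the
  tangent terms.\<close>

lemma nn_integral_first_variation:
  fixes g k :: "'a \<Rightarrow> real"
  assumes "1 < p" and [measurable]: "g \<in> borel_measurable N" "k \<in> borel_measurable N" "A \<in> sets N"
    and nonneg: "\<And>x. 0 \<le> g x" "\<And>x. 0 \<le> k x"
    and fin: "(\<integral>\<^sup>+x. ennreal ((g x + k x) powr p) \<partial>N) < \<infinity>"
    and min: "\<And>e. 0 < e \<Longrightarrow> e < 1 \<Longrightarrow> (\<integral>\<^sup>+x. ennreal (g x powr p) \<partial>N)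
        \<le> (\<integral>\<^sup>+x. ennreal (((1 - e * indicator A x) * g x + e * k x) powr p) \<partial>N)"
  shows "(\<integral>\<^sup>+x. ennreal (g x powr p * indicator A x) \<partial>N) \<le> (\<integral>\<^sup>+x. ennreal (g x powr (p - 1) * k x) \<partial>N)"
proof -
  define Y where "Y e x = (1 - e * indicator A x) * g x + e * k x" for e x
  have Y_meas[measurable]: "Y e \<in> borel_measurable N" for e
    unfolding Y_def by measurable
  have Y: "0 \<le> Y e x" "Y e x \<le> g x + k x" if "0 \<le> e" "e \<le> 1" for e x
  proof -
    have *: "0 \<le> e * g x" "e * g x \<le> g x" "0 \<le> e * k x" "e * k x \<le> k x"
      using that nonneg[of x] by (auto intro: mult_left_le_one_le)
    have "Y e x = g x - e * g x + e * k x \<or> Y e x = g x + e * k x"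
      by (cases "x \<in> A") (auto simp: Y_def algebra_simps)
    with * show "0 \<le> Y e x" "Y e x \<le> g x + k x" by linarith+
  qed
  have int: "integrable N (\<lambda>x. (g x + k x) powr p)"
    using fin by (intro integrableI_nonneg) auto
  have pw: "z powr (p - 1) * z = z powr p" if "0 \<le> z" for z :: real
    using that by (cases "z = 0") (auto simp: powr_diff)
  have bound: "\<bar>y powr (p - 1) * (c - d)\<bar> \<le> (g x + k x) powr p"
    if "0 \<le> y" "y \<le> g x + k x" "0 \<le> c" "c \<le> k x" "0 \<le> d" "d \<le> g x" for y c d x
  proof -
    have "\<bar>y powr (p - 1) * (c - d)\<bar> \<le> (g x + k x) powr (p - 1) * (g x + k x)"
      unfolding abs_mult using that nonneg[of x] \<open>1 < p\<close>
      by (intro mult_mono) (auto intro!: powr_mono2)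
    then show ?thesis using pw[of "g x + k x"] nonneg[of x] by simp
  qed
  have bound_Y: "\<bar>Y e x powr (p - 1) * (k x - g x * indicator A x)\<bar> \<le> (g x + k x) powr p"
    if "0 \<le> e" "e \<le> 1" for e x
    using Y[OF that, of x] nonneg[of x] by (intro bound) (auto split: split_indicator)
  have int_Yp: "integrable N (\<lambda>x. Y e x powr p)" if "0 \<le> e" "e \<le> 1" for e
    using Y[OF that] \<open>1 < p\<close> by (intro Bochner_Integration.integrable_bound[OF int])
      (auto intro!: AE_I2 powr_mono2)
  have gY: "g x = Y 0 x" for x by (simp add: Y_def)
  have int_V: "integrable N (\<lambda>x. Y e x powr (p - 1) * (k x - g x * indicator A x))" if "0 \<le> e" "e \<le> 1" for e
    using bound_Y[OF that]
    by (intro Bochner_Integration.integrable_bound[OF int]) (auto intro!: AE_I2)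
  have pos: "0 \<le> (\<integral>x. Y e x powr (p - 1) * (k x - g x * indicator A x) \<partial>N)" if e: "0 < e" "e < 1" for e
  proof -
    have "(\<integral>x. Y 0 x powr p \<partial>N) \<le> (\<integral>x. Y e x powr p \<partial>N)"
    proof -
      have "ennreal (\<integral>x. Y 0 x powr p \<partial>N) \<le> ennreal (\<integral>x. Y e x powr p \<partial>N)"
        using min[OF e] e int_Yp[of 0] int_Yp[of e]
        unfolding Y_def[symmetric] gY[symmetric]
        by (simp add: nn_integral_eq_integral[symmetric] gY)
      then show ?thesis by (subst (asm) ennreal_le_iff) auto
    qed
    then have "0 \<le> (\<integral>x. Y e x powr p - Y 0 x powr p \<partial>N)"
      using int_Yp[of e] int_Yp[of 0] e by simp
    \<comment> \<open>The increment from \<open>g\<close> to \<open>Y e\<close> is exactly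
      \<open>e\<close> times \<open>k - g * indicator A\<close>, so \<open>p * e\<close> factors out
      and can be cancelled.\<close>
    also have "\<dots> \<le> (\<integral>x. (p * e) * (Y e x powr (p - 1) * (k x - g x * indicator A x)) \<partial>N)"
    proof (intro integral_mono)
      show "Y e x powr p - Y 0 x powr p \<le> (p * e) * (Y e x powr (p - 1) * (k x - g x * indicator A x))" for x
        using powr_tangent_le[OF \<open>1 < p\<close>, of "Y 0 x" "Y e x"] Y(1)[of 0 x] Y(1)[of e x] e
        by (simp add: Y_def algebra_simps)
    qed (use e int_Yp[of e] int_Yp[of 0] int_V[of e] in auto)
    also have "\<dots> = (p * e) * (\<integral>x. Y e x powr (p - 1) * (k x - g x * indicator A x) \<partial>N)"
      by simp
    finally show ?thesis
      using mult_le_cancel_left_pos[of "p * e" 0] e \<open>1 < p\<close> by simp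
  qed
  have i1: "integrable N (\<lambda>x. g x powr p * indicator A x)"
    using int_Yp[of 0] \<open>1 < p\<close> by (intro Bochner_Integration.integrable_bound[OF int_Yp[of 0]])
      (auto simp: gY split: split_indicator)
  have "integrable N (\<lambda>x. g x powr (p - 1) * (k x - g x * indicator A x) + g x powr p * indicator A x)"
    using int_V[of 0] i1 by (intro Bochner_Integration.integrable_add) (auto simp: gY)
  also have "(\<lambda>x. g x powr (p - 1) * (k x - g x * indicator A x) + g x powr p * indicator A x) =
      (\<lambda>x. g x powr (p - 1) * k x)"
    using pw[OF nonneg(1)] by (auto simp: fun_eq_iff algebra_simps)
  finally have i2: "integrable N (\<lambda>x. g x powr (p - 1) * k x)" .
  \<comment> \<open>The shift by 2 keeps \<open>\<epsilon> 0\<close> strictly below 1, as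
    \<open>min\<close> demands.\<close>
  define \<epsilon> where "\<epsilon> n = 1 / real (n + 2)" for n
  have \<epsilon>: "0 < \<epsilon> n" "\<epsilon> n < 1" for n by (auto simp: \<epsilon>_def field_simps)
  have \<epsilon>_lim: "\<epsilon> \<longlonglongrightarrow> 0"
    unfolding \<epsilon>_def by (rule LIMSEQ_ignore_initial_segment[OF lim_1_over_n])
  have "(\<lambda>n. \<integral>x. Y (\<epsilon> n) x powr (p - 1) * (k x - g x * indicator A x) \<partial>N)
      \<longlonglongrightarrow> (\<integral>x. Y 0 x powr (p - 1) * (k x - g x * indicator A x) \<partial>N)"
  proof (rule integral_dominated_convergence[where w = "\<lambda>x. (g x + k x) powr p"])
    show "AE x in N. (\<lambda>n. Y (\<epsilon> n) x powr (p - 1) * (k x - g x * indicator A x))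
         \<longlonglongrightarrow> Y 0 x powr (p - 1) * (k x - g x * indicator A x)"
    proof (intro AE_I2 tendsto_mult tendsto_const)
      fix x
      have "(\<lambda>n. Y (\<epsilon> n) x) \<longlonglongrightarrow> Y 0 x"
        unfolding Y_def by (intro tendsto_intros \<epsilon>_lim)
      moreover have "\<forall>\<^sub>F n in sequentially. 0 \<le> Y (\<epsilon> n) x"
        using Y(1) \<epsilon> by (intro always_eventually allI) (simp add: less_imp_le)
      ultimately show "(\<lambda>n. Y (\<epsilon> n) x powr (p - 1)) \<longlonglongrightarrow> Y 0 x powr (p - 1)"
        using \<open>1 < p\<close> by (intro tendsto_powr') auto
    qed
    show "AE x in N. norm (Y (\<epsilon> n) x powr (p - 1) * (k x - g x * indicator A x)) \<le> (g x + k x) powr p" for n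
      using bound_Y[of "\<epsilon> n"] \<epsilon>[of n] by (auto intro!: AE_I2 simp: less_imp_le)
  qed (use int in auto)
  then have "0 \<le> (\<integral>x. Y 0 x powr (p - 1) * (k x - g x * indicator A x) \<partial>N)"
    by (rule LIMSEQ_le_const) (use pos \<epsilon> in auto)
  also have "\<dots> = (\<integral>x. g x powr (p - 1) * k x - g x powr p * indicator A x \<partial>N)"
    using pw[OF nonneg(1)] by (intro Bochner_Integration.integral_cong) (auto simp: Y_def algebra_simps)
  also have "\<dots> = (\<integral>x. g x powr (p - 1) * k x \<partial>N) - (\<integral>x. g x powr p * indicator A x \<partial>N)"
    using i1 i2 by simp
  finally have le: "(\<integral>x. g x powr p * indicator A x \<partial>N) \<le> (\<integral>x. g x powr (p - 1) * k x \<partial>N)" by simp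
  show ?thesis
    using le i1 i2 nonneg by (simp add: nn_integral_eq_integral ennreal_leI)
qed

section \<open>The Green function near its singularity\<close>

context proper_metric_measure
begin

lemma nn_integral_epow_max_finite:
  assumes "g \<in> borel_measurable borel" "h \<in> borel_measurable borel"
    "(\<integral>\<^sup>+x. epow (g x) p \<partial>M) < \<infinity>" "(\<integral>\<^sup>+x. epow (h x) p \<partial>M) < \<infinity>"
  shows "(\<integral>\<^sup>+x. epow (max (g x) (h x)) p \<partial>M) < \<infinity>"
proof -
  note [measurable] = borel_measurable_M[OF assms(1)] borel_measurable_M[OF assms(2)]
  have "(\<integral>\<^sup>+x. epow (max (g x) (h x)) p \<partial>M) \<le> (\<integral>\<^sup>+x. epow (g x) p + epow (h x) p \<partial>M)"
    by (intro nn_integral_mono epow_max_le p_pos)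
  also have "\<dots> = (\<integral>\<^sup>+x. epow (g x) p \<partial>M) + (\<integral>\<^sup>+x. epow (h x) p \<partial>M)"
    by (intro nn_integral_add) auto
  also have "\<dots> < \<infinity>" using assms by simp
  finally show ?thesis .
qed

lemma nn_integral_epow_add_finite:
  assumes "g \<in> borel_measurable borel" "h \<in> borel_measurable borel"
    "(\<integral>\<^sup>+x. epow (g x) p \<partial>M) < \<infinity>" "(\<integral>\<^sup>+x. epow (h x) p \<partial>M) < \<infinity>"
  shows "(\<integral>\<^sup>+x. epow (g x + h x) p \<partial>M) < \<infinity>"
proof -
  note [measurable] = borel_measurable_M[OF assms(1)] borel_measurable_M[OF assms(2)]
  have "(\<integral>\<^sup>+x. epow (g x + h x) p \<partial>M) \<le> (\<integral>\<^sup>+x. ennreal (2 powr p) * (epow (g x) p + epow (h x) p) \<partial>M)"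
    by (intro nn_integral_mono epow_add_le p_pos)
  also have "\<dots> = ennreal (2 powr p) * ((\<integral>\<^sup>+x. epow (g x) p \<partial>M) + (\<integral>\<^sup>+x. epow (h x) p \<partial>M))"
    by (simp add: nn_integral_cmult nn_integral_add)
  also have "\<dots> < \<infinity>" using assms by (simp add: ennreal_mult_less_top)
  finally show ?thesis .
qed

lemma nn_integral_epow_cmult_finite:
  assumes "g \<in> borel_measurable borel" "(\<integral>\<^sup>+x. epow (g x) p \<partial>M) < \<infinity>" "0 \<le> c"
  shows "(\<integral>\<^sup>+x. epow (ennreal c * g x) p \<partial>M) < \<infinity>"
proof (cases "c = 0")
  case False
  then show ?thesis using assms borel_measurable_M[OF assms(1)]
    by (simp add: epow_mult nn_integral_cmult ennreal_mult_less_top)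
qed simp

lemma Lp_loc_of_Lp:
  assumes "(\<integral>\<^sup>+x. epow (g x) p \<partial>M) < \<infinity>" "open U"
  shows "Lp_loc M p U g"
  unfolding Lp_loc_def
proof
  fix x assume "x \<in> U"
  then obtain r where r: "0 < r" "ball x r \<subseteq> U" using \<open>open U\<close> by (meson openE)
  have "(\<integral>\<^sup>+ y \<in> ball x r. epow (g y) p \<partial>M) \<le> (\<integral>\<^sup>+x. epow (g x) p \<partial>M)"
    by (intro nn_integral_mono) (auto split: split_indicator)
  then show "\<exists>r>0. ball x r \<subseteq> U \<and> (\<integral>\<^sup>+ y \<in> ball x r. epow (g y) p \<partial>M) < \<infinity>"
    using r assms(1) le_less_trans by blast
qed

lemma Lp_loc_add:
  assumes "Lp_loc M p U g" "(\<integral>\<^sup>+x. epow (h x) p \<partial>M) < \<infinity>"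
    "g \<in> borel_measurable borel" "h \<in> borel_measurable borel"
  shows "Lp_loc M p U (\<lambda>x. g x + h x)"
  unfolding Lp_loc_def
proof
  fix x assume "x \<in> U"
  then obtain r where r: "0 < r" "ball x r \<subseteq> U" "(\<integral>\<^sup>+ y \<in> ball x r. epow (g y) p \<partial>M) < \<infinity>"
    using assms(1) unfolding Lp_loc_def by blast
  note [measurable] = assms(3,4)
  have [measurable]: "ball x r \<in> sets borel" by simp
  have "(\<integral>\<^sup>+ y. epow (g y * indicator (ball x r) y + h y) p \<partial>M) < \<infinity>"
    using r(3) assms(2) by (intro nn_integral_epow_add_finite) (auto simp: epow_mult_indicator)
  moreover have "(\<integral>\<^sup>+ y \<in> ball x r. epow (g y + h y) p \<partial>M) \<le> (\<integral>\<^sup>+ y. epow (g y * indicator (ball x r) y + h y) p \<partial>M)"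
    by (intro nn_integral_mono) (auto split: split_indicator)
  ultimately show "\<exists>r>0. ball x r \<subseteq> U \<and> (\<integral>\<^sup>+ y \<in> ball x r. epow (g y + h y) p \<partial>M) < \<infinity>"
    using r le_less_trans by blast
qed

lemma bounded_finite_measure:
  assumes "bounded B"
  shows "emeasure M B < \<infinity>"
proof (cases "B \<in> sets M")
  case True
  fix a :: 'a
  obtain R where "B \<subseteq> cball a R"
    using assms unfolding bounded_any_center[where a = a] by (auto simp: subset_iff)
  then have "B \<subseteq> ball a (R + 1)" by (auto simp: subset_iff)
  then have "emeasure M B \<le> emeasure M (ball a (R + 1))"
    by (intro emeasure_mono) (auto intro: borel_in_sets)
  then show ?thesis using finite_balls le_less_trans by blast
qed (simp add: emeasure_notin_sets)

text \<open>The maximum of the local gradients, each cut off outside its own set. The cutoff makes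
  \<open>G\<close> integrable over the whole space, so it may be added to other gradients
  freely.\<close>

lemma ex_weak_ug_Lp_finite_Union:
  assumes "finite D" "\<And>y. y \<in> D \<Longrightarrow> open (B y)"
    and "\<And>y. y \<in> D \<Longrightarrow> \<exists>g. weak_ug M p (B y) f g \<and> (\<integral>\<^sup>+x\<in>B y. epow (g x) p \<partial>M) < \<infinity>"
  shows "\<exists>G. weak_ug M p (\<Union>y\<in>D. B y) f G \<and> (\<integral>\<^sup>+x. epow (G x) p \<partial>M) < \<infinity>"
  using assms
proof (induction rule: finite_induct)
  case empty
  have "weak_ug M p {} f (\<lambda>_. 0)" by (rule weak_ug_mono[OF weak_ug_const]) auto
  then show ?case by (intro exI[of _ "\<lambda>_. 0"]) simp
next
  case (insert y D)
  then obtain G where G: "weak_ug M p (\<Union>y\<in>D. B y) f G" "(\<integral>\<^sup>+x. epow (G x) p \<partial>M) < \<infinity>" by auto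
  obtain g where g: "weak_ug M p (B y) f g" "(\<integral>\<^sup>+x\<in>B y. epow (g x) p \<partial>M) < \<infinity>"
    using insert.prems(2)[of y] by auto
  note [measurable] = weak_ug_borel[OF G(1)] weak_ug_borel[OF g(1)]
  have [measurable]: "B y \<in> sets borel" using insert.prems(1)[of y] by auto
  define h where "h x = max (G x) (g x * indicator (B y) x)" for x
  have [measurable]: "h \<in> borel_measurable borel" unfolding h_def by measurable
  have "weak_ug M p (B y \<union> (\<Union>y\<in>D. B y)) f h"
    using insert.prems(1) by (intro weak_ug_glue[OF g(1) G(1)]) (auto simp: h_def)
  moreover have "(\<integral>\<^sup>+x. epow (h x) p \<partial>M) < \<infinity>"
    unfolding h_def using G(2) g(2)
    by (intro nn_integral_epow_max_finite) (auto simp: epow_mult_indicator)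
  ultimately show ?case by auto
qed

end

section \<open>Truncation of the Green function at a level below its supremum\<close>

locale green_setup = proper_metric_measure M p for M :: "'a::metric_space measure" and p +
  fixes \<Omega> :: "'a set" and x0 :: 'a and u :: "'a \<Rightarrow> ereal" and g :: "'a \<Rightarrow> ennreal" and b :: real
  assumes p_gt_1: "1 < p"
    and open_\<Omega>: "open \<Omega>" and bounded_\<Omega>: "bounded \<Omega>" and x0_in: "x0 \<in> \<Omega>"
    and green: "green_fun M p \<Omega> x0 u"
    and minimal_g: "minimal_wug M p (\<Omega> - {x0}) (\<lambda>x. real_of_ereal (u x)) g"
    and b_pos: "0 < b" and b_less: "ereal b < u x0"
begin

definition "U = \<Omega> - {x0}"
definition "w x = real_of_ereal (u x)"
text \<open>The truncation \<open>min u b\<close>, extended by 0. The value at \<open>x0\<close> is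
  set by hand because \<open>real_of_ereal \<infinity> = 0\<close>, so \<open>w x0\<close> would be
  wrong for an infinite pole.\<close>

definition "wb x = (if x \<in> \<Omega> then if x = x0 then b else min (w x) b else 0)"
definition "A = {x\<in>U. w x < b}"

lemma singular: "singular_fun M p \<Omega> x0 u"
  using green by (simp add: green_fun_def)

lemma open_U: "open U"
  unfolding U_def using open_\<Omega> by (intro open_Diff) auto

lemma u_eq_w: "x \<in> U \<Longrightarrow> u x = ereal (w x)" and w_pos: "x \<in> U \<Longrightarrow> 0 < w x"
proof -
  assume x: "x \<in> U"
  then have "0 < u x" "u x \<noteq> \<infinity>"
    using singular unfolding singular_fun_def U_def by auto
  then show "u x = ereal (w x)" "0 < w x"
    unfolding w_def by (cases "u x"; simp)+
qed

lemma harmonic_w: "p_harmonic M p U w"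
  using singular unfolding singular_fun_def U_def w_def[abs_def] by simp

lemma continuous_w: "continuous_on U w"
  using harmonic_w by (simp add: p_harmonic_def)

lemma minimal_U: "minimal_wug M p U w g"
  using minimal_g unfolding U_def w_def[abs_def] .

lemma g_ug: "weak_ug M p U w g" and g_loc: "Lp_loc M p U g"
  using minimal_U by (auto simp: minimal_wug_def)

lemma g_borel [measurable]: "g \<in> borel_measurable borel" "g \<in> borel_measurable M"
  using weak_ug_borel[OF g_ug] borel_measurable_M by auto

lemma open_A: "open A"
  unfolding A_def by (rule borel_strict_sublevel[OF continuous_w open_U])

lemma sets_measurable [measurable]: "U \<in> sets borel" "U \<in> sets M" "A \<in> sets borel" "A \<in> sets M"
    "\<Omega> \<in> sets borel" "\<Omega> \<in> sets M"
  using open_U open_A open_\<Omega> borel_in_sets by auto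

text \<open>Lower semicontinuity of \<open>u\<close> at \<open>x0\<close>, applied to the level
  \<open>b < u x0\<close>. It makes the truncation constant around the pole.\<close>

lemma near_x0:
  obtains \<delta> where "0 < \<delta>" "ball x0 \<delta> \<subseteq> \<Omega>" "\<And>x. x \<in> ball x0 \<delta> \<Longrightarrow> x \<noteq> x0 \<Longrightarrow> b < w x"
proof -
  have "\<exists>e>0. \<forall>y\<in>\<Omega>. dist y x0 < e \<longrightarrow> ereal b < u y"
    using singular x0_in b_less unfolding singular_fun_def superharmonic_def by blast
  then obtain e where e: "0 < e" "\<And>y. y \<in> \<Omega> \<Longrightarrow> dist y x0 < e \<Longrightarrow> ereal b < u y" by blast
  obtain r where r: "0 < r" "ball x0 r \<subseteq> \<Omega>" using open_\<Omega> x0_in by (meson openE)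
  show ?thesis
  proof (rule that[of "min e r"])
    fix x assume x: "x \<in> ball x0 (min e r)" "x \<noteq> x0"
    then have "x \<in> \<Omega>" "dist x x0 < e" using r by (auto simp: dist_commute)
    then show "b < w x" using e(2)[of x] u_eq_w[of x] x(2) by (simp add: U_def)
  qed (use e r in auto)
qed

text \<open>The zero extension is locally Newtonian off \<open>x0\<close>, also across the boundary
  of \<open>\<Omega>\<close>. Finitely many of its local gradients cover the compact set
  \<open>K\<close>, and beyond \<open>closure \<Omega>\<close> the function is constant. This is
  what gives integrability up to the boundary.\<close>

lemma ex_ug_off_x0:
  assumes "0 < \<delta>"
  obtains G where "weak_ug M p (UNIV - cball x0 \<delta>) (\<lambda>x. if x \<in> \<Omega> then w x else 0) G"
    "(\<integral>\<^sup>+x. epow (G x) p \<partial>M) < \<infinity>"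
proof -
  let ?f = "\<lambda>x. if x \<in> \<Omega> then w x else 0"
  define K where "K = closure \<Omega> - ball x0 \<delta>"
  have "\<exists>R. closure \<Omega> \<subseteq> cball x0 R"
    using bounded_closure[OF bounded_\<Omega>] unfolding bounded_any_center[where a = x0] by (auto simp: subset_iff)
  then obtain R where "closure \<Omega> \<subseteq> cball x0 R" by blast
  then have "K = cball x0 R \<inter> (closure \<Omega> - ball x0 \<delta>)" unfolding K_def by blast
  then have cK: "compact K"
    using compact_Int_closed[OF compact_cball, of "closure \<Omega> - ball x0 \<delta>"] by (simp add: closed_Diff)
  have "newton_loc M p (UNIV - {x0}) ?f"
    using singular unfolding singular_fun_def w_def by simp
  moreover have "y \<noteq> x0" if "y \<in> K" for y using that assms unfolding K_def by auto
  ultimately have "\<forall>y\<in>K. \<exists>r>0. newton M p (ball y r) ?f"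
    unfolding newton_loc_def by blast
  then obtain r where r: "\<And>y. y \<in> K \<Longrightarrow> 0 < r y" "\<And>y. y \<in> K \<Longrightarrow> newton M p (ball y (r y)) ?f"
    by metis
  obtain D where D: "D \<subseteq> K" "finite D" "K \<subseteq> (\<Union>y\<in>D. ball y (r y))"
  proof (rule compactE_image[OF cK, of K "\<lambda>x. ball x (r x)"])
    show "K \<subseteq> (\<Union>x\<in>K. ball x (r x))" using r(1) by (auto intro!: UN_I)
  qed auto
  obtain G where G: "weak_ug M p (\<Union>y\<in>D. ball y (r y)) ?f G" "(\<integral>\<^sup>+x. epow (G x) p \<partial>M) < \<infinity>"
  proof -
    have "\<exists>G. weak_ug M p (\<Union>y\<in>D. ball y (r y)) ?f G \<and> (\<integral>\<^sup>+x. epow (G x) p \<partial>M) < \<infinity>"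
      using D(1,2) r(2) by (intro ex_weak_ug_Lp_finite_Union) (auto simp: newton_def)
    then show ?thesis using that by blast
  qed
  have 0: "weak_ug M p (- closure \<Omega>) ?f (\<lambda>_. 0)"
    by (rule weak_ug_mono[OF weak_ug_const[of UNIV 0]]) (use closure_subset[of \<Omega>] in auto)
  have un: "weak_ug M p ((\<Union>y\<in>D. ball y (r y)) \<union> - closure \<Omega>) ?f G"
    using weak_ug_borel[OF G(1)] by (intro weak_ug_glue[OF G(1) 0]) auto
  have "weak_ug M p (UNIV - cball x0 \<delta>) ?f G"
  proof (rule weak_ug_mono[OF un])
    show "UNIV - cball x0 \<delta> \<subseteq> (\<Union>y\<in>D. ball y (r y)) \<union> - closure \<Omega>"
      using D(3) unfolding K_def by (auto simp: subset_iff)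
  qed (use weak_ug_borel[OF G(1)] in auto)
  then show ?thesis using that G(2) by blast
qed

text \<open>Minimality compares \<open>g\<close> with a gradient \<open>h\<close> that equals
  \<open>G\<close> outside \<open>ball x0 \<delta>\<close>. The radii \<open>\<delta>/2\<close> and
  \<open>\<delta>\<close> make the two glued pieces open and overlapping.\<close>

lemma g_Lp_off_x0:
  assumes "0 < \<delta>"
  shows "(\<integral>\<^sup>+x\<in>U - ball x0 \<delta>. epow (g x) p \<partial>M) < \<infinity>"
proof -
  obtain G where G: "weak_ug M p (UNIV - cball x0 (\<delta>/2)) (\<lambda>x. if x \<in> \<Omega> then w x else 0) G"
    "(\<integral>\<^sup>+x. epow (G x) p \<partial>M) < \<infinity>"
    using ex_ug_off_x0[of "\<delta>/2"] assms by auto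
  note [measurable] = weak_ug_borel[OF G(1)]
  have [measurable]: "ball x0 \<delta> \<in> sets borel" by simp
  define h where "h x = G x + g x * indicator (ball x0 \<delta>) x" for x
  have h[measurable]: "h \<in> borel_measurable borel" unfolding h_def by measurable
  have 1: "weak_ug M p (U - cball x0 (\<delta>/2)) w h"
    by (rule weak_ug_mono[OF G(1)]) (auto simp: h_def U_def)
  have 2: "weak_ug M p (U \<inter> ball x0 \<delta>) w h"
    by (rule weak_ug_mono[OF g_ug]) (auto simp: h_def)
  have "weak_ug M p ((U - cball x0 (\<delta>/2)) \<union> (U \<inter> ball x0 \<delta>)) w h"
    using open_U by (intro weak_ug_glue[OF 1 2]) auto
  moreover have "(U - cball x0 (\<delta>/2)) \<union> (U \<inter> ball x0 \<delta>) = U" using assms by auto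
  ultimately have "weak_ug M p U w h" by simp
  moreover have "Lp_loc M p U h"
  proof (rule Lp_loc_mono[of U "\<lambda>x. g x + G x"])
    show "Lp_loc M p U (\<lambda>x. g x + G x)" using g_loc G(2) by (intro Lp_loc_add) auto
    show "h x \<le> g x + G x" for x by (auto simp: h_def add.commute split: split_indicator)
  qed
  ultimately have AE: "AE x in M. x \<in> U \<longrightarrow> g x \<le> h x"
    using minimal_U unfolding minimal_wug_def by blast
  have "(\<integral>\<^sup>+x\<in>U - ball x0 \<delta>. epow (g x) p \<partial>M) \<le> (\<integral>\<^sup>+x. epow (G x) p \<partial>M)"
  proof (rule nn_integral_mono_AE, use AE in eventually_elim)
    fix x assume *: "x \<in> U \<longrightarrow> g x \<le> h x"
    show "epow (g x) p * indicator (U - ball x0 \<delta>) x \<le> epow (G x) p"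
    proof (cases "x \<in> U - ball x0 \<delta>")
      case True
      then have "g x \<le> G x" using * by (auto simp: h_def)
      then show ?thesis using True by (simp add: epow_mono p_pos)
    qed simp
  qed
  then show ?thesis using G(2) le_less_trans by blast
qed

text \<open>Away from \<open>x0\<close> truncation does not increase increments, so the gradient of
  the zero extension serves; near \<open>x0\<close> the truncation is constant.\<close>

lemma ex_ug_wb:
  obtains G where "weak_ug M p UNIV wb G" "(\<integral>\<^sup>+x. epow (G x) p \<partial>M) < \<infinity>"
proof -
  obtain \<delta> where \<delta>: "0 < \<delta>" "ball x0 \<delta> \<subseteq> \<Omega>" "\<And>x. x \<in> ball x0 \<delta> \<Longrightarrow> x \<noteq> x0 \<Longrightarrow> b < w x"
    using near_x0 by blast
  obtain G where G: "weak_ug M p (UNIV - cball x0 (\<delta>/2)) (\<lambda>x. if x \<in> \<Omega> then w x else 0) G"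
    "(\<integral>\<^sup>+x. epow (G x) p \<partial>M) < \<infinity>"
    using ex_ug_off_x0[of "\<delta>/2"] \<delta>(1) by auto
  note [measurable] = weak_ug_borel[OF G(1)]
  have 1: "weak_ug M p (UNIV - cball x0 (\<delta>/2)) wb G"
  proof (rule weak_ug_mono[OF G(1)])
    fix x y assume "x \<in> UNIV - cball x0 (\<delta>/2)" "y \<in> UNIV - cball x0 (\<delta>/2)"
    then have "x \<noteq> x0" "y \<noteq> x0" using \<delta>(1) by auto
    then show "\<bar>wb x - wb y\<bar> \<le> \<bar>(if x \<in> \<Omega> then w x else 0) - (if y \<in> \<Omega> then w y else 0)\<bar>"
      using b_pos w_pos[of x] w_pos[of y] by (auto simp: wb_def U_def min_def)
  qed auto
  have 2: "weak_ug M p (ball x0 \<delta>) wb (\<lambda>_. 0)"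
  proof (rule weak_ug_mono[OF weak_ug_const[of UNIV 0]])
    fix x y assume "x \<in> ball x0 \<delta>" "y \<in> ball x0 \<delta>"
    moreover have "wb z = b" if "z \<in> ball x0 \<delta>" for z
      using \<delta>(2) \<delta>(3)[OF that] that x0_in by (auto simp: wb_def)
    ultimately show "\<bar>wb x - wb y\<bar> \<le> \<bar>0 - 0\<bar>" by simp
  qed auto
  have "weak_ug M p ((UNIV - cball x0 (\<delta>/2)) \<union> ball x0 \<delta>) wb G"
    by (intro weak_ug_glue[OF 1 2]) auto
  moreover have "(UNIV - cball x0 (\<delta>/2)) \<union> ball x0 \<delta> = UNIV" using \<delta>(1) by auto
  ultimately show ?thesis using that G(2) by auto
qed

lemma wb_bounds: "0 \<le> wb x" "wb x \<le> b"
  using b_pos w_pos[of x] by (auto simp: wb_def U_def)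

lemma wb_borel [measurable]: "wb \<in> borel_measurable borel"
proof -
  have "(\<lambda>x. indicator U x *\<^sub>R min (w x) b) \<in> borel_measurable borel"
    using open_U by (intro borel_measurable_continuous_on_indicator continuous_intros continuous_w) auto
  then have "(\<lambda>x. indicator U x *\<^sub>R min (w x) b + b * indicator {x0} x) \<in> borel_measurable borel"
    by measurable
  also have "(\<lambda>x. indicator U x *\<^sub>R min (w x) b + b * indicator {x0} x) = wb"
    using x0_in by (auto simp: wb_def U_def fun_eq_iff split: split_indicator)
  finally show ?thesis .
qed

lemma newton_bounded_support:
  assumes [measurable]: "f \<in> borel_measurable borel" and "\<And>x. \<bar>f x\<bar> \<le> c" "\<And>x. x \<notin> \<Omega> \<Longrightarrow> f x = 0"
    and "weak_ug M p UNIV f G" "(\<integral>\<^sup>+x. epow (G x) p \<partial>M) < \<infinity>"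
  shows "newton M p UNIV f"
  unfolding newton_def
proof (intro conjI exI)
  show "(\<lambda>x. indicator UNIV x * f x) \<in> borel_measurable M"
    by (intro borel_measurable_M) measurable
  have "0 \<le> c" using assms(2)[of x0] by linarith
  have "(\<integral>\<^sup>+ x \<in> UNIV. ennreal (\<bar>f x\<bar> powr p) \<partial>M) \<le> (\<integral>\<^sup>+ x. ennreal (c powr p) * indicator \<Omega> x \<partial>M)"
    using assms(2,3) p_pos by (intro nn_integral_mono) (auto intro!: ennreal_leI powr_mono2 split: split_indicator)
  also have "\<dots> = ennreal (c powr p) * emeasure M \<Omega>"
    by (intro nn_integral_cmult_indicator) auto
  also have "\<dots> < \<infinity>" using bounded_finite_measure[OF bounded_\<Omega>] by (simp add: ennreal_mult_less_top)
  finally show "(\<integral>\<^sup>+ x \<in> UNIV. ennreal (\<bar>f x\<bar> powr p) \<partial>M) < \<infinity>" .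
qed (use assms in auto)

lemma A_off_x0: obtains \<delta> where "0 < \<delta>" "A \<subseteq> U - ball x0 \<delta>" "ball x0 \<delta> \<subseteq> \<Omega>" "\<And>x. x \<in> ball x0 \<delta> \<Longrightarrow> wb x = b"
proof (rule near_x0)
  fix \<delta> assume \<delta>: "0 < \<delta>" "ball x0 \<delta> \<subseteq> \<Omega>" "\<And>x. x \<in> ball x0 \<delta> \<Longrightarrow> x \<noteq> x0 \<Longrightarrow> b < w x"
  show thesis
  proof (rule that[OF \<delta>(1) _ \<delta>(2)])
    show "A \<subseteq> U - ball x0 \<delta>" using \<delta>(3) unfolding A_def U_def by force
    show "wb x = b" if "x \<in> ball x0 \<delta>" for x
      using \<delta>(2) \<delta>(3)[OF that] that x0_in by (auto simp: wb_def)
  qed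
qed

lemma g_Lp_A: "(\<integral>\<^sup>+x\<in>A. epow (g x) p \<partial>M) < \<infinity>"
proof (rule A_off_x0)
  fix \<delta> assume \<delta>: "0 < \<delta>" "A \<subseteq> U - ball x0 \<delta>"
  have "(\<integral>\<^sup>+x\<in>A. epow (g x) p \<partial>M) \<le> (\<integral>\<^sup>+x\<in>U - ball x0 \<delta>. epow (g x) p \<partial>M)"
    using \<delta>(2) by (intro nn_integral_mono) (auto split: split_indicator)
  then show ?thesis using g_Lp_off_x0[OF \<delta>(1)] le_less_trans by blast
qed

text \<open>Testing the capacity with \<open>min u b / b\<close> gives \<open>b powr (1 - p)\<close>
  at most \<open>b powr (- p)\<close> times the energy on \<open>A\<close>. The difficulty is that
  the capacity uses the minimal gradient \<open>gv\<close> in the whole space, whereas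
  \<open>g\<close> is a gradient only inside \<open>\<Omega> - {x0}\<close>; the two are compared
  almost everywhere in \<open>\<Omega>\<close>.\<close>

lemma energy_A_ge: "ennreal b \<le> (\<integral>\<^sup>+x\<in>A. epow (g x) p \<partial>M)"
proof -
  obtain \<delta> where \<delta>: "0 < \<delta>" "A \<subseteq> U - ball x0 \<delta>" "ball x0 \<delta> \<subseteq> \<Omega>" "\<And>x. x \<in> ball x0 \<delta> \<Longrightarrow> wb x = b"
    using A_off_x0 by blast
  obtain G where G: "weak_ug M p UNIV wb G" "(\<integral>\<^sup>+x. epow (G x) p \<partial>M) < \<infinity>" by (rule ex_ug_wb)
  note [measurable] = weak_ug_borel[OF G(1)]
  define v where "v x = 1 / b * wb x" for x
  have cap: "cond_cap M p {x\<in>\<Omega>. ereal b \<le> u x} \<Omega> = ennreal (b powr (1 - p))"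
    using green b_pos b_less unfolding green_fun_def by blast
  have ug_v: "weak_ug M p UNIV v (\<lambda>x. ennreal (1 / b) * h x)" if "weak_ug M p UNIV wb h" for h
    using weak_ug_cmult[OF that, of "1 / b"] b_pos by (simp add: v_def[abs_def])
  have loc: "Lp_loc M p UNIV (\<lambda>x. ennreal (1 / b) * h x)"
    if "h \<in> borel_measurable borel" "(\<integral>\<^sup>+x. epow (h x) p \<partial>M) < \<infinity>" for h
    using that b_pos by (intro Lp_loc_of_Lp nn_integral_epow_cmult_finite) auto
  obtain gv where gv: "minimal_wug M p UNIV v gv"
    using ex_minimal_wug[OF open_UNIV ug_v[OF G(1)] loc] G(2) by auto
  have "newton M p UNIV v"
  proof (rule newton_bounded_support[OF _ _ _ ug_v[OF G(1)]])
    show "v \<in> borel_measurable borel" unfolding v_def by measurable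
    show "\<bar>v x\<bar> \<le> 1" for x using wb_bounds[of x] b_pos by (simp add: v_def field_simps)
    show "v x = 0" if "x \<notin> \<Omega>" for x using that by (simp add: v_def wb_def)
    show "(\<integral>\<^sup>+x. epow (ennreal (1 / b) * G x) p \<partial>M) < \<infinity>"
      using G(2) b_pos by (intro nn_integral_epow_cmult_finite) auto
  qed
  moreover have "1 \<le> v x" if "x \<in> {x\<in>\<Omega>. ereal b \<le> u x}" for x
    using that u_eq_w[of x] b_pos by (auto simp: v_def wb_def U_def)
  ultimately have "cond_cap M p {x\<in>\<Omega>. ereal b \<le> u x} \<Omega> \<le> (\<integral>\<^sup>+ x \<in> \<Omega>. epow (snd (v, gv) x) p \<partial>M)"
    unfolding cond_cap_def using gv by (intro INF_lower) (auto simp: v_def wb_def)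
  then have cap_le: "ennreal (b powr (1 - p)) \<le> (\<integral>\<^sup>+ x \<in> \<Omega>. epow (gv x) p \<partial>M)"
    using cap by simp
  \<comment> \<open>Shrinking open neighbourhoods of the complement of \<open>\<Omega>\<close>. The
    gradient \<open>G\<close> is needed only there to get across the boundary, and each point of
    \<open>\<Omega>\<close> lies outside \<open>W n\<close> for some \<open>n\<close>, which leaves
    \<open>g * indicator A\<close> as the bound.\<close>
  define W where "W n = (\<Union>y\<in>-\<Omega>. ball y (1 / real (Suc n)))" for n
  have W: "open (W n)" for n by (auto simp: W_def)
  then have [measurable]: "W n \<in> sets borel" for n by simp
  define h where "h n x = max (g x * indicator A x) (G x * indicator (W n) x)" for n x
  have [measurable]: "h n \<in> borel_measurable borel" for n unfolding h_def by measurable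
  have "AE x in M. gv x \<le> ennreal (1 / b) * h n x" for n
  proof -
    have 1: "weak_ug M p U wb (\<lambda>x. g x * indicator A x)"
      by (rule weak_ug_mono[OF weak_ug_min_const[OF g_ug continuous_w open_U, of b, folded A_def]])
        (auto simp: wb_def U_def)
    have 2: "weak_ug M p (ball x0 \<delta>) wb (\<lambda>_. 0)"
      by (rule weak_ug_mono[OF weak_ug_const[of UNIV 0]]) (use \<delta>(4) in auto)
    have "weak_ug M p (U \<union> ball x0 \<delta>) wb (\<lambda>x. g x * indicator A x)"
      using open_U by (intro weak_ug_glue[OF 1 2]) auto
    also have "U \<union> ball x0 \<delta> = \<Omega>" using \<delta>(1,3) x0_in by (auto simp: U_def)
    finally have 3: "weak_ug M p \<Omega> wb (\<lambda>x. g x * indicator A x)" .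
    have 4: "weak_ug M p (W n) wb (\<lambda>x. G x * indicator (W n) x)"
      by (rule weak_ug_mono[OF G(1)]) auto
    have "weak_ug M p (\<Omega> \<union> W n) wb (h n)"
      using open_\<Omega> W by (intro weak_ug_glue[OF 3 4]) (auto simp: h_def)
    also have "\<Omega> \<union> W n = UNIV" by (force simp: W_def)
    finally have "weak_ug M p UNIV wb (h n)" .
    moreover have "(\<integral>\<^sup>+x. epow (h n x) p \<partial>M) < \<infinity>"
    proof -
      have "(\<integral>\<^sup>+x. epow (G x * indicator (W n) x) p \<partial>M) \<le> (\<integral>\<^sup>+x. epow (G x) p \<partial>M)"
        by (intro nn_integral_mono epow_mono p_pos) (auto split: split_indicator)
      then have "(\<integral>\<^sup>+x. epow (G x * indicator (W n) x) p \<partial>M) < \<infinity>" using G(2) by (rule le_less_trans)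
      then show ?thesis unfolding h_def using g_Lp_A
        by (intro nn_integral_epow_max_finite) (auto simp: epow_mult_indicator)
    qed
    ultimately have "weak_ug M p UNIV v (\<lambda>x. ennreal (1 / b) * h n x)" "Lp_loc M p UNIV (\<lambda>x. ennreal (1 / b) * h n x)"
      using ug_v loc by auto
    then show ?thesis using gv unfolding minimal_wug_def by auto
  qed
  then have "AE x in M. \<forall>n. gv x \<le> ennreal (1 / b) * h n x" by (simp add: AE_all_countable)
  then have AE: "AE x in M. x \<in> \<Omega> \<longrightarrow> gv x \<le> ennreal (1 / b) * (g x * indicator A x)"
  proof (rule eventually_mono, intro impI)
    fix x assume *: "\<forall>n. gv x \<le> ennreal (1 / b) * h n x" and "x \<in> \<Omega>"
    then obtain e where e: "0 < e" "ball x e \<subseteq> \<Omega>" using open_\<Omega> by (meson openE)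
    obtain n where "1 / real (Suc n) < e" using nat_approx_posE[OF e(1)] by auto
    then have "x \<notin> W n" using e(2) by (force simp: W_def dist_commute subset_iff)
    then show "gv x \<le> ennreal (1 / b) * (g x * indicator A x)"
      using *[rule_format, of n] by (simp add: h_def)
  qed
  have "(\<integral>\<^sup>+ x \<in> \<Omega>. epow (gv x) p \<partial>M) \<le> (\<integral>\<^sup>+ x. ennreal ((1 / b) powr p) * (epow (g x) p * indicator A x) \<partial>M)"
  proof (rule nn_integral_mono_AE, use AE in eventually_elim)
    fix x assume *: "x \<in> \<Omega> \<longrightarrow> gv x \<le> ennreal (1 / b) * (g x * indicator A x)"
    show "epow (gv x) p * indicator \<Omega> x \<le> ennreal ((1 / b) powr p) * (epow (g x) p * indicator A x)"
    proof (cases "x \<in> \<Omega>")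
      case True
      then have "epow (gv x) p \<le> epow (ennreal (1 / b) * (g x * indicator A x)) p"
        using * by (intro epow_mono p_pos) auto
      then show ?thesis using True b_pos by (simp add: epow_mult epow_mult_indicator)
    qed simp
  qed
  also have "\<dots> = ennreal ((1 / b) powr p) * (\<integral>\<^sup>+x\<in>A. epow (g x) p \<partial>M)"
    by (intro nn_integral_cmult) auto
  finally have "ennreal (b powr (1 - p)) \<le> ennreal ((1 / b) powr p) * (\<integral>\<^sup>+x\<in>A. epow (g x) p \<partial>M)"
    using cap_le by (rule order_trans[rotated])
  then have "ennreal (b powr p) * ennreal (b powr (1 - p)) \<le>
      ennreal (b powr p) * (ennreal ((1 / b) powr p) * (\<integral>\<^sup>+x\<in>A. epow (g x) p \<partial>M))"
    by (intro mult_left_mono) auto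
  also have "\<dots> = ennreal (b powr p * (1 / b) powr p) * (\<integral>\<^sup>+x\<in>A. epow (g x) p \<partial>M)"
    by (simp add: ennreal_mult mult.assoc)
  also have "b powr p * (1 / b) powr p = 1" using b_pos by (simp flip: powr_mult)
  also have "ennreal (b powr p) * ennreal (b powr (1 - p)) = ennreal b"
    using b_pos by (simp flip: ennreal_mult powr_add)
  finally show ?thesis by simp
qed

end

section \<open>Flux of the Green function through cutoff functions\<close>

context green_setup
begin

text \<open>Minimality compares energies only where the test function differs from 0, which is
  \<open>S\<close> for every \<open>e\<close>. Hence the energy on the left is that of
  \<open>A \<inter> S\<close>, while \<open>\<kappa>\<close> and \<open>B\<close> record the size
  and the support of the gradient of \<open>\<eta>\<close>.\<close>

lemma flux_through_cutoff:
  fixes \<eta> :: "'a \<Rightarrow> real"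
  assumes \<eta>_meas: "\<eta> \<in> borel_measurable borel" and \<eta>: "\<And>x. 0 \<le> \<eta> x" "\<And>x. \<eta> x \<le> 1" "\<And>x. x \<notin> \<Omega> \<Longrightarrow> \<eta> x = 0"
    and "0 < r'" "\<And>x. x \<in> ball x0 r' \<Longrightarrow> \<eta> x = 1"
    and B[measurable]: "B \<in> sets borel" "bounded B" and "0 \<le> \<kappa>"
    and ug_\<eta>: "weak_ug M p UNIV \<eta> (\<lambda>x. ennreal \<kappa> * indicator B x)"
  defines "S \<equiv> {x\<in>U. b * \<eta> x \<noteq> wb x}"
  shows "(\<integral>\<^sup>+x\<in>A \<inter> S. epow (g x) p \<partial>M) \<le> ennreal (b * \<kappa>) * (\<integral>\<^sup>+x\<in>B \<inter> U. epow (g x) (p - 1) \<partial>M)"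
proof -
  note [measurable] = \<eta>_meas borel_measurable_M[OF \<eta>_meas] borel_measurable_M[OF wb_borel] borel_in_sets[OF B(1)]
  have [measurable]: "S \<in> sets M" unfolding S_def
  proof -
    have "{x\<in>U. b * \<eta> x \<noteq> wb x} = U \<inter> {x \<in> space M. b * \<eta> x \<noteq> wb x}" by (auto simp: space_UNIV)
    also have "\<dots> \<in> sets M" by measurable
    finally show "{x\<in>U. b * \<eta> x \<noteq> wb x} \<in> sets M" .
  qed
  have B_fin: "(\<integral>\<^sup>+x. epow (ennreal c * indicator B x) p \<partial>M) < \<infinity>" if "0 \<le> c" for c
  proof -
    have "(\<integral>\<^sup>+x. epow (ennreal c * indicator B x) p \<partial>M) = ennreal (c powr p) * emeasure M B"
      using that by (simp add: epow_mult_indicator epow_ennreal nn_integral_cmult_indicator)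
    then show ?thesis using bounded_finite_measure[OF B(2)] by (simp add: ennreal_mult_less_top)
  qed
  define k where "k x = b * \<kappa> * indicator B x" for x
  have k_nonneg: "0 \<le> k x" for x using b_pos \<open>0 \<le> \<kappa>\<close> by (auto simp: k_def)
  have [measurable]: "k \<in> borel_measurable borel" "k \<in> borel_measurable M" unfolding k_def by measurable
  have k_eq: "ennreal (k x) = ennreal (b * \<kappa>) * indicator B x" for x
    by (simp add: k_def split: split_indicator)
  obtain \<delta> where \<delta>: "0 < \<delta>" "A \<subseteq> U - ball x0 \<delta>" "\<And>x. x \<in> ball x0 \<delta> \<Longrightarrow> wb x = b"
    using A_off_x0 by metis
  \<comment> \<open>Near \<open>x0\<close> both \<open>b * \<eta>\<close> and \<open>wb\<close>
    equal \<open>b\<close>, so \<open>S\<close> keeps away from the pole and \<open>g\<close> has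
    finite energy on it.\<close>
  have S_off: "S \<subseteq> U - ball x0 (min \<delta> r')"
    using \<delta>(3) assms(6) by (auto simp: S_def)
  have g_S: "(\<integral>\<^sup>+x\<in>S. epow (g x) p \<partial>M) < \<infinity>"
  proof -
    have "(\<integral>\<^sup>+x\<in>S. epow (g x) p \<partial>M) \<le> (\<integral>\<^sup>+x\<in>U - ball x0 (min \<delta> r'). epow (g x) p \<partial>M)"
      using S_off by (intro nn_integral_mono) (auto split: split_indicator)
    then show ?thesis using g_Lp_off_x0[of "min \<delta> r'"] \<delta>(1) \<open>0 < r'\<close> le_less_trans by auto
  qed
  obtain G where G: "weak_ug M p UNIV wb G" "(\<integral>\<^sup>+x. epow (G x) p \<partial>M) < \<infinity>" by (rule ex_ug_wb)
  note [measurable] = weak_ug_borel[OF G(1)]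
  have minimal_energy: "(\<integral>\<^sup>+x\<in>S. epow (g x) p \<partial>M)
      \<le> (\<integral>\<^sup>+x\<in>S. epow (ennreal (1 - e * indicator A x) * g x + ennreal (e * k x)) p \<partial>M)"
    if e: "0 < e" "e < 1" for e
  proof -
    define \<phi> where "\<phi> x = e * b * \<eta> x + (- e) * wb x" for x
    define H where "H x = ennreal (1 - e * indicator A x) * g x + ennreal (e * k x)" for x
    have [measurable]: "H \<in> borel_measurable borel" unfolding H_def by measurable
    have "newton0 M p U \<phi>"
      unfolding newton0_def
    proof (intro exI conjI allI ballI impI)
      have "weak_ug M p UNIV \<phi> (\<lambda>x. ennreal \<bar>e * b\<bar> * (ennreal \<kappa> * indicator B x) + ennreal \<bar>- e\<bar> * G x)"
        unfolding \<phi>_def by (intro weak_ug_add weak_ug_cmult ug_\<eta> G(1))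
      moreover have "(\<integral>\<^sup>+x. epow (ennreal \<bar>e * b\<bar> * (ennreal \<kappa> * indicator B x) + ennreal \<bar>- e\<bar> * G x) p \<partial>M) < \<infinity>"
        using \<open>0 \<le> \<kappa>\<close> by (intro nn_integral_epow_add_finite nn_integral_epow_cmult_finite B_fin G(2)) auto
      moreover have "\<bar>\<phi> x\<bar> \<le> e * b" for x
      proof -
        have "\<phi> x = e * (b * \<eta> x - wb x)" by (simp add: \<phi>_def algebra_simps)
        moreover have "0 \<le> b * \<eta> x" "b * \<eta> x \<le> b"
          using \<eta>(1,2)[of x] b_pos by (auto intro: mult_left_le)
        then have "\<bar>b * \<eta> x - wb x\<bar> \<le> b"
          using wb_bounds[of x] by linarith
        ultimately show ?thesis using e by (simp add: abs_mult)
      qed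
      moreover have "\<phi> x = 0" if "x \<notin> \<Omega>" for x using \<eta>(3)[OF that] that by (simp add: \<phi>_def wb_def)
      moreover have "\<phi> \<in> borel_measurable borel" unfolding \<phi>_def by measurable
      ultimately show "newton M p UNIV \<phi>" by (intro newton_bounded_support)
      show "\<phi> x = 0" if "x \<notin> U" for x
      proof (cases "x = x0")
        case True
        then show ?thesis using assms(6)[of x0] \<open>0 < r'\<close> x0_in by (simp add: \<phi>_def wb_def)
      next
        case False
        then show ?thesis using that \<open>\<And>x. x \<notin> \<Omega> \<Longrightarrow> \<phi> x = 0\<close> by (auto simp: U_def)
      qed
    qed simp
    have ugH: "weak_ug M p U (\<lambda>x. w x + \<phi> x) H"
    proof -
      note mn = weak_ug_min_const[OF g_ug continuous_w open_U, of b]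
      note mx = weak_ug_max_const[OF g_ug continuous_w open_U, of b]
      have \<eta>_U: "weak_ug M p U \<eta> (\<lambda>x. ennreal \<kappa> * indicator B x)"
        by (rule weak_ug_mono[OF ug_\<eta>]) auto
      note sum = weak_ug_add[OF weak_ug_add[OF weak_ug_cmult[OF mn, of "1 - e"] mx] weak_ug_cmult[OF \<eta>_U, of "e * b"]]
      show ?thesis
      proof (rule weak_ug_mono[OF sum])
        fix x assume x: "x \<in> U"
        have 1: "ennreal \<bar>e * b\<bar> * (ennreal \<kappa> * indicator B x) = ennreal (e * k x)"
          using e b_pos \<open>0 \<le> \<kappa>\<close> by (simp add: k_def mult.assoc flip: ennreal_mult split: split_indicator)
        \<comment> \<open>The gradients of \<open>min w b\<close> and \<open>max w b\<close> live on
          disjoint sets, so \<open>g\<close> is never counted twice; it is scaled by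
          \<open>1 - e\<close> exactly on \<open>A\<close>.\<close>
        have 2: "ennreal \<bar>1 - e\<bar> * (g x * indicator {x \<in> U. w x < b} x) + g x * indicator {x \<in> U. b < w x} x
          \<le> ennreal (1 - e * indicator A x) * g x"
          using e x by (auto simp: A_def split: split_indicator)
        show "ennreal \<bar>1 - e\<bar> * (g x * indicator {x \<in> U. w x < b} x) + g x * indicator {x \<in> U. b < w x} x +
           ennreal \<bar>e * b\<bar> * (ennreal \<kappa> * indicator B x) \<le> H x"
          unfolding H_def 1 by (intro add_right_mono 2)
      next
        fix x y assume xy: "x \<in> U" "y \<in> U"
        \<comment> \<open>From \<open>w = min w b + max w b - b\<close>: subtracting
          \<open>e * wb\<close> acts on the minimum alone.\<close>
        have eq: "w z + \<phi> z = (1 - e) * min (w z) b + max (w z) b + e * b * \<eta> z - b" if "z \<in> U" for z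
          using that by (auto simp: \<phi>_def wb_def U_def min_def max_def algebra_simps)
        show "\<bar>w x + \<phi> x - (w y + \<phi> y)\<bar> \<le> \<bar>(1 - e) * min (w x) b + max (w x) b + e * b * \<eta> x -
           ((1 - e) * min (w y) b + max (w y) b + e * b * \<eta> y)\<bar>"
          using eq[OF xy(1)] eq[OF xy(2)] by linarith
      qed auto
    qed
    have locH: "Lp_loc M p U H"
    proof (rule Lp_loc_mono[of U "\<lambda>x. g x + ennreal (b * \<kappa>) * indicator B x"])
      show "Lp_loc M p U (\<lambda>x. g x + ennreal (b * \<kappa>) * indicator B x)"
        using b_pos \<open>0 \<le> \<kappa>\<close> by (intro Lp_loc_add g_loc B_fin) auto
      show "H x \<le> g x + ennreal (b * \<kappa>) * indicator B x" for x
      proof -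
        have "ennreal (1 - e * indicator A x) * g x \<le> ennreal 1 * g x"
          using e by (intro mult_right_mono ennreal_leI) (auto split: split_indicator)
        moreover have "ennreal (e * k x) \<le> ennreal (k x)"
          using e k_nonneg[of x] by (intro ennreal_leI) (auto intro: mult_left_le_one_le)
        ultimately show ?thesis unfolding H_def k_eq by (simp add: add_mono)
      qed
    qed
    obtain h where h: "minimal_wug M p U (\<lambda>x. w x + \<phi> x) h"
      using ex_minimal_wug[OF open_U ugH locH] by blast
    have AE: "AE x in M. x \<in> U \<longrightarrow> h x \<le> H x"
      using h ugH locH unfolding minimal_wug_def by blast
    have S_eq: "{x\<in>U. \<phi> x \<noteq> 0} = S"
      using e by (auto simp: \<phi>_def S_def)
    have "(\<integral>\<^sup>+x\<in>S. epow (g x) p \<partial>M) \<le> (\<integral>\<^sup>+x\<in>S. epow (h x) p \<partial>M)"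
      using harmonic_w \<open>newton0 M p U \<phi>\<close> minimal_U h unfolding p_harmonic_def S_eq[symmetric] by blast
    also have "\<dots> \<le> (\<integral>\<^sup>+x\<in>S. epow (H x) p \<partial>M)"
    proof (rule nn_integral_mono_AE, use AE in eventually_elim)
      fix x assume "x \<in> U \<longrightarrow> h x \<le> H x"
      then show "epow (h x) p * indicator S x \<le> epow (H x) p * indicator S x"
        by (auto simp: S_def intro!: epow_mono p_pos split: split_indicator)
    qed
    finally show ?thesis unfolding H_def .
  qed
  define N where "N = restrict_space M S"
  have N_int: "(\<integral>\<^sup>+x. f x \<partial>N) = (\<integral>\<^sup>+x\<in>S. f x \<partial>M)" for f :: "'a \<Rightarrow> ennreal"
    unfolding N_def by (subst nn_integral_restrict_space) auto
  have N_meas: "f \<in> borel_measurable M \<Longrightarrow> f \<in> borel_measurable N" for f :: "'a \<Rightarrow> real"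
    unfolding N_def by (rule measurable_restrict_space1)
  \<comment> \<open>\<open>enn2real\<close> maps infinite values to 0. On \<open>S\<close> this
    affects a null set only, because the energy of \<open>g\<close> there is finite; the first
    variation then runs with real functions on the restricted space \<open>N\<close>.\<close>
  define gr where "gr x = enn2real (g x)" for x
  have fin: "AE x in M. x \<in> S \<longrightarrow> g x = ennreal (gr x)"
  proof -
    have "AE x in M. epow (g x) p * indicator S x \<noteq> \<infinity>"
      using g_S by (intro nn_integral_PInf_AE) auto
    then show ?thesis
    proof (rule eventually_mono, intro impI)
      fix x assume "epow (g x) p * indicator S x \<noteq> \<infinity>" "x \<in> S"
      then have "g x \<noteq> top" by auto
      then show "g x = ennreal (gr x)" by (simp add: gr_def less_top)
    qed
  qed
  have [measurable]: "gr \<in> borel_measurable M" unfolding gr_def by measurable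
  have [measurable]: "S \<inter> A \<in> sets N" unfolding N_def by (subst sets_restrict_space) auto
  have gr_nonneg: "0 \<le> gr x" for x by (simp add: gr_def)
  have epow_gr: "g x = ennreal (gr x) \<Longrightarrow> epow (g x) q = ennreal (gr x powr q)" for x q
    by (metis epow_ennreal gr_nonneg)
  have g_gr: "(\<integral>\<^sup>+x. ennreal (gr x powr p) \<partial>N) = (\<integral>\<^sup>+x\<in>S. epow (g x) p \<partial>M)"
    unfolding N_int using fin
    by (intro nn_integral_cong_AE) (auto simp: epow_ennreal gr_nonneg split: split_indicator elim!: eventually_mono)
  have "(\<integral>\<^sup>+x. ennreal (gr x powr p * indicator (S \<inter> A) x) \<partial>N) \<le> (\<integral>\<^sup>+x. ennreal (gr x powr (p - 1) * k x) \<partial>N)"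
  proof (rule nn_integral_first_variation[OF p_gt_1])
    have "(\<integral>\<^sup>+x. ennreal ((gr x + k x) powr p) \<partial>N) \<le> (\<integral>\<^sup>+x. epow (ennreal (gr x) * indicator S x + ennreal (k x)) p \<partial>M)"
      unfolding N_int
    proof (rule nn_integral_mono)
      fix x
      show "ennreal ((gr x + k x) powr p) * indicator S x \<le> epow (ennreal (gr x) * indicator S x + ennreal (k x)) p"
        using k_nonneg[of x] by (auto simp: gr_def epow_ennreal split: split_indicator simp flip: ennreal_plus)
    qed
    also have "\<dots> \<le> (\<integral>\<^sup>+x. ennreal (2 powr p) * (epow (ennreal (gr x) * indicator S x) p + epow (ennreal (k x)) p) \<partial>M)"
      by (intro nn_integral_mono epow_add_le p_pos)
    also have "\<dots> = ennreal (2 powr p) * ((\<integral>\<^sup>+x\<in>S. epow (ennreal (gr x)) p \<partial>M) + (\<integral>\<^sup>+x. epow (ennreal (k x)) p \<partial>M))"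
      by (simp add: nn_integral_cmult nn_integral_add epow_mult_indicator)
    also have "(\<integral>\<^sup>+x\<in>S. epow (ennreal (gr x)) p \<partial>M) = (\<integral>\<^sup>+x\<in>S. epow (g x) p \<partial>M)"
      unfolding g_gr[symmetric] N_int by (simp add: epow_ennreal gr_def)
    also have "ennreal (2 powr p) * ((\<integral>\<^sup>+x\<in>S. epow (g x) p \<partial>M) + (\<integral>\<^sup>+x. epow (ennreal (k x)) p \<partial>M)) < \<infinity>"
      unfolding k_eq using g_S B_fin[of "b * \<kappa>"] b_pos \<open>0 \<le> \<kappa>\<close> by (simp add: ennreal_mult_less_top)
    finally show "(\<integral>\<^sup>+x. ennreal ((gr x + k x) powr p) \<partial>N) < \<infinity>" .
  next
    fix e :: real assume e: "0 < e" "e < 1"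
    have "(\<integral>\<^sup>+x. ennreal (gr x powr p) \<partial>N) \<le> (\<integral>\<^sup>+x\<in>S. epow (ennreal (1 - e * indicator A x) * g x + ennreal (e * k x)) p \<partial>M)"
      unfolding g_gr by (rule minimal_energy[OF e])
    also have "\<dots> = (\<integral>\<^sup>+x. ennreal (((1 - e * indicator (S \<inter> A) x) * gr x + e * k x) powr p) \<partial>N)"
      unfolding N_int
    proof (rule nn_integral_cong_AE, use fin in eventually_elim)
      fix x assume *: "x \<in> S \<longrightarrow> g x = ennreal (gr x)"
      show "epow (ennreal (1 - e * indicator A x) * g x + ennreal (e * k x)) p * indicator S x =
         ennreal (((1 - e * indicator (S \<inter> A) x) * gr x + e * k x) powr p) * indicator S x"
      proof (cases "x \<in> S")
        case True
        have nn: "0 \<le> 1 - e * indicator A x" "0 \<le> gr x" "0 \<le> e * k x"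
          using e k_nonneg[of x] by (auto simp: gr_def split: split_indicator)
        have "ennreal (1 - e * indicator A x) * g x + ennreal (e * k x) =
            ennreal ((1 - e * indicator A x) * gr x + e * k x)"
          using * True nn by (simp add: ennreal_mult ennreal_plus)
        then have "epow (ennreal (1 - e * indicator A x) * g x + ennreal (e * k x)) p =
            ennreal (((1 - e * indicator A x) * gr x + e * k x) powr p)"
          using nn by (metis epow_ennreal add_nonneg_nonneg mult_nonneg_nonneg)
        then show ?thesis using True by (simp add: indicator_inter_arith)
      qed simp
    qed
    finally show "(\<integral>\<^sup>+x. ennreal (gr x powr p) \<partial>N)
        \<le> (\<integral>\<^sup>+x. ennreal (((1 - e * indicator (S \<inter> A) x) * gr x + e * k x) powr p) \<partial>N)" .
  qed (auto simp: k_nonneg gr_def[of _] intro!: N_meas)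
  moreover have "(\<integral>\<^sup>+x. ennreal (gr x powr p * indicator (S \<inter> A) x) \<partial>N) = (\<integral>\<^sup>+x\<in>A \<inter> S. epow (g x) p \<partial>M)"
    unfolding N_int using fin
    by (intro nn_integral_cong_AE) (auto simp: epow_ennreal gr_nonneg split: split_indicator elim!: eventually_mono)
  moreover have "(\<integral>\<^sup>+x. ennreal (gr x powr (p - 1) * k x) \<partial>N) \<le> (\<integral>\<^sup>+x. ennreal (b * \<kappa>) * (epow (g x) (p - 1) * indicator (B \<inter> U) x) \<partial>M)"
    unfolding N_int
  proof (rule nn_integral_mono_AE, use fin in eventually_elim)
    fix x assume *: "x \<in> S \<longrightarrow> g x = ennreal (gr x)"
    show "ennreal (gr x powr (p - 1) * k x) * indicator S x \<le> ennreal (b * \<kappa>) * (epow (g x) (p - 1) * indicator (B \<inter> U) x)"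
    proof (cases "x \<in> S \<inter> B")
      case True
      then have "x \<in> U" by (auto simp: S_def)
      have "g x = ennreal (gr x)" "0 \<le> gr x" using * True by (auto simp: gr_def)
      then have "epow (g x) (p - 1) = ennreal (gr x powr (p - 1))" by (intro epow_gr)
      then show ?thesis using True \<open>x \<in> U\<close> b_pos \<open>0 \<le> \<kappa>\<close>
        by (simp add: k_def mult.commute flip: ennreal_mult)
    next
      case False
      then have "k x = 0 \<or> x \<notin> S" by (auto simp: k_def)
      then show ?thesis by auto
    qed
  qed
  moreover have "(\<integral>\<^sup>+x. ennreal (b * \<kappa>) * (epow (g x) (p - 1) * indicator (B \<inter> U) x) \<partial>M) =
      ennreal (b * \<kappa>) * (\<integral>\<^sup>+x\<in>B \<inter> U. epow (g x) (p - 1) \<partial>M)"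
    by (intro nn_integral_cmult) measurable
  ultimately show ?thesis by (simp add: order_trans)
qed

end

context green_setup
begin

text \<open>The variation only sees the energy on \<open>{b \<eta> \<noteq> min u b}\<close>. The exceptional sets of two cutoffs
  whose slopes differ by a factor two are disjoint, so together they see all of \<open>{u < b}\<close>.\<close>
lemma flux_lower_bound:
  assumes "0 < r" "ball x0 (2 * r) \<subseteq> \<Omega>"
  shows "ennreal (r / 4) \<le> (\<integral>\<^sup>+x\<in>ball x0 (2 * r) - {x0}. epow (g x) (p - 1) \<partial>M)"
proof -
  \<comment> \<open>For \<open>1 \<le> j \<le> 2\<close> this is 1 on \<open>ball x0 r\<close>, 0
    outside \<open>ball x0 (2 * r)\<close>, and has slope \<open>j / r \<le> 2 / r\<close> in
    between.\<close>
  define \<eta> where "\<eta> j x = min (max (j * (2 - dist x0 x / r)) 0) 1" for j :: real and x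
  define S where "S j = {x\<in>U. b * \<eta> j x \<noteq> wb x}" for j
  define I where "I = (\<integral>\<^sup>+x\<in>ball x0 (2 * r) \<inter> U. epow (g x) (p - 1) \<partial>M)"
  have \<eta>_meas[measurable]: "\<eta> j \<in> borel_measurable borel" for j
    unfolding \<eta>_def by (intro borel_measurable_continuous_onI continuous_intros) (use assms in auto)
  have flux: "(\<integral>\<^sup>+x\<in>A \<inter> S j. epow (g x) p \<partial>M) \<le> ennreal (b * (2 / r)) * I" if j: "1 \<le> j" "j \<le> 2" for j
    unfolding S_def I_def
  proof (rule flux_through_cutoff[where r' = r])
    show "0 \<le> \<eta> j x" "\<eta> j x \<le> 1" for x by (auto simp: \<eta>_def)
    show "\<eta> j x = 0" if "x \<notin> \<Omega>" for x
    proof -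
      have "2 * r \<le> dist x0 x" using that assms(2) by (auto simp: subset_iff not_less)
      then have "2 - dist x0 x / r \<le> 0" using assms(1) by (simp add: field_simps)
      then have "j * (2 - dist x0 x / r) \<le> 0" using j by (simp add: mult_nonneg_nonpos)
      then show ?thesis by (simp add: \<eta>_def)
    qed
    show "\<eta> j x = 1" if "x \<in> ball x0 r" for x
    proof -
      have "1 \<le> 2 - dist x0 x / r" using that assms(1) by (simp add: field_simps)
      then have "1 * 1 \<le> j * (2 - dist x0 x / r)" using j by (intro mult_mono) auto
      then show ?thesis by (simp add: \<eta>_def)
    qed
    have lip: "\<bar>j * (2 - dist x0 x / r) - j * (2 - dist x0 y / r)\<bar> \<le> 2 / r * dist x y" for x y
    proof -
      have "\<bar>j * (2 - dist x0 x / r) - j * (2 - dist x0 y / r)\<bar> = j / r * \<bar>dist x0 y - dist x0 x\<bar>"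
      proof -
        have "j * (2 - dist x0 x / r) - j * (2 - dist x0 y / r) = j / r * (dist x0 y - dist x0 x)"
          using assms(1) by (simp add: field_simps)
        then show ?thesis using assms(1) j by (simp add: abs_mult)
      qed
      also have "\<dots> \<le> 2 / r * dist x y"
        using assms(1) j dist_triangle[of x0 y x] dist_triangle[of x0 x y]
        by (intro mult_mono divide_right_mono) (auto simp: dist_commute abs_le_iff)
      finally show ?thesis .
    qed
    have "weak_ug M p UNIV (\<lambda>x. j * (2 - dist x0 x / r)) (\<lambda>_. ennreal (2 / r))"
      using assms(1) by (intro weak_ug_lipschitz lip) auto
    moreover have "continuous_on UNIV (\<lambda>x. j * (2 - dist x0 x / r))"
      using assms(1) by (intro continuous_intros) auto
    \<comment> \<open>Truncation at 0 through \<open>weak_ug_max_const\<close> confines the gradient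
      to the ball, which the Lipschitz bound alone does not.\<close>
    ultimately have "weak_ug M p UNIV (\<lambda>x. max (j * (2 - dist x0 x / r)) 0)
        (\<lambda>x. ennreal (2 / r) * indicator {x\<in>UNIV. 0 < j * (2 - dist x0 x / r)} x)"
      by (intro weak_ug_max_const) auto
    also have "{x\<in>UNIV. 0 < j * (2 - dist x0 x / r)} = ball x0 (2 * r)"
      using assms(1) j by (auto simp: zero_less_mult_iff field_simps)
    finally have *: "weak_ug M p UNIV (\<lambda>x. max (j * (2 - dist x0 x / r)) 0)
        (\<lambda>x. ennreal (2 / r) * indicator (ball x0 (2 * r)) x)" .
    show "weak_ug M p UNIV (\<eta> j) (\<lambda>x. ennreal (2 / r) * indicator (ball x0 (2 * r)) x)"
    proof (rule weak_ug_mono[OF *])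
      have "\<bar>min y 1 - min z 1\<bar> \<le> \<bar>y - z\<bar>" for y z :: real by (auto simp: min_def)
      then show "\<bar>\<eta> j x - \<eta> j y\<bar> \<le> \<bar>max (j * (2 - dist x0 x / r)) 0 - max (j * (2 - dist x0 y / r)) 0\<bar>" for x y
        unfolding \<eta>_def .
    qed (use weak_ug_borel[OF *] in auto)
  qed (use assms in auto)
  have cover: "A \<subseteq> S 1 \<union> S 2"
  proof
    fix x assume x: "x \<in> A"
    then have *: "x \<in> U" "0 < w x" "w x < b" "wb x = w x"
      using w_pos[of x] by (auto simp: A_def wb_def U_def)
    show "x \<in> S 1 \<union> S 2"
    proof (rule ccontr)
      assume "x \<notin> S 1 \<union> S 2"
      \<comment> \<open>In a common point both cutoffs have the same value strictly between 0 and 1,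
        but doubling the slope strictly raises such a value.\<close>
      then have eq: "b * \<eta> 1 x = w x" "b * \<eta> 2 x = w x" using * by (auto simp: S_def)
      then have "\<eta> 1 x = \<eta> 2 x" using b_pos by (metis mult_left_cancel less_irrefl)
      moreover have "0 < \<eta> 1 x" using eq * b_pos by (metis zero_less_mult_pos)
      moreover have "\<eta> 1 x < 1" using eq * b_pos
        by (metis mult_less_cancel_left_pos mult.right_neutral)
      ultimately show False by (auto simp: \<eta>_def min_def max_def split: if_splits)
    qed
  qed
  have S_meas[measurable]: "S j \<in> sets M" for j
  proof -
    note [measurable] = borel_measurable_M[OF wb_borel] borel_measurable_M[OF \<eta>_meas]
    have "S j = U \<inter> {x \<in> space M. b * \<eta> j x \<noteq> wb x}" by (auto simp: S_def space_UNIV)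
    also have "\<dots> \<in> sets M" by measurable
    finally show ?thesis .
  qed
  have "ennreal b \<le> (\<integral>\<^sup>+x\<in>A. epow (g x) p \<partial>M)" by (rule energy_A_ge)
  also have "\<dots> \<le> (\<integral>\<^sup>+x. epow (g x) p * indicator (A \<inter> S 1) x + epow (g x) p * indicator (A \<inter> S 2) x \<partial>M)"
    using cover by (intro nn_integral_mono) (auto split: split_indicator)
  also have "\<dots> = (\<integral>\<^sup>+x\<in>A \<inter> S 1. epow (g x) p \<partial>M) + (\<integral>\<^sup>+x\<in>A \<inter> S 2. epow (g x) p \<partial>M)"
    by (intro nn_integral_add) measurable
  also have "\<dots> \<le> ennreal (b * (2 / r)) * I + ennreal (b * (2 / r)) * I"
    by (intro add_mono flux) auto
  \<comment> \<open>Each cutoff contributes at most \<open>2 * b / r\<close> times the flux.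
    Dividing \<open>b\<close> by the sum \<open>4 * b / r\<close> removes the level and leaves
    \<open>r / 4\<close>.\<close>
  also have "\<dots> = ennreal (4 * b / r) * I"
    using assms(1) b_pos by (simp flip: distrib_right ennreal_plus)
  finally have "ennreal (r / (4 * b)) * ennreal b \<le> ennreal (r / (4 * b)) * (ennreal (4 * b / r) * I)"
    by (intro mult_left_mono) auto
  also have "\<dots> = ennreal (r / (4 * b) * (4 * b / r)) * I"
    using assms(1) b_pos by (subst ennreal_mult) (auto simp: mult.assoc)
  also have "r / (4 * b) * (4 * b / r) = 1" using assms(1) b_pos by simp
  also have "ennreal (r / (4 * b)) * ennreal b = ennreal (r / 4)"
    using assms(1) b_pos by (simp flip: ennreal_mult)
  also have "I = (\<integral>\<^sup>+x\<in>ball x0 (2 * r) - {x0}. epow (g x) (p - 1) \<partial>M)"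
  proof -
    have "ball x0 (2 * r) \<inter> U = ball x0 (2 * r) - {x0}" using assms(2) by (auto simp: U_def)
    then show ?thesis by (simp add: I_def)
  qed
  finally show ?thesis by simp
qed

end

section \<open>From the flux bound to the growth of the measure of balls\<close>

lemma epow_young:
  assumes "1 < p" "p - 1 < t" "0 < c"
  shows "epow x (p - 1) \<le> ennreal c + ennreal (c powr (- ((t - p + 1) / (p - 1)))) * epow x t"
proof (cases x rule: ennreal_cases)
  case (real a)
  define \<kappa> where "\<kappa> = (t - p + 1) / (p - 1)"
  have \<kappa>: "0 < \<kappa>" "t = (p - 1) * (1 + \<kappa>)" using assms by (auto simp: \<kappa>_def field_simps)
  have "a powr (p - 1) \<le> c + c powr (- \<kappa>) * a powr t"
  \<comment> \<open>Where \<open>a powr (p - 1)\<close> exceeds \<open>c\<close>, multiplying it by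
    the \<open>\<kappa>\<close>-th power of its ratio to \<open>c\<close> only increases it;
    \<open>\<kappa>\<close> satisfies \<open>(p - 1) * (1 + \<kappa>) = t\<close>.\<close>
  proof (cases "a powr (p - 1) \<le> c")
    case True
    then show ?thesis by (simp add: add_increasing2)
  next
    case False
    then have "1 * a powr (p - 1) \<le> (c powr (- \<kappa>) * (a powr (p - 1)) powr \<kappa>) * a powr (p - 1)"
    proof (intro mult_right_mono)
      have "c powr (- \<kappa>) * c powr \<kappa> \<le> c powr (- \<kappa>) * (a powr (p - 1)) powr \<kappa>"
        using False assms \<kappa> by (intro mult_left_mono powr_mono2) auto
      then show "1 \<le> c powr (- \<kappa>) * (a powr (p - 1)) powr \<kappa>"
        using assms(3) by (simp flip: powr_add)
    qed auto
    also have "\<dots> = c powr (- \<kappa>) * a powr t"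
    proof -
      have "t = (p - 1) * \<kappa> + (p - 1)" using \<kappa>(2) by (simp add: algebra_simps)
      then have "a powr t = (a powr (p - 1)) powr \<kappa> * a powr (p - 1)"
        by (simp add: powr_powr powr_add)
      then show ?thesis by simp
    qed
    finally show ?thesis using assms(3) by simp
  qed
  then show ?thesis using real assms
    by (simp add: epow_ennreal \<kappa>_def flip: ennreal_mult ennreal_plus)
next
  case top
  then show ?thesis using assms by (simp add: ennreal_mult_top)
qed

text \<open>The bound on the integral over a ball is used twice. Against the total integral it keeps
  \<open>\<rho> powr s / m \<rho>\<close> bounded, which is the upper exponent property. If
  \<open>s\<close> were also a lower exponent, the ratio would stay away from 0, yet the integrals
  over shrinking punctured balls tend to 0.\<close>

lemma growth_of_integrable:
  fixes M :: "'a::metric_space measure"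
  assumes "1 < p" "p - 1 < t" and borel: "sets borel \<subseteq> sets M"
    and balls: "\<And>r. 0 < r \<Longrightarrow> 0 < emeasure M (ball x0 r) \<and> emeasure M (ball x0 r) < \<infinity>"
    and g[measurable]: "g \<in> borel_measurable M" and "0 < \<rho>0" "ball x0 \<rho>0 \<subseteq> \<Omega>"
    and flux: "\<And>\<rho>. 0 < \<rho> \<Longrightarrow> \<rho> \<le> \<rho>0 \<Longrightarrow> ennreal (\<rho> / 8) \<le> (\<integral>\<^sup>+x\<in>ball x0 \<rho> - {x0}. epow (g x) (p - 1) \<partial>M)"
    and fin: "(\<integral>\<^sup>+x\<in>\<Omega> - {x0}. epow (g x) t \<partial>M) < \<infinity>"
  defines "s \<equiv> t / (t - p + 1)"
  shows "s \<in> S0_upper M x0" "s \<notin> S0_lower M x0"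
proof -
  define \<kappa> where "\<kappa> = (t - p + 1) / (p - 1)"
  have \<kappa>: "0 < \<kappa>" "0 < s" using assms(1,2) by (auto simp: \<kappa>_def s_def)
  have s\<kappa>: "s * \<kappa> = 1 + \<kappa>"
  proof -
    have "s * \<kappa> = t / (p - 1)" using assms(1,2) by (simp add: \<kappa>_def s_def)
    also have "\<dots> = 1 + \<kappa>" using assms(1) by (simp add: \<kappa>_def field_simps)
    finally show ?thesis .
  qed
  define m where "m \<rho> = measure M (ball x0 \<rho>)" for \<rho>
  have m: "0 < m \<rho>" "emeasure M (ball x0 \<rho>) = ennreal (m \<rho>)" if "0 < \<rho>" for \<rho>
  proof -
    have "emeasure M (ball x0 \<rho>) \<noteq> top" using balls[OF that] by (metis infinity_ennreal_def less_irrefl)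
    then show *: "emeasure M (ball x0 \<rho>) = ennreal (m \<rho>)"
      unfolding m_def by (rule emeasure_eq_ennreal_measure)
    show "0 < m \<rho>" using balls[OF that] unfolding * by simp
  qed
  have [measurable]: "ball x0 \<rho> \<in> sets M" "{x0} \<in> sets M" for \<rho>
    using borel by auto
  define I where "I \<rho> = (\<integral>\<^sup>+x\<in>ball x0 \<rho> - {x0}. epow (g x) t \<partial>M)" for \<rho>
  have I_le: "I \<rho> \<le> (\<integral>\<^sup>+x\<in>\<Omega> - {x0}. epow (g x) t \<partial>M)" if "\<rho> \<le> \<rho>0" for \<rho>
    unfolding I_def using that assms(7)
    by (intro nn_integral_mono) (auto split: split_indicator simp: subset_iff)
  have I_ge: "ennreal ((\<rho> / 16) * (\<rho> / (16 * m \<rho>)) powr \<kappa>) \<le> I \<rho>" if \<rho>: "0 < \<rho>" "\<rho> \<le> \<rho>0" for \<rho>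
  proof -
    \<comment> \<open>With this choice the constant term of Young's inequality integrates to
      \<open>\<rho> / 16\<close>, half of the flux bound \<open>\<rho> / 8\<close>, so the other
      half must come from \<open>I\<close>.\<close>
    define c where "c = \<rho> / (16 * m \<rho>)"
    have c: "0 < c" "c * m \<rho> = \<rho> / 16" using m[OF \<rho>(1)] \<rho> by (auto simp: c_def)
    have "I \<rho> < \<infinity>" using I_le[OF \<rho>(2)] fin by (rule le_less_trans)
    then obtain i where i: "I \<rho> = ennreal i" "0 \<le> i" by (cases "I \<rho>" rule: ennreal_cases) auto
    have "ennreal (\<rho> / 8) \<le> (\<integral>\<^sup>+x\<in>ball x0 \<rho> - {x0}. epow (g x) (p - 1) \<partial>M)" by (rule flux[OF \<rho>])
    also have "\<dots> \<le> (\<integral>\<^sup>+x. ennreal c * indicator (ball x0 \<rho>) x + ennreal (c powr (- \<kappa>)) * (epow (g x) t * indicator (ball x0 \<rho> - {x0}) x) \<partial>M)"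
      using epow_young[OF assms(1,2) c(1)] unfolding \<kappa>_def
      by (intro nn_integral_mono) (auto split: split_indicator)
    also have "\<dots> = ennreal c * ennreal (m \<rho>) + ennreal (c powr (- \<kappa>)) * I \<rho>"
      unfolding I_def m(2)[OF \<rho>(1), symmetric]
      by (subst nn_integral_add) (auto simp: nn_integral_cmult nn_integral_cmult_indicator)
    also have "\<dots> = ennreal (\<rho> / 16 + c powr (- \<kappa>) * i)"
      using c i m(1)[OF \<rho>(1)] \<rho> by (simp flip: ennreal_mult ennreal_plus)
    finally have "\<rho> / 8 \<le> \<rho> / 16 + c powr (- \<kappa>) * i" using i \<rho> by (subst (asm) ennreal_le_iff) auto
    then have "\<rho> / 16 \<le> c powr (- \<kappa>) * i" by simp
    then have "\<rho> / 16 * c powr \<kappa> \<le> (c powr (- \<kappa>) * i) * c powr \<kappa>"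
      by (intro mult_right_mono) auto
    also have "\<dots> = i" using c by (simp add: powr_minus field_simps)
    finally show ?thesis using i by (simp add: c_def ennreal_leI)
  qed
  \<comment> \<open>\<open>s * \<kappa> = 1 + \<kappa>\<close> is the identity that turns the bound
    into a power of \<open>\<rho> powr s / m \<rho>\<close>; this singles out the exponent
    \<open>s\<close>.\<close>
  have rewrite: "(\<rho> / 16) * (\<rho> / (16 * m \<rho>)) powr \<kappa> = (1 / 16) powr (1 + \<kappa>) * (\<rho> powr s / m \<rho>) powr \<kappa>"
    if "0 < \<rho>" for \<rho>
  proof -
    have "(\<rho> / 16) * (\<rho> / (16 * m \<rho>)) powr \<kappa> = (1/16 * (1/16) powr \<kappa>) * ((\<rho> * \<rho> powr \<kappa>) / m \<rho> powr \<kappa>)"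
      using that m(1)[OF that] by (simp add: powr_divide powr_mult)
    also have "\<rho> * \<rho> powr \<kappa> = (\<rho> powr s) powr \<kappa>"
      using that by (simp add: powr_powr s\<kappa> powr_add)
    also have "(\<rho> powr s) powr \<kappa> / m \<rho> powr \<kappa> = (\<rho> powr s / m \<rho>) powr \<kappa>"
      using m(1)[OF that] by (simp add: powr_divide)
    also have "1/16 * (1/16) powr \<kappa> = (1/16::real) powr (1 + \<kappa>)" by (simp add: powr_add)
    finally show ?thesis .
  qed
  define c0 :: real where "c0 = (1 / 16) powr (1 + \<kappa>)"
  have "0 < c0" by (simp add: c0_def)
  have I_ge': "ennreal (c0 * (\<rho> powr s / m \<rho>) powr \<kappa>) \<le> I \<rho>" if "0 < \<rho>" "\<rho> \<le> \<rho>0" for \<rho>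
    using I_ge[OF that] rewrite[OF that(1)] by (simp add: c0_def)
  obtain J where J: "(\<integral>\<^sup>+x\<in>\<Omega> - {x0}. epow (g x) t \<partial>M) = ennreal J" "0 \<le> J"
    using fin by (cases "\<integral>\<^sup>+x\<in>\<Omega> - {x0}. epow (g x) t \<partial>M" rule: ennreal_cases) auto
  define L where "L = ((J + 1) / c0) powr (1 / \<kappa>)"
  have L: "0 < L" "L powr \<kappa> = (J + 1) / c0" using J(2) \<open>0 < c0\<close> \<kappa>(1) by (auto simp: L_def powr_powr)
  have m_ge: "\<rho> powr s / L \<le> m \<rho>" if "0 < \<rho>" "\<rho> \<le> \<rho>0" for \<rho>
  proof -
    have "ennreal (c0 * (\<rho> powr s / m \<rho>) powr \<kappa>) \<le> ennreal J"
      using I_ge'[OF that] I_le[OF that(2)] J(1) by simp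
    then have "c0 * (\<rho> powr s / m \<rho>) powr \<kappa> \<le> J" using J(2) by (simp add: ennreal_le_iff)
    then have "(\<rho> powr s / m \<rho>) powr \<kappa> \<le> L powr \<kappa>"
      unfolding L(2) using \<open>0 < c0\<close> by (simp add: field_simps)
    then have "\<rho> powr s / m \<rho> \<le> L"
      using \<kappa>(1) L(1) powr_less_mono2[of \<kappa> L "\<rho> powr s / m \<rho>"] by linarith
    then show ?thesis using L(1) m(1)[OF that(1)] by (simp add: field_simps)
  qed
  show "s \<in> S0_upper M x0"
    unfolding S0_upper_def
  proof (intro CollectI conjI exI allI impI)
    show "0 < s" by (rule \<kappa>(2))
    \<comment> \<open>The estimate holds up to radius \<open>\<rho>0\<close> only. For larger
      \<open>r \<le> 1\<close> the ball contains \<open>ball x0 \<rho>0\<close>, hence the second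
      entry of the minimum.\<close>
    show "0 < min (1 / L) (m \<rho>0)" using L(1) m(1)[OF assms(6)] by simp
    fix r :: real assume r: "0 < r \<and> r \<le> 1"
    show "ennreal (min (1 / L) (m \<rho>0) * r powr s) \<le> emeasure M (ball x0 r)"
    proof (cases "r \<le> \<rho>0")
      case True
      have "min (1 / L) (m \<rho>0) * r powr s \<le> 1 / L * r powr s" by (intro mult_right_mono) auto
      also have "\<dots> \<le> m r" using m_ge[of r] r True by simp
      finally show ?thesis using m(2)[of r] r by (simp add: ennreal_leI)
    next
      case False
      have "min (1 / L) (m \<rho>0) * r powr s \<le> m \<rho>0 * 1"
        using r \<kappa>(2) m(1)[OF assms(6)] L(1) by (intro mult_mono) (auto intro!: powr_le1)
      then have "ennreal (min (1 / L) (m \<rho>0) * r powr s) \<le> emeasure M (ball x0 \<rho>0)"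
        using m(2)[OF assms(6)] by (simp add: ennreal_leI)
      also have "\<dots> \<le> emeasure M (ball x0 r)" using False by (intro emeasure_mono) auto
      finally show ?thesis .
    qed
  qed
  show "s \<notin> S0_lower M x0"
  proof
    assume "s \<in> S0_lower M x0"
    then obtain C where C: "0 < C" "\<And>r. 0 < r \<Longrightarrow> r \<le> 1 \<Longrightarrow> emeasure M (ball x0 r) \<le> ennreal (C * r powr s)"
      unfolding S0_lower_def by auto
    define \<rho> where "\<rho> n = min 1 \<rho>0 / real (Suc n)" for n
    have \<rho>: "0 < \<rho> n" "\<rho> n \<le> 1" "\<rho> n \<le> \<rho>0" for n
      using assms(6) by (auto simp: \<rho>_def field_simps min_def add_increasing2 mult_le_cancel_left1)
    have low: "ennreal (c0 * (1 / C) powr \<kappa>) \<le> I (\<rho> n)" for n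
    proof -
      have "m (\<rho> n) \<le> C * \<rho> n powr s"
        using C(2)[OF \<rho>(1,2)] m(2)[OF \<rho>(1)] C(1) by (simp add: ennreal_le_iff)
      then have "1 / C \<le> \<rho> n powr s / m (\<rho> n)"
        using C(1) m(1)[OF \<rho>(1), of n] by (simp add: field_simps)
      then have "c0 * (1 / C) powr \<kappa> \<le> c0 * (\<rho> n powr s / m (\<rho> n)) powr \<kappa>"
        using \<open>0 < c0\<close> C(1) \<kappa>(1) by (intro mult_left_mono powr_mono2) auto
      then show ?thesis using I_ge'[OF \<rho>(1,3)] ennreal_leI order_trans by blast
    qed
    \<comment> \<open>The punctured balls decrease to the empty set and the first integral is
      finite, so the infimum may be taken under the integral.\<close>
    have "(INF n. I (\<rho> n)) = (\<integral>\<^sup>+x. (INF n. epow (g x) t * indicator (ball x0 (\<rho> n) - {x0}) x) \<partial>M)"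
      unfolding I_def
    proof (rule nn_integral_monotone_convergence_INF_decseq[symmetric])
      have dec: "\<rho> (Suc n) \<le> \<rho> n" for n
        using assms(6) unfolding \<rho>_def by (intro divide_left_mono) auto
      show "decseq (\<lambda>n x. epow (g x) t * indicator (ball x0 (\<rho> n) - {x0}) x)"
        by (intro decseq_SucI le_funI mult_left_mono)
          (auto split: split_indicator intro: less_le_trans[OF _ dec])
      show "(\<integral>\<^sup>+x\<in>ball x0 (\<rho> 0) - {x0}. epow (g x) t \<partial>M) < \<infinity>"
        using I_le[OF \<rho>(3)] fin unfolding I_def by (rule le_less_trans)
    qed measurable
    also have "\<dots> = (\<integral>\<^sup>+x. 0 \<partial>M)"
    proof (rule nn_integral_cong)
      fix x
      have "\<exists>n. x \<notin> ball x0 (\<rho> n) - {x0}"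
      proof (cases "x = x0")
        case False
        then obtain n where "1 / real (Suc n) < dist x0 x"
          using nat_approx_posE[of "dist x0 x"] by auto
        moreover have "\<rho> n \<le> 1 / real (Suc n)" unfolding \<rho>_def by (intro divide_right_mono) auto
        ultimately show ?thesis by (intro exI[of _ n]) auto
      qed auto
      then obtain n where n: "x \<notin> ball x0 (\<rho> n) - {x0}" by blast
      have "(INF n. epow (g x) t * indicator (ball x0 (\<rho> n) - {x0}) x) \<le> epow (g x) t * indicator (ball x0 (\<rho> n) - {x0}) x"
        by (intro INF_lower) auto
      also have "\<dots> = 0" using n by simp
      finally show "(INF n. epow (g x) t * indicator (ball x0 (\<rho> n) - {x0}) x) = 0" by simp
    qed
    finally have "(INF n. I (\<rho> n)) = 0" by simp
    moreover have "ennreal (c0 * (1 / C) powr \<kappa>) \<le> (INF n. I (\<rho> n))"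
      using low by (intro INF_greatest)
    ultimately have "c0 * (1 / C) powr \<kappa> \<le> 0" by (simp add: ennreal_eq_0_iff)
    moreover have "0 < c0 * (1 / C) powr \<kappa>" using \<open>0 < c0\<close> C(1) by simp
    ultimately show False by linarith
  qed
qed

section \<open>Doubling measures\<close>

lemma doubling_iterate:
  fixes M :: "'a::metric_space measure"
  assumes "\<And>x r. 0 < r \<Longrightarrow> emeasure M (ball x (2 * r)) \<le> ennreal C * emeasure M (ball x r)" "0 < r"
  shows "emeasure M (ball x (2 ^ k * r)) \<le> ennreal C ^ k * emeasure M (ball x r)"
proof (induction k)
  case (Suc k)
  have "emeasure M (ball x (2 ^ Suc k * r)) = emeasure M (ball x (2 * (2 ^ k * r)))" by (simp add: mult.assoc)
  also have "\<dots> \<le> ennreal C * emeasure M (ball x (2 ^ k * r))" using assms(2) by (intro assms(1)) simp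
  also have "\<dots> \<le> ennreal C * (ennreal C ^ k * emeasure M (ball x r))" by (intro mult_left_mono Suc.IH) simp
  finally show ?case by (simp add: mult.assoc)
qed simp

text \<open>Volume packing: the balls of radius \<open>e / 2\<close> around the points are disjoint
  inside \<open>?R\<close>, and \<open>k\<close> doublings of any of them cover \<open>?R\<close>,
  so each carries at least the fraction \<open>C ^ (-k)\<close> of its measure.\<close>

lemma doubling_imp_card_separated_le:
  fixes M :: "'a::metric_space measure" and x :: 'a
  assumes borel: "sets borel \<subseteq> sets M"
    and balls: "\<And>x r. 0 < r \<Longrightarrow> 0 < emeasure M (ball x r) \<and> emeasure M (ball x r) < \<infinity>"
    and dbl: "\<And>x r. 0 < r \<Longrightarrow> emeasure M (ball x (2 * r)) \<le> ennreal C * emeasure M (ball x r)"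
    and F: "finite F" "F \<subseteq> cball x r" "\<And>y z. y \<in> F \<Longrightarrow> z \<in> F \<Longrightarrow> y \<noteq> z \<Longrightarrow> e \<le> dist y z"
    and "0 < e" "0 \<le> r" "2 * r + 2 * e \<le> 2 ^ k * (e / 2)"
  shows "of_nat (card F) \<le> ennreal C ^ k"
proof -
  let ?R = "ball x (r + e)"
  have disj: "disjoint_family_on (\<lambda>y. ball y (e / 2)) F"
    unfolding disjoint_family_on_def
  proof (intro ballI impI)
    fix y z assume yz: "y \<in> F" "z \<in> F" "y \<noteq> z"
    have False if "v \<in> ball y (e / 2)" "v \<in> ball z (e / 2)" for v
      using that F(3)[OF yz] dist_triangle[of y z v] by (simp add: dist_commute)
    then show "ball y (e / 2) \<inter> ball z (e / 2) = {}" by blast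
  qed
  have "of_nat (card F) * emeasure M ?R = (\<Sum>y\<in>F. emeasure M ?R)" by simp
  also have "\<dots> \<le> (\<Sum>y\<in>F. ennreal C ^ k * emeasure M (ball y (e / 2)))"
  proof (rule sum_mono)
    fix y assume "y \<in> F"
    then have y: "dist x y \<le> r" using F(2) by auto
    have "?R \<subseteq> ball y (2 ^ k * (e / 2))"
    proof
      fix v assume "v \<in> ?R"
      then have "dist y v < 2 * r + 2 * e"
        using y dist_triangle[of y v x] \<open>0 < e\<close> by (simp add: dist_commute)
      then show "v \<in> ball y (2 ^ k * (e / 2))" using assms(9) by simp
    qed
    then have "emeasure M ?R \<le> emeasure M (ball y (2 ^ k * (e / 2)))"
      using borel by (intro emeasure_mono) auto
    also have "\<dots> \<le> ennreal C ^ k * emeasure M (ball y (e / 2))"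
      using \<open>0 < e\<close> by (intro doubling_iterate dbl) auto
    finally show "emeasure M ?R \<le> ennreal C ^ k * emeasure M (ball y (e / 2))" .
  qed
  also have "\<dots> = ennreal C ^ k * (\<Sum>y\<in>F. emeasure M (ball y (e / 2)))" by (simp add: sum_distrib_left)
  also have "(\<Sum>y\<in>F. emeasure M (ball y (e / 2))) = emeasure M (\<Union>y\<in>F. ball y (e / 2))"
    using borel disj F(1) by (intro sum_emeasure) auto
  also have "\<dots> \<le> emeasure M ?R"
  proof (rule emeasure_mono)
    show "(\<Union>y\<in>F. ball y (e / 2)) \<subseteq> ?R"
    proof (intro UN_least subsetI)
      fix y v assume "y \<in> F" "v \<in> ball y (e / 2)"
      then have "dist x y \<le> r" "dist y v < e / 2" using F(2) by auto
      then show "v \<in> ?R" using dist_triangle[of x v y] \<open>0 < e\<close> by simp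
    qed
  qed (use borel in auto)
  finally have *: "of_nat (card F) * emeasure M ?R \<le> ennreal C ^ k * emeasure M ?R"
    by (simp add: mult_left_mono)
  have "0 < emeasure M ?R" "emeasure M ?R < top"
    using balls[of "r + e" x] \<open>0 < e\<close> \<open>0 \<le> r\<close> by auto
  then show ?thesis
    using * ennreal_mult_strict_right_mono[of "ennreal C ^ k" "of_nat (card F)" "emeasure M ?R"]
    by (meson not_less)
qed

text \<open>The packing bound limits the size of \<open>e\<close>-separated sets, so one of largest
  cardinality exists. It is a finite \<open>e\<close>-net, since a point far from it could be added;
  completeness does the rest.\<close>

lemma doubling_imp_compact_cball:
  fixes M :: "'a::complete_space measure"
  assumes borel: "sets borel \<subseteq> sets M"
    and balls: "\<And>x r. 0 < r \<Longrightarrow> 0 < emeasure M (ball x r) \<and> emeasure M (ball x r) < \<infinity>"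
    and "doubling M"
  shows "compact (cball x r :: 'a set)"
proof (cases "0 \<le> r")
  case True
  obtain C where dbl: "\<And>x r. 0 < r \<Longrightarrow> emeasure M (ball x (2 * r)) \<le> ennreal C * emeasure M (ball x r)"
    using \<open>doubling M\<close> unfolding doubling_def by blast
  have "\<exists>K. finite K \<and> cball x r \<subseteq> (\<Union>y\<in>K. ball y e)" if "0 < e" for e
  proof -
    define sep where "sep F \<longleftrightarrow> finite F \<and> F \<subseteq> cball x r \<and> (\<forall>y\<in>F. \<forall>z\<in>F. y \<noteq> z \<longrightarrow> e \<le> dist y z)" for F
    obtain k where "(2 * r + 2 * e) / (e / 2) < 2 ^ k" using real_arch_pow[of 2] by auto
    then have k: "2 * r + 2 * e \<le> 2 ^ k * (e / 2)" using that by (simp add: field_simps)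
    obtain B :: nat where B: "ennreal C ^ k \<le> of_nat B"
    proof -
      have "ennreal C ^ k < top" by (simp add: power_less_top_ennreal)
      then show ?thesis using that ennreal_Ex_less_of_nat[of "ennreal C ^ k"] by (auto intro: less_imp_le)
    qed
    have bd: "card F \<le> B" if "sep F" for F
    proof -
      have "of_nat (card F) \<le> ennreal C ^ k"
        using that True \<open>0 < e\<close> k unfolding sep_def
        by (intro doubling_imp_card_separated_le[OF borel balls dbl, of F x r e]) auto
      then have "(of_nat (card F) :: ennreal) \<le> of_nat B" using B by (rule order_trans)
      then show ?thesis by simp
    qed
    have "sep {}" by (simp add: sep_def)
    moreover have "\<forall>F. sep F \<longrightarrow> card F < Suc B" using bd by (simp add: less_Suc_eq_le)
    ultimately have "\<exists>F. sep F \<and> (\<forall>G. sep G \<longrightarrow> card G \<le> card F)"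
      by (rule Lattices_Big.ex_has_greatest_nat)
    then obtain F where F: "sep F" "\<And>G. sep G \<Longrightarrow> card G \<le> card F"
      by metis
    have "cball x r \<subseteq> (\<Union>y\<in>F. ball y e)"
    proof
      fix z assume z: "z \<in> cball x r"
      show "z \<in> (\<Union>y\<in>F. ball y e)"
      proof (rule ccontr)
        assume "z \<notin> (\<Union>y\<in>F. ball y e)"
        then have far: "\<And>y. y \<in> F \<Longrightarrow> e \<le> dist y z" by (auto simp: not_less)
        then have "z \<notin> F" using \<open>0 < e\<close> by force
        moreover have "sep (insert z F)" using F(1) z far unfolding sep_def by (auto simp: dist_commute)
        then have "card (insert z F) \<le> card F" by (rule F(2))
        moreover have "finite F" using F(1) by (simp add: sep_def)
        ultimately show False by simp
      qed
    qed
    moreover have "finite F" using F(1) by (simp add: sep_def)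
    ultimately show ?thesis by (intro exI conjI)
  qed
  moreover have "complete (cball x r)" by (simp add: complete_eq_closed)
  ultimately show ?thesis
    unfolding compact_eq_totally_bounded by (intro conjI allI impI)
qed simp

text \<open>The \<open>Inf\<close> of an empty set of reals carries no information, so a member is
  needed. The exponent is \<open>log 2 C\<close>: reaching radius 1 from \<open>r\<close> takes
  about \<open>log 2 (1 / r)\<close> doublings, each costing a factor \<open>C\<close>.\<close>

lemma doubling_imp_S0_upper_nonempty:
  fixes M :: "'a::metric_space measure"
  assumes borel: "sets borel \<subseteq> sets M"
    and balls: "\<And>x r. 0 < r \<Longrightarrow> 0 < emeasure M (ball x r) \<and> emeasure M (ball x r) < \<infinity>"
    and "doubling M"
  shows "S0_upper M x0 \<noteq> {}"
proof -
  obtain C' where C': "\<And>x r. 0 < r \<Longrightarrow> emeasure M (ball x (2 * r)) \<le> ennreal C' * emeasure M (ball x r)"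
    using \<open>doubling M\<close> unfolding doubling_def by blast
  \<comment> \<open>Raising the constant to at least 2 makes \<open>log 2 C\<close> positive, as
    members of \<open>S0_upper\<close> must be.\<close>
  define C where "C = max 2 C'"
  have dbl: "emeasure M (ball x (2 * r)) \<le> ennreal C * emeasure M (ball x r)" if "0 < r" for x r
    using C'[OF that, of x] by (rule order_trans) (auto simp: C_def intro!: mult_right_mono ennreal_leI)
  define s where "s = log 2 C"
  have C: "2 \<le> C" by (simp add: C_def)
  have s: "0 < s" "C = 2 powr s" using C by (auto simp: s_def)
  define m where "m \<rho> = measure M (ball x0 \<rho>)" for \<rho>
  have m: "emeasure M (ball x0 \<rho>) = ennreal (m \<rho>)" if "0 < \<rho>" for \<rho>
    unfolding m_def using balls[OF that, of x0]
    by (intro emeasure_eq_ennreal_measure) (metis infinity_ennreal_def less_irrefl)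
  have m1: "0 < m 1" using balls[of 1 x0] m[of 1] by simp
  have "s \<in> S0_upper M x0"
    unfolding S0_upper_def
  proof (intro CollectI conjI exI allI impI)
    show "0 < s" by fact
    show "0 < m 1 / 2 powr s" using m1 by simp
    fix r :: real assume r: "0 < r \<and> r \<le> 1"
    \<comment> \<open>The number of doublings is rounded up so that
      \<open>1 \<le> 2 ^ k * r \<le> 2\<close>; the excess accounts for the factor
      \<open>2 powr s\<close> in the constant.\<close>
    define k where "k = nat \<lceil>log 2 (1 / r)\<rceil>"
    have "0 \<le> log 2 (1 / r)" using r by simp
    then have k: "log 2 (1 / r) \<le> real k" "real k \<le> log 2 (1 / r) + 1" unfolding k_def by linarith+
    have k1: "1 / r \<le> 2 ^ k"
      using k(1) r by (simp add: log_le_iff powr_realpow)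
    have k2: "2 ^ k \<le> 2 / r"
    proof -
      have "2 powr real k \<le> 2 powr (log 2 (1 / r) + 1)" using k(2) by simp
      also have "\<dots> = 2 / r" using r by (simp add: powr_add)
      finally show ?thesis by (simp add: powr_realpow)
    qed
    have "emeasure M (ball x0 1) \<le> emeasure M (ball x0 (2 ^ k * r))"
      using k1 r borel by (intro emeasure_mono subset_ball) (auto simp: field_simps)
    also have "\<dots> \<le> ennreal C ^ k * emeasure M (ball x0 r)" using r by (intro doubling_iterate dbl) auto
    finally have "ennreal (m 1) \<le> ennreal (C ^ k * m r)"
      using C r m by (simp add: ennreal_mult ennreal_power m_def)
    then have "m 1 \<le> C ^ k * m r" by (subst (asm) ennreal_le_iff) (use C in \<open>auto simp: m_def\<close>)
    also have "\<dots> \<le> (2 / r) powr s * m r"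
    proof (rule mult_right_mono)
      have "C ^ k = (2 ^ k) powr s"
        unfolding s(2) by (simp add: powr_powr mult.commute flip: powr_realpow)
      also have "\<dots> \<le> (2 / r) powr s" using k2 s(1) by (intro powr_mono2) auto
      finally show "C ^ k \<le> (2 / r) powr s" .
    qed (simp add: m_def)
    also have "(2 / r) powr s = 2 powr s / r powr s" using r by (simp add: powr_divide)
    finally have "m 1 / 2 powr s * r powr s \<le> m r" using r by (simp add: field_simps)
    then show "ennreal (m 1 / 2 powr s * r powr s) \<le> emeasure M (ball x0 r)"
      using m[of r] r by (simp add: ennreal_leI)
  qed
  then show ?thesis by blast
qed

section \<open>The critical exponent and the three cases\<close>

theorem theorem10p3:
  fixes M :: "'a::complete_space measure"
    and p :: real and x0 :: 'a and \<Omega> :: "'a set" and u :: "'a \<Rightarrow> ereal"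
  assumes p: "1 < p"
    and space: "space M = UNIV"
    and borel: "sets borel \<subseteq> sets M"
    and complete: "complete_measure M"
    and balls: "\<And>x r. 0 < r \<Longrightarrow> 0 < emeasure M (ball x r) \<and> emeasure M (ball x r) < \<infinity>"
    and doubling: "doubling M"
    and PI: "poincare_global M p"
    and dom: "open \<Omega>" "connected \<Omega>" "bounded \<Omega>" "x0 \<in> \<Omega>"
    and green: "green_fun M p \<Omega> x0 u"
  defines "s0 \<equiv> s0_upper M x0" and "q0 \<equiv> q0_lower M x0"
  defines "tp \<equiv> s0 * (p - 1) / (s0 - 1)" and "qhat \<equiv> q0 + 1 - q0 / s0"
  defines "gu_notin_L \<equiv> \<lambda>t. \<forall>g. minimal_wug M p (\<Omega> - {x0}) (\<lambda>x. real_of_ereal (u x)) g \<longrightarrow>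
                          (\<integral>\<^sup>+ x \<in> \<Omega> - {x0}. epow (g x) t \<partial>M) = \<infinity>"
  shows
    "(p < s0 \<longrightarrow> (\<forall>t. poincare_at M t x0 \<and> tp < t \<and> 1 \<le> t \<longrightarrow> gu_notin_L t))
     \<and> (p < qhat \<and> 1 \<le> tp \<and> (s0 \<in> S0_upper M x0 \<longrightarrow> s0 \<in> S0_lower M x0) \<longrightarrow>
          (poincare_at M tp x0 \<longrightarrow> gu_notin_L tp))
     \<and> (qhat \<le> p \<and> p < s0 \<and> (s0 \<in> S0_upper M x0 \<longrightarrow> s0 \<in> S0_lower M x0) \<and> 1 < q0 \<longrightarrow>
          (\<forall>t0. poincare_at M t0 x0 \<and> 1 \<le> t0 \<and> t0 < tp \<longrightarrow> gu_notin_L tp))"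
proof -
  interpret proper_metric_measure M p
  proof
    show "emeasure M (ball x r) < \<infinity>" for x r
      using balls[of r x] by (cases "0 < r") (auto simp: not_less ball_empty)
  qed (use p space borel doubling_imp_compact_cball[OF borel balls doubling] in auto)
  have "0 < u x0" using green dom(4) unfolding green_fun_def singular_fun_def by blast
  \<comment> \<open>Any level below \<open>u x0\<close> will do, since the flux bound is independent
    of it.\<close>
  then obtain b where b: "0 < b" "ereal b < u x0"
    using ereal_dense2[of 0 "u x0"] by auto
  obtain \<rho>0 where \<rho>0: "0 < \<rho>0" "ball x0 \<rho>0 \<subseteq> \<Omega>" using dom(1,4) by (meson openE)
  have growth: "t / (t - p + 1) \<in> S0_upper M x0 \<and> t / (t - p + 1) \<notin> S0_lower M x0"
    if t: "p - 1 < t" and "\<not> gu_notin_L t" for t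
  proof -
    from that obtain g where g: "minimal_wug M p (\<Omega> - {x0}) (\<lambda>x. real_of_ereal (u x)) g"
      and fin: "(\<integral>\<^sup>+ x \<in> \<Omega> - {x0}. epow (g x) t \<partial>M) < \<infinity>"
      unfolding gu_notin_L_def by (auto simp: less_top)
    interpret green_setup M p \<Omega> x0 u g b
      by standard (use p dom green g b in auto)
    \<comment> \<open>Half the radius goes into \<open>flux_lower_bound\<close>, which turns
      \<open>r / 4\<close> into \<open>\<rho> / 8\<close>.\<close>
    have "ennreal (\<rho> / 8) \<le> (\<integral>\<^sup>+x\<in>ball x0 \<rho> - {x0}. epow (g x) (p - 1) \<partial>M)" if "0 < \<rho>" "\<rho> \<le> \<rho>0" for \<rho>
      using flux_lower_bound[of "\<rho> / 2"] that \<rho>0(2) subset_ball[OF that(2), of x0] by simp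
    then show ?thesis
      using growth_of_integrable[OF p t borel balls g_borel(2) \<rho>0 _ fin] by auto
  qed
  have s0_le: "s0 \<le> s" if "s \<in> S0_upper M x0" for s
    unfolding s0_def s0_upper_def using that
    by (intro cInf_lower bdd_belowI[of _ 0]) (auto simp: S0_upper_def)
  have s0_nonneg: "0 \<le> s0"
    unfolding s0_def s0_upper_def using doubling_imp_S0_upper_nonempty[OF borel balls doubling]
    by (intro cInf_greatest) (auto simp: S0_upper_def)
  have tp: "p - 1 < tp" "tp / (tp - p + 1) = s0" if "1 < s0"
  proof -
    have eq: "tp - p + 1 = (p - 1) / (s0 - 1)" unfolding tp_def using that by (simp add: field_simps)
    have pos: "0 < (p - 1) / (s0 - 1)" using that p by simp
    show "p - 1 < tp" using eq pos by linarith
    show "tp / (tp - p + 1) = s0" unfolding eq using that p by (simp add: tp_def)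
  qed
  \<comment> \<open>At \<open>t = tp\<close> the exponent is \<open>s0\<close> itself, so
    integrability would put \<open>s0\<close> into the upper set and keep it out of the lower one,
    the very situation excluded by assumption.\<close>
  have critical: "gu_notin_L tp" if "1 < s0" "s0 \<in> S0_upper M x0 \<longrightarrow> s0 \<in> S0_lower M x0"
    using growth[OF tp(1)[OF that(1)]] tp(2)[OF that(1)] that(2) by auto
  \<comment> \<open>Beyond \<open>tp\<close> the exponent \<open>t / (t - p + 1)\<close> drops
    strictly below \<open>s0\<close>, contradicting that \<open>s0\<close> is the infimum of the
    upper set.\<close>
  have supercritical: "gu_notin_L t" if "1 < s0" "tp < t" for t
  proof (rule ccontr)
    assume "\<not> gu_notin_L t"
    moreover have t: "p - 1 < t" using tp(1)[OF that(1)] that(2) by linarith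
    ultimately have "s0 \<le> t / (t - p + 1)" using growth s0_le by blast
    then have "s0 * (t - p + 1) \<le> t" using t by (simp add: pos_le_divide_eq)
    moreover have "s0 * (p - 1) < t * (s0 - 1)"
      using that unfolding tp_def by (simp add: pos_divide_less_eq)
    ultimately show False by (simp add: algebra_simps)
  qed
  \<comment> \<open>For \<open>s0 \<le> 1\<close> the quotient \<open>tp\<close> is not positive; at
    \<open>s0 = 1\<close> it is 0 by the convention for division by zero.\<close>
  have "1 < s0" if "1 \<le> tp"
  proof (rule ccontr)
    assume "\<not> 1 < s0"
    then have "tp \<le> 0"
      unfolding tp_def using s0_nonneg p by (intro divide_nonneg_nonpos mult_nonneg_nonneg) auto
    then show False using that by simp
  qed
  moreover have "1 < s0" if "p < s0" using that p by simp
  ultimately show ?thesis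
    using critical supercritical by blast
qed

end
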